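(* For every $n$ divisible by $6$ there exists a set $P_n=\{z_1,\dots,z_n\}\subset\mathbb C$ of $n$ points with $\operatorname{diam}(P_n)\le 2$ such that, as $n\to\infty$ along multiples of $6$, \[ \frac{\Delta(P_n)}{n^n}\to C_*=\frac{3^{9/4}}{2^3}\exp\left(\frac{\pi^2-2\sqrt3\,\pi}{8}\right)\approx 1.304457. \] Moreover, $\liminf_{n\to\infty}\overline\Delta_{\max}(n)\ge C_*^{1/9}>1$.
   Context: For points $z_1,\dots,z_n\in\mathbb C$, $\Delta(z_1,\dots,z_n)=\prod_{i\neq j}|z_i-z_j|$. $\Delta_{\max}(n)=\sup\{\Delta(z_1,\dots,z_n): \max_{i,j}|z_i-z_j|\le 2\}$ and $\overline\Delta_{\max}(n)=\Delta_{\max}(n)/n^n$. *)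

theory Defs
  imports "HOL-Analysis.Analysis"
begin

text \<open>A tuple of \<open>n\<close> points is a function \<open>z\<close> used only on the indices \<open>1, \<dots>, n\<close>.
  The product runs over ordered pairs, so every distance occurs twice.\<close>

definition Delta :: "nat \<Rightarrow> (nat \<Rightarrow> complex) \<Rightarrow> real" where
  "Delta n z = (\<Prod>i\<in>{1..n}. \<Prod>j\<in>{1..n} - {i}. cmod (z i - z j))"

definition Delta_values :: "nat \<Rightarrow> real set" where
  "Delta_values n = {Delta n z | z. \<forall>i\<in>{1..n}. \<forall>j\<in>{1..n}. cmod (z i - z j) \<le> 2}"

definition Delta_max :: "nat \<Rightarrow> real" where
  "Delta_max n = Sup (Delta_values n)"

text \<open>The supremum is a genuine one: the set is nonempty and bounded above.\<close>

lemma Delta_values_nonempty: "Delta_values n \<noteq> {}"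
proof -
  have "Delta n (\<lambda>_. 0) \<in> Delta_values n"
    unfolding Delta_values_def by fastforce
  then show ?thesis by blast
qed

lemma Delta_values_bdd_above: "bdd_above (Delta_values n)"
proof (rule bdd_aboveI)
  fix x assume "x \<in> Delta_values n"
  then obtain z where z: "\<forall>i\<in>{1..n}. \<forall>j\<in>{1..n}. cmod (z i - z j) \<le> 2"
    and x: "x = Delta n z"
    unfolding Delta_values_def by blast
  have "Delta n z \<le> (\<Prod>i\<in>{1..n}. \<Prod>j\<in>{1..n} - {i}. (2::real))"
    unfolding Delta_def by (intro prod_mono conjI prod_nonneg) (use z in auto)
  then show "x \<le> (\<Prod>i\<in>{1..n}. \<Prod>j\<in>{1..n} - {i}. (2::real))"
    using x by simp
qed

definition Delta_max_bar :: "nat \<Rightarrow> real" where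
  "Delta_max_bar n = Delta_max n / real n ^ n"

definition C_star :: real where
  "C_star = 3 powr (9/4) / 2 ^ 3 * exp ((pi\<^sup>2 - 2 * sqrt 3 * pi) / 8)"

end

theory Submission
  imports Defs "HOL-Computational_Algebra.Polynomial" "HOL-Real_Asymp.Real_Asymp"
begin

text \<open>
  Let \<open>n = 6m\<close>. Cut the \<open>n\<close>-th roots of \<open>-1\<close> into six blocks of \<open>m\<close> consecutive points, rotate
  the blocks alternately by \<open>\<plusminus>\<pi>/2n\<close>, and translate each block by a vector of length of order
  \<open>1/n\<close> so that opposite blocks get the same translation and neighbouring blocks still fit
  together. With circumradius \<open>1 / cos (\<pi>/2n)\<close>, opposite blocks then face each other as in a
  regular polygon with an odd number of vertices, and the diameter is \<open>2\<close>.

  Exactly, \<open>z\<^sub>j = w\<^sub>j + i tan (\<pi>/2n) g\<^sub>j\<close> for a Lipschitz function \<open>g\<close> on the roots \<open>w\<^sub>j\<close>. With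
  \<open>G\<^sub>j\<^sub>l = (g\<^sub>j - g\<^sub>l) / (w\<^sub>j - w\<^sub>l)\<close>, the logarithm of \<open>\<Delta> / n\<^sup>n\<close> is the sum of \<open>Re Ln (1 + i tan (\<pi>/2n) G\<^sub>j\<^sub>l)\<close>.
  Its linear part vanishes and its quadratic part is diagonalised by the discrete Fourier
  transform; by Tannery's theorem it tends to \<open>\<Sum> 9 / (k\<^sup>2 (k + 1))\<close> over \<open>k \<equiv> 3 (mod 6)\<close>, which is
  \<open>ln C\<^sub>*\<close>.

  For even \<open>n\<close>, every third point of the configuration for \<open>3n\<close> is a perturbed \<open>n\<close>-gon of
  diameter at most \<open>2\<close> with one third of the amplitude, hence one ninth of the quadratic gain. For
  odd \<open>n\<close> the regular \<open>n\<close>-gon of diameter \<open>2\<close> is better still.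
\<close>

subsection \<open>Sums over grids of roots of unity\<close>

text \<open>For even \<open>n\<close> the regular \<open>n\<close>-gon has antipodal pairs, which
  force circumradius 1 and the value \<open>n^n\<close>. Opposite blocks are three apart, so
  alternating rotations turn them against each other by half a spacing, and no antipodal pair
  survives. With displacements of order \<open>1/n\<close>, each of the about \<open>n^2\<close>
  pairs contributes order \<open>1/n^2\<close> to the quadratic part, so that part stays of order
  one while the cubic remainder is \<open>O(1/n)\<close>, provided that all chord quotients are
  bounded. Hence \<open>g\<close> must be Lipschitz across the block ends too, and this fixes the
  length of the translations. The linear part vanishes because \<open>g / w\<close> changes sign
  from each block to the next; the same sign rule leaves only the frequencies \<open>k\<close>
  congruent to 3 modulo 6. The factor one ninth needs no second Fourier computation. Nine pairs of
  fine nodes lie next to each pair of coarse nodes and have almost the same chord quotient, so the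
  fine form is nine times the coarse one up to \<open>O(m log m)\<close>, which is negligible
  against \<open>m^2\<close>.\<close>

lemma cis_root_ne_1:
  assumes "0 < p" "p < n"
  shows "cis (2 * pi * real p / real n) \<noteq> 1"
proof
  assume "cis (2 * pi * real p / real n) = 1"
  then have "cis (2 * pi * real p / real n) = cis (2 * pi * real 0 / real n)" by simp
  moreover have "inj_on (\<lambda>k. cis (2 * pi * real k / real n)) {..<n}"
    using Complex.bij_betw_roots_unity[of n] assms by (auto simp: bij_betw_def)
  ultimately have "p = 0" using assms by (elim inj_onD) auto
  then show False using assms by simp
qed

lemma sum_powers_root_of_unity:
  fixes r :: complex
  assumes "r ^ n = 1" "r \<noteq> 1"
  shows "(\<Sum>k<n. r ^ k) = 0"
  using assms by (simp add: geometric_sum)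

lemma sum_roots_unity_power:
  assumes "0 < p" "p < n"
  shows "(\<Sum>r\<in>{r::complex. r ^ n = 1}. r ^ p) = 0"
proof -
  let ?x = "cis (2 * pi * real p / real n)"
  have comm: "cis (2 * pi * real k / real n) ^ p = ?x ^ k" for k
  proof -
    have "real p * (2 * pi * real k / real n) = real k * (2 * pi * real p / real n)" by simp
    then show ?thesis by (metis Complex.DeMoivre)
  qed
  have "(\<Sum>r\<in>{r::complex. r ^ n = 1}. r ^ p) = (\<Sum>k<n. cis (2 * pi * real k / real n) ^ p)"
    using assms by (intro sum.reindex_bij_betw [symmetric] Complex.bij_betw_roots_unity) auto
  also have "\<dots> = (\<Sum>k<n. ?x ^ k)"
    by (simp add: comm)
  also have "\<dots> = 0"
    using assms cis_root_ne_1[OF assms]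
    by (intro sum_powers_root_of_unity) (auto simp: Complex.DeMoivre cis_multiple_2pi)
  finally show ?thesis .
qed

lemma finite_nontrivial_roots: "n > 0 \<Longrightarrow> finite ({r::complex. r ^ n = 1} - {1})"
  by (simp add: finite_roots_unity)

lemma card_nontrivial_roots: "n > 0 \<Longrightarrow> card ({r::complex. r ^ n = 1} - {1}) = n - 1"
  by (simp add: finite_roots_unity card_roots_unity_eq)

text \<open>The product of the linear factors and \<open>1 + X + ... + X^(n-1)\<close> are both
  monic of degree \<open>n - 1\<close> and vanish at the \<open>n - 1\<close> nontrivial roots, so
  they coincide; evaluate at 1.\<close>

lemma prod_one_minus_nontrivial_roots:
  assumes "n > 0"
  shows "(\<Prod>r\<in>{r::complex. r ^ n = 1} - {1}. 1 - r) = of_nat n"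
proof -
  let ?R = "{r::complex. r ^ n = 1} - {1}"
  define p where "p = (\<Prod>r\<in>?R. [:-r, 1:])"
  define q :: "complex poly" where "q = (\<Sum>i<n. monom 1 i)"
  note fin = finite_nontrivial_roots[OF assms]
  have deg: "degree p = n - 1"
    unfolding p_def by (subst degree_prod_eq_sum_degree) (use card_nontrivial_roots assms in auto)
  have lc: "lead_coeff p = 1"
    unfolding p_def by (simp add: lead_coeff_prod)
  have "p = q"
  proof (rule poly_eqI_degree_lead_coeff[where A = ?R and n = "n - 1"])
    show "poly.coeff p (n - 1) = poly.coeff q (n - 1)"
      using lc deg assms by (simp add: q_def coeff_sum)
    show "degree q \<le> n - 1"
      unfolding q_def by (rule degree_sum_le) (auto intro: order.trans[OF degree_monom_le])
    show "poly p z = poly q z" if "z \<in> ?R" for z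
    proof -
      have "poly p z = 0" unfolding p_def using that fin by (auto simp: poly_prod)
      moreover have "poly q z = 0"
        unfolding q_def using that sum_powers_root_of_unity[of z n] by (simp add: poly_sum poly_monom)
      ultimately show ?thesis by simp
    qed
  qed (use deg card_nontrivial_roots[OF assms] in auto)
  then have "poly p 1 = poly q 1" by simp
  then show ?thesis by (simp add: p_def q_def poly_prod poly_sum poly_monom)
qed

text \<open>Inversion permutes the nontrivial roots and
  \<open>1 / (1 - r) + 1 / (1 - 1 / r) = 1\<close>, so twice the sum counts the roots.\<close>

lemma sum_inverse_one_minus_roots:
  assumes "n > 0"
  shows "(\<Sum>r\<in>{r::complex. r ^ n = 1} - {1}. 1 / (1 - r)) = (of_nat n - 1) / 2"
proof -
  let ?R = "{r::complex. r ^ n = 1} - {1}"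
  let ?S = "\<Sum>r\<in>?R. 1 / (1 - r)"
  have nz: "r \<noteq> 0" if "r \<in> ?R" for r using that assms by (auto simp: power_0_left)
  have "bij_betw inverse ?R ?R"
    by (rule bij_betwI[where g = inverse]) (auto simp: power_inverse)
  then have "?S = (\<Sum>r\<in>?R. 1 / (1 - inverse r))"
    by (rule sum.reindex_bij_betw [symmetric])
  then have "?S + ?S = (\<Sum>r\<in>?R. 1 / (1 - r) + 1 / (1 - inverse r))"
    by (simp add: sum.distrib)
  also have "\<dots> = (\<Sum>r\<in>?R. 1)"
  proof (rule sum.cong)
    fix r assume r: "r \<in> ?R"
    then have "r \<noteq> 0" "1 - r \<noteq> 0" "r - 1 \<noteq> 0" using nz by auto
    then show "1 / (1 - r) + 1 / (1 - inverse r) = 1"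
      by (simp add: divide_simps) (simp add: algebra_simps)
  qed simp
  also have "\<dots> = of_nat n - 1"
    using card_nontrivial_roots[OF assms] assms by (simp add: of_nat_diff)
  finally show ?thesis by (simp add: field_simps)
qed

lemma sum_root_power_over_one_minus_Suc:
  "(\<Sum>r\<in>{r::complex. r ^ n = 1} - {1}. r ^ Suc p / (1 - r))
     = (\<Sum>r\<in>{r. r ^ n = 1} - {1}. r ^ p / (1 - r)) - (\<Sum>r\<in>{r. r ^ n = 1} - {1}. r ^ p)"
proof -
  let ?R = "{r::complex. r ^ n = 1} - {1}"
  have "(\<Sum>r\<in>?R. r ^ Suc p / (1 - r)) = (\<Sum>r\<in>?R. r ^ p / (1 - r) - r ^ p)"
  proof (rule sum.cong)
    fix r assume "r \<in> ?R"
    then have "1 - r \<noteq> 0" by auto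
    then show "r ^ Suc p / (1 - r) = r ^ p / (1 - r) - r ^ p"
      by (simp add: field_simps)
  qed simp
  then show ?thesis by (simp add: sum_subtractf)
qed

text \<open>Linear in \<open>p\<close>: raising \<open>p\<close> by one subtracts the sum of
  \<open>r ^ p\<close> over the nontrivial roots, which is -1 as long as
  \<open>0 < p < n\<close>.\<close>

lemma sum_root_power_over_one_minus:
  assumes "1 \<le> p" "p \<le> n"
  shows "(\<Sum>r\<in>{r::complex. r ^ n = 1} - {1}. r ^ p / (1 - r)) = (1 - of_nat n) / 2 + of_nat p - 1"
  using assms
proof (induction p rule: nat_induct_at_least)
  let ?R = "{r::complex. r ^ n = 1} - {1}"
  have n: "n > 0" using assms by simp
  case base
  have "(\<Sum>r\<in>?R. r ^ 0) = of_nat n - (1 :: complex)"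
    using card_nontrivial_roots[OF n] n by (simp add: of_nat_diff)
  moreover have "(\<Sum>r\<in>?R. r ^ 0 / (1 - r)) = (of_nat n - 1) / 2"
    using sum_inverse_one_minus_roots[OF n] by simp
  ultimately have "(\<Sum>r\<in>?R. r ^ Suc 0 / (1 - r)) = (of_nat n - 1) / 2 - (of_nat n - 1)"
    using sum_root_power_over_one_minus_Suc[where n = n and p = 0] by argo
  then show ?case by (simp add: field_simps)
next
  let ?R = "{r::complex. r ^ n = 1} - {1}"
  have n: "n > 0" using assms by simp
  case (Suc p)
  have "(\<Sum>r\<in>?R. r ^ p) = (\<Sum>r\<in>{r::complex. r ^ n = 1}. r ^ p) - 1"
    by (subst sum_diff1) (use n in \<open>auto simp: finite_roots_unity\<close>)
  also have "\<dots> = - 1" using Suc by (subst sum_roots_unity_power) auto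
  finally show ?case using sum_root_power_over_one_minus_Suc[where n = n and p = p] Suc by simp
qed

text \<open>Summing the preceding linear formula over \<open>p\<close> gives a quadratic in
  \<open>p\<close>. It becomes the eigenvalue at \<open>w ^ p\<close> of the operator behind the
  quadratic form.\<close>

lemma sum_one_minus_root_power:
  assumes "1 \<le> p" "p \<le> n"
  shows "(\<Sum>r\<in>{r::complex. r ^ n = 1} - {1}. (1 - r ^ p) / (1 - r) ^ 2)
           = - ((of_nat p - 2) * (of_nat n - of_nat p) / 2)"
  using assms
proof (induction p rule: nat_induct_at_least)
  let ?R = "{r::complex. r ^ n = 1} - {1}"
  have n: "n > 0" using assms by simp
  {
    case base
    have "(\<Sum>r\<in>?R. (1 - r ^ 1) / (1 - r) ^ 2) = (\<Sum>r\<in>?R. 1 / (1 - r))"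
      by (intro sum.cong) (auto simp: power2_eq_square)
    then show ?case using sum_inverse_one_minus_roots[OF n] by (simp add: field_simps)
  next
    case (Suc p)
    have "(\<Sum>r\<in>?R. (1 - r ^ Suc p) / (1 - r) ^ 2)
        = (\<Sum>r\<in>?R. (1 - r ^ p) / (1 - r) ^ 2 + r ^ p / (1 - r))"
    proof (rule sum.cong)
      fix r assume "r \<in> ?R"
      then have "1 - r \<noteq> 0" by auto
      then show "(1 - r ^ Suc p) / (1 - r) ^ 2 = (1 - r ^ p) / (1 - r) ^ 2 + r ^ p / (1 - r)"
        by (simp add: divide_simps power2_eq_square) (simp add: algebra_simps)
    qed simp
    also have "\<dots> = - ((of_nat p - 2) * (of_nat n - of_nat p) / 2) + ((1 - of_nat n) / 2 + of_nat p - 1)"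
      using Suc sum_root_power_over_one_minus[of p n] by (simp add: sum.distrib)
    also have "\<dots> = - ((of_nat (Suc p) - 2) * (of_nat n - of_nat (Suc p)) / 2)"
      by (simp add: field_simps)
    finally show ?case .
  }
qed

text \<open>The value \<open>c\<close> is left free because several grids occur: all nodes
  (\<open>c = -1\<close>), every third node (\<open>c = cis (pi / 3)\<close>) and the ordinary roots
  of unity (\<open>c = 1\<close>). Ratios of grid points do not see \<open>c\<close>.\<close>

locale root_grid =
  fixes n :: nat and w :: "nat \<Rightarrow> complex" and c :: complex
  assumes n_pos: "n > 0"
    and inj: "inj_on w {..<n}"
    and pow: "\<And>j. j < n \<Longrightarrow> w j ^ n = c"
    and unit: "\<And>j. j < n \<Longrightarrow> cmod (w j) = 1"
begin

lemma nz: "j < n \<Longrightarrow> w j \<noteq> 0"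
  using unit by fastforce

lemma diff_nz: "j < n \<Longrightarrow> l \<in> {..<n} - {j} \<Longrightarrow> w j - w l \<noteq> 0"
  using inj by (auto simp: inj_on_def)

lemma ratio_bij:
  assumes "j < n"
  shows "bij_betw (\<lambda>l. w l / w j) ({..<n} - {j}) ({r. r ^ n = 1} - {1})"
proof -
  have inj': "inj_on (\<lambda>l. w l / w j) ({..<n} - {j})"
    using inj nz[OF assms] by (auto simp: inj_on_def)
  have "c \<noteq> 0" using pow[OF assms] nz[OF assms] by auto
  then have "(\<lambda>l. w l / w j) ` ({..<n} - {j}) \<subseteq> {r. r ^ n = 1} - {1}"
    using pow[OF assms] pow nz[OF assms] inj assms by (auto simp: power_divide inj_on_def)
  moreover have "card ((\<lambda>l. w l / w j) ` ({..<n} - {j})) = card ({r::complex. r ^ n = 1} - {1})"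
    using card_nontrivial_roots[OF n_pos] assms by (simp add: card_image[OF inj'])
  ultimately have "(\<lambda>l. w l / w j) ` ({..<n} - {j}) = {r. r ^ n = 1} - {1}"
    using finite_nontrivial_roots[OF n_pos] by (intro card_subset_eq)
  then show ?thesis using inj' by (simp add: bij_betw_def)
qed

lemma sum_over_ratios:
  assumes "j < n"
  shows "(\<Sum>l\<in>{..<n} - {j}. f (w l / w j)) = (\<Sum>r\<in>{r. r ^ n = 1} - {1}. f r)"
  using sum.reindex_bij_betw[OF ratio_bij[OF assms], of f] by simp

lemma prod_distances:
  assumes "j < n"
  shows "(\<Prod>l\<in>{..<n} - {j}. cmod (w j - w l)) = real n"
proof -
  have "(\<Prod>l\<in>{..<n} - {j}. cmod (w j - w l)) = (\<Prod>l\<in>{..<n} - {j}. cmod (1 - w l / w j))"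
  proof (rule prod.cong)
    fix l
    have "w j - w l = w j * (1 - w l / w j)" using nz[OF assms] by (simp add: field_simps)
    then show "cmod (w j - w l) = cmod (1 - w l / w j)"
      by (metis norm_mult unit[OF assms] mult_1)
  qed simp
  also have "\<dots> = (\<Prod>r\<in>{r. r ^ n = 1} - {1}. cmod (1 - r))"
    using prod.reindex_bij_betw[OF ratio_bij[OF assms], of "\<lambda>r. cmod (1 - r)"] by simp
  also have "\<dots> = cmod (\<Prod>r\<in>{r. r ^ n = 1} - {1}. 1 - r)"
    by (simp add: prod_norm)
  finally show ?thesis using prod_one_minus_nontrivial_roots[OF n_pos] by simp
qed

lemma sum_inverse_differences:
  assumes "j < n"
  shows "(\<Sum>l\<in>{..<n} - {j}. 1 / (w j - w l)) = (of_nat n - 1) / (2 * w j)"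
proof -
  have "(\<Sum>l\<in>{..<n} - {j}. 1 / (w j - w l)) = (\<Sum>l\<in>{..<n} - {j}. 1 / w j * (1 / (1 - w l / w j)))"
    using nz[OF assms] by (intro sum.cong) (auto simp: field_simps)
  also have "\<dots> = 1 / w j * (\<Sum>r\<in>{r. r ^ n = 1} - {1}. 1 / (1 - r))"
    by (subst sum_distrib_left[symmetric], subst sum_over_ratios[OF assms, of "\<lambda>r. 1 / (1 - r)"]) simp
  finally show ?thesis using sum_inverse_one_minus_roots[OF n_pos] by simp
qed

lemma sum_power_differences:
  assumes "j < n" "1 \<le> p" "p \<le> n"
  shows "(\<Sum>l\<in>{..<n} - {j}. (w j ^ p - w l ^ p) / (w j - w l) ^ 2)
           = - ((of_nat p - 2) * (of_nat n - of_nat p) / 2) * w j ^ p / w j ^ 2"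
proof -
  have "(\<Sum>l\<in>{..<n} - {j}. (w j ^ p - w l ^ p) / (w j - w l) ^ 2)
      = (\<Sum>l\<in>{..<n} - {j}. w j ^ p / w j ^ 2 * ((1 - (w l / w j) ^ p) / (1 - w l / w j) ^ 2))"
  proof (rule sum.cong)
    fix l assume "l \<in> {..<n} - {j}"
    have "w j \<noteq> 0" using nz[OF assms(1)] .
    then have "w j ^ p - w l ^ p = w j ^ p * (1 - (w l / w j) ^ p)"
      "w j - w l = w j * (1 - w l / w j)"
      by (simp_all add: field_simps power_divide)
    then show "(w j ^ p - w l ^ p) / (w j - w l) ^ 2
        = w j ^ p / w j ^ 2 * ((1 - (w l / w j) ^ p) / (1 - w l / w j) ^ 2)"
      by (simp add: power_mult_distrib)
  qed simp
  also have "\<dots> = w j ^ p / w j ^ 2 * (\<Sum>r\<in>{r. r ^ n = 1} - {1}. (1 - r ^ p) / (1 - r) ^ 2)"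
    by (subst sum_distrib_left[symmetric],
        subst sum_over_ratios[OF assms(1), of "\<lambda>r. (1 - r ^ p) / (1 - r) ^ 2"]) simp
  finally show ?thesis
    using sum_one_minus_root_power[OF assms(2,3)] by (simp add: mult_ac)
qed

lemma offdiag_swap:
  "(\<Sum>j<n. \<Sum>l\<in>{..<n} - {j}. f j l) = (\<Sum>j<n. \<Sum>l\<in>{..<n} - {j}. f l (j::nat) :: complex)"
proof -
  have eq: "(\<Sum>j<n. \<Sum>l\<in>{..<n} - {j}. h j l) = (\<Sum>j<n. \<Sum>l<n. if l = j then 0 else h j l)"
    for h :: "nat \<Rightarrow> nat \<Rightarrow> complex"
    by (intro sum.cong refl sum.mono_neutral_cong_left) auto
  show ?thesis
    unfolding eq by (subst sum.swap) (auto intro!: sum.cong)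
qed

text \<open>Splitting the numerator and exchanging \<open>j\<close> and \<open>l\<close> leaves
  twice the sum of \<open>g j / (w j - w l)\<close>. This is the first-order term of the logarithm
  of the distance product, and a zero mean of \<open>g j / w j\<close> kills it.\<close>

lemma sum_difference_quotients:
  "(\<Sum>j<n. \<Sum>l\<in>{..<n} - {j}. (g j - g l) / (w j - w l)) = (of_nat n - 1) * (\<Sum>j<n. g j / w j)"
proof -
  have "(\<Sum>j<n. \<Sum>l\<in>{..<n} - {j}. (g j - g l) / (w j - w l))
      = (\<Sum>j<n. \<Sum>l\<in>{..<n} - {j}. g j / (w j - w l)) + (\<Sum>j<n. \<Sum>l\<in>{..<n} - {j}. g l / (w l - w j))"
    unfolding sum.distrib[symmetric]
  proof (intro sum.cong refl)
    fix j l
    have "g l / (w l - w j) = - (g l / (w j - w l))"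
      by (metis minus_diff_eq minus_divide_right)
    then show "(g j - g l) / (w j - w l) = g j / (w j - w l) + g l / (w l - w j)"
      by (simp add: diff_divide_distrib)
  qed
  also have "(\<Sum>j<n. \<Sum>l\<in>{..<n} - {j}. g l / (w l - w j)) = (\<Sum>j<n. \<Sum>l\<in>{..<n} - {j}. g j / (w j - w l))"
    by (rule offdiag_swap)
  also have "(\<Sum>j<n. \<Sum>l\<in>{..<n} - {j}. g j / (w j - w l)) = (\<Sum>j<n. g j * ((of_nat n - 1) / (2 * w j)))"
    by (intro sum.cong refl) (simp add: sum_inverse_differences[symmetric] sum_distrib_left)
  finally show ?thesis
    by (simp add: sum.distrib[symmetric] sum_distrib_left field_simps)
qed

lemma fourier_inversion:
  assumes "j < n"
  shows "f j = (\<Sum>k<n. ((\<Sum>l<n. f l / w l ^ k) / of_nat n) * w j ^ k)"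
proof -
  have "(\<Sum>k<n. ((\<Sum>l<n. f l / w l ^ k) / of_nat n) * w j ^ k)
      = (\<Sum>k<n. \<Sum>l<n. f l / of_nat n * (w j / w l) ^ k)"
    unfolding sum_divide_distrib sum_distrib_right
    by (intro sum.cong refl) (simp add: power_divide)
  also have "\<dots> = (\<Sum>l<n. f l / of_nat n * (\<Sum>k<n. (w j / w l) ^ k))"
    by (subst sum.swap) (simp add: sum_distrib_left)
  also have "\<dots> = (\<Sum>l<n. if l = j then f j else 0)"
  proof (rule sum.cong)
    fix l assume l: "l \<in> {..<n}"
    show "f l / of_nat n * (\<Sum>k<n. (w j / w l) ^ k) = (if l = j then f j else 0)"
    proof (cases "l = j")
      case True
      then show ?thesis using nz[OF assms] n_pos by simp
    next
      case False
      have "c \<noteq> 0" using pow[OF assms] nz[OF assms] by auto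
      then have "(w j / w l) ^ n = 1" "w j / w l \<noteq> 1"
        using l assms pow inj False by (auto simp: power_divide inj_on_def)
      then show ?thesis using False sum_powers_root_of_unity by simp
    qed
  qed simp
  also have "\<dots> = f j" using assms by simp
  finally show ?thesis by simp
qed

text \<open>The operator \<open>g \<mapsto> (\<lambda>j. \<Sum>l\<noteq>j. (g j - g l) / (w j - w l)\<^sup>2)\<close> is diagonal in the
  monomial basis, so the quadratic form is diagonalised by the discrete Fourier transform.\<close>

lemma quadratic_form_fourier:
  fixes U :: "nat \<Rightarrow> complex"
  defines "g \<equiv> \<lambda>j. w j * U j"
  shows "(\<Sum>j<n. \<Sum>l\<in>{..<n} - {j}. ((g j - g l) / (w j - w l)) ^ 2)
     = - of_nat n * (\<Sum>k<n. ((\<Sum>j<n. U j / w j ^ k) / of_nat n) * ((\<Sum>j<n. U j * w j ^ k) / of_nat n)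
          * ((of_nat k - 1) * (of_nat n - of_nat k - 1)))"
proof -
  define u where "u k = (\<Sum>j<n. U j / w j ^ k) / of_nat n" for k
  define L where "L j = (\<Sum>l\<in>{..<n} - {j}. (g j - g l) / (w j - w l) ^ 2)" for j
  \<comment> \<open>The factor \<open>w j\<close> in \<open>g\<close> shifts exponents by one, so
    frequency \<open>k\<close> of \<open>U\<close> meets the eigenvalue for
    \<open>p = Suc k\<close>.\<close>
  have g: "g j = (\<Sum>k<n. u k * w j ^ Suc k)" if "j < n" for j
  proof -
    have "g j = w j * (\<Sum>k<n. u k * w j ^ k)"
      unfolding g_def u_def using fourier_inversion[OF that, of U] by simp
    then show ?thesis by (simp add: sum_distrib_left mult_ac)
  qed
  define la :: "nat \<Rightarrow> complex" where "la k = - ((of_nat k - 1) * (of_nat n - of_nat k - 1) / 2)" for k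
  have L: "L j = (\<Sum>k<n. u k * la k * w j ^ k) / w j" if "j < n" for j
  proof -
    have "L j = (\<Sum>l\<in>{..<n} - {j}. \<Sum>k<n. u k * ((w j ^ Suc k - w l ^ Suc k) / (w j - w l) ^ 2))"
      unfolding L_def
    proof (rule sum.cong)
      fix l assume "l \<in> {..<n} - {j}"
      then have "g j - g l = (\<Sum>k<n. u k * (w j ^ Suc k - w l ^ Suc k))"
        using g that by (simp add: sum_subtractf[symmetric] right_diff_distrib)
      then show "(g j - g l) / (w j - w l) ^ 2
          = (\<Sum>k<n. u k * ((w j ^ Suc k - w l ^ Suc k) / (w j - w l) ^ 2))"
        by (simp add: sum_divide_distrib)
    qed simp
    also have "\<dots> = (\<Sum>k<n. u k * (\<Sum>l\<in>{..<n} - {j}. (w j ^ Suc k - w l ^ Suc k) / (w j - w l) ^ 2))"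
      by (subst sum.swap) (simp add: sum_distrib_left)
    also have "\<dots> = (\<Sum>k<n. u k * (la k * w j ^ Suc k / w j ^ 2))"
    proof (intro sum.cong refl)
      fix k assume "k \<in> {..<n}"
      then show "u k * (\<Sum>l\<in>{..<n} - {j}. (w j ^ Suc k - w l ^ Suc k) / (w j - w l) ^ 2)
          = u k * (la k * w j ^ Suc k / w j ^ 2)"
        by (subst sum_power_differences) (use that in \<open>auto simp: la_def algebra_simps\<close>)
    qed
    also have "\<dots> = (\<Sum>k<n. u k * la k * w j ^ k) / w j"
      unfolding sum_divide_distrib using nz[OF that]
      by (intro sum.cong refl) (simp add: power2_eq_square)
    finally show ?thesis .
  qed
  \<comment> \<open>Since \<open>(a - b)^2 = a (a - b) + b (b - a)\<close>, exchanging the indices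
    turns the form into \<open>2 * (\<Sum>j<n. g j * L j)\<close>.\<close>
  have "(\<Sum>j<n. \<Sum>l\<in>{..<n} - {j}. ((g j - g l) / (w j - w l)) ^ 2)
      = (\<Sum>j<n. \<Sum>l\<in>{..<n} - {j}. g j * ((g j - g l) / (w j - w l) ^ 2))
        + (\<Sum>j<n. \<Sum>l\<in>{..<n} - {j}. g l * ((g l - g j) / (w l - w j) ^ 2))"
    unfolding sum.distrib[symmetric]
  proof (intro sum.cong refl)
    fix j l
    have "(w l - w j) ^ 2 = (w j - w l) ^ 2" by (simp add: power2_commute)
    moreover have "(g j - g l) ^ 2 = g j * (g j - g l) + g l * (g l - g j)"
      by (simp add: power2_eq_square algebra_simps)
    ultimately show "((g j - g l) / (w j - w l)) ^ 2
        = g j * ((g j - g l) / (w j - w l) ^ 2) + g l * ((g l - g j) / (w l - w j) ^ 2)"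
      by (simp add: power_divide add_divide_distrib)
  qed
  also have "(\<Sum>j<n. \<Sum>l\<in>{..<n} - {j}. g l * ((g l - g j) / (w l - w j) ^ 2))
      = (\<Sum>j<n. \<Sum>l\<in>{..<n} - {j}. g j * ((g j - g l) / (w j - w l) ^ 2))"
    by (rule offdiag_swap)
  also have "(\<Sum>j<n. \<Sum>l\<in>{..<n} - {j}. g j * ((g j - g l) / (w j - w l) ^ 2)) = (\<Sum>j<n. g j * L j)"
    by (simp add: L_def sum_distrib_left)
  \<comment> \<open>Nothing is conjugated: the form is bilinear, so the coefficient at
    \<open>k\<close> is paired with the one at \<open>-k\<close>.\<close>
  also have "\<dots> = (\<Sum>j<n. \<Sum>k<n. u k * la k * (U j * w j ^ k))"
  proof (intro sum.cong refl)
    fix j assume "j \<in> {..<n}"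
    then have "g j * L j = U j * (\<Sum>k<n. u k * la k * w j ^ k)"
      using L[of j] nz[of j] by (simp add: g_def)
    then show "g j * L j = (\<Sum>k<n. u k * la k * (U j * w j ^ k))"
      by (simp add: sum_distrib_left mult_ac)
  qed
  also have "\<dots> = (\<Sum>k<n. u k * la k * (\<Sum>j<n. U j * w j ^ k))"
    by (subst sum.swap) (simp add: sum_distrib_left)
  finally have "(\<Sum>j<n. \<Sum>l\<in>{..<n} - {j}. ((g j - g l) / (w j - w l)) ^ 2)
      = (\<Sum>k<n. 2 * (u k * la k * (\<Sum>j<n. U j * w j ^ k)))"
    by (simp add: sum_distrib_left)
  also have "\<dots> = (\<Sum>k<n. - of_nat n * (u k * ((\<Sum>j<n. U j * w j ^ k) / of_nat n)
          * ((of_nat k - 1) * (of_nat n - of_nat k - 1))))"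
    using n_pos by (intro sum.cong refl) (simp add: la_def field_simps)
  finally show ?thesis by (simp add: u_def sum_distrib_left mult.assoc)
qed

end

subsection \<open>The perturbation and its Fourier coefficients\<close>

lemma cis_diff: "cis a - cis b = 2 * \<i> * of_real (sin ((a - b) / 2)) * cis ((a + b) / 2)"
proof -
  define x y where "x = (a + b) / 2" and "y = (a - b) / 2"
  have ab: "a = x + y" "b = x - y" by (simp_all add: x_def y_def field_simps)
  have "cis (x + y) - cis (x - y) = 2 * \<i> * of_real (sin y) * cis x"
    by (simp add: complex_eq_iff cos_add cos_diff sin_add sin_diff)
  then show ?thesis by (simp add: ab)
qed

lemma cmod_cis_diff: "cmod (cis a - cis b) = 2 * \<bar>sin ((a - b) / 2)\<bar>"
  by (simp add: cis_diff norm_mult)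

lemma sin_ge_linear:
  fixes t :: real
  assumes "0 \<le> t" "t \<le> 1 / 2"
  shows "2 * t \<le> sin (pi * t)"
proof -
  have "convex_on {0..pi} (\<lambda>x. - sin x)"
    by (rule f''_ge0_imp_convex[where f' = "\<lambda>x. - cos x" and f'' = sin])
       (auto intro!: derivative_eq_intros sin_ge_zero)
  from convex_onD[OF this, of "2 * t" 0 "pi / 2"] assms
  show ?thesis by (simp add: field_simps)
qed

lemma sin_ge_min:
  fixes t :: real
  assumes "0 \<le> t" "t \<le> 1"
  shows "2 * min t (1 - t) \<le> sin (pi * t)"
proof (cases "t \<le> 1 / 2")
  case True
  then show ?thesis using sin_ge_linear[of t] assms by (simp add: min_def)
next
  case False
  moreover have "sin (pi * (1 - t)) = sin (pi * t)" by (simp add: right_diff_distrib sin_diff)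
  ultimately show ?thesis using sin_ge_linear[of "1 - t"] assms by (simp add: min_def)
qed

lemma sum_lessThan_add: "(\<Sum>l<a + b. f l) = (\<Sum>l<a. f l) + (\<Sum>l<b. f (l + a))" for f :: "nat \<Rightarrow> 'a::comm_monoid_add"
  by (induction b) (simp_all add: ac_simps)

text \<open>Reduces a sum over all blocks to one block. When \<open>q\<close> is a nontrivial root
  of unity of order dividing \<open>a\<close>, the geometric factor is zero; this is how most
  Fourier coefficients vanish.\<close>

lemma sum_quasiperiodic:
  fixes f :: "nat \<Rightarrow> 'a::comm_ring_1"
  assumes "\<And>l. f (l + m) = q * f l"
  shows "(\<Sum>l<a * m. f l) = (\<Sum>b<a. q ^ b) * (\<Sum>l<m. f l)"
proof (induction a)
  case (Suc a)
  have shift: "f (l + b * m) = q ^ b * f l" for l b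
  proof (induction b)
    case (Suc b)
    have "f (l + Suc b * m) = f ((l + b * m) + m)" by (simp add: ac_simps)
    then show ?case using assms[of "l + b * m"] Suc by (simp add: mult_ac)
  qed simp
  have "(\<Sum>l<Suc a * m. f l) = (\<Sum>l<a * m + m. f l)" by (simp add: add.commute)
  also have "\<dots> = (\<Sum>l<a * m. f l) + q ^ a * (\<Sum>l<m. f l)"
    by (simp add: sum_lessThan_add shift sum_distrib_left)
  finally show ?case using Suc by (simp add: algebra_simps)
qed simp

section \<open>The nodes, the displacement function and its Lipschitz bound\<close>

definition node :: "nat \<Rightarrow> nat \<Rightarrow> complex" where
  "node m j = cis (pi * (2 * real j + 1) / (6 * real m))"

text \<open>The subtracted points are the vertices of the regular hexagon circumscribed about the
  unit circle, touching it at the block ends. Two neighbouring vertices add up to twice the touching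
  point, so the two signed branches agree there and the function is continuous around the
  circle.\<close>

definition twist :: "nat \<Rightarrow> nat \<Rightarrow> complex" where
  "twist m j = (-1) ^ (j div m) *
     (node m j - of_real (2 / sqrt 3) * cis (pi * (2 * real (j div m) + 1) / 6))"

definition chord_quot :: "nat \<Rightarrow> nat \<Rightarrow> nat \<Rightarrow> complex" where
  "chord_quot m j l = (twist m j - twist m l) / (node m j - node m l)"

lemma node_nz [simp]: "node m j \<noteq> 0"
  by (simp add: node_def)

lemma norm_node [simp]: "cmod (node m j) = 1"
  by (simp add: node_def)

lemma node_shift:
  assumes "m > 0"
  shows "node m (j + m) = cis (pi / 3) * node m j"
  using assms by (simp add: node_def cis_mult field_simps)

lemma twist_shift:
  assumes "m > 0"
  shows "twist m (j + m) = - cis (pi / 3) * twist m j"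
proof -
  have "cis (pi * (2 * real (Suc (j div m)) + 1) / 6) = cis (pi / 3) * cis (pi * (2 * real (j div m) + 1) / 6)"
    by (simp add: cis_mult field_simps)
  then show ?thesis
    using assms by (simp add: twist_def node_shift algebra_simps)
qed

lemma twist_quot_shift:
  assumes "m > 0"
  shows "twist m (j + m) / node m (j + m) = - (twist m j / node m j)"
  using assms by (simp add: node_shift twist_shift)

lemma node_shift_mult: "m > 0 \<Longrightarrow> node m (j + k * m) = cis (pi / 3) ^ k * node m j"
proof (induction k)
  case (Suc k)
  have "node m (j + Suc k * m) = node m ((j + k * m) + m)" by (simp add: ac_simps)
  then show ?case using Suc by (simp add: node_shift)
qed simp

lemma twist_shift_mult: "m > 0 \<Longrightarrow> twist m (j + k * m) = (- cis (pi / 3)) ^ k * twist m j"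
proof (induction k)
  case (Suc k)
  have "twist m (j + Suc k * m) = twist m ((j + k * m) + m)" by (simp add: ac_simps)
  then show ?case using Suc by (simp add: twist_shift)
qed simp

lemma cis_pi3_power6: "cis (pi / 3) ^ 6 = 1"
  by (simp add: Complex.DeMoivre)

lemma node_periodic: "m > 0 \<Longrightarrow> node m (j + 6 * m) = node m j"
  by (subst node_shift_mult) (simp_all add: cis_pi3_power6)

lemma twist_periodic: "m > 0 \<Longrightarrow> twist m (j + 6 * m) = twist m j"
  by (subst twist_shift_mult) (simp_all add: cis_pi3_power6)

lemma node_diff_norm: "cmod (node m j - node m l) = 2 * \<bar>sin (pi * (real j - real l) / (6 * real m))\<bar>"
proof -
  have "(pi * (2 * real j + 1) / (6 * real m) - pi * (2 * real l + 1) / (6 * real m)) / 2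
     = pi * (real j - real l) / (6 * real m)"
    by (cases "m = 0") (simp_all add: field_simps)
  then show ?thesis by (simp add: node_def cmod_cis_diff)
qed

lemma node_step: "cmod (node m (Suc j) - node m j) \<le> pi / (3 * real m)"
  using abs_sin_x_le_abs_x[of "pi / (6 * real m)"] by (simp add: node_diff_norm)

text \<open>Inside a block the difference is, up to sign, a node difference. Across a block end the
  radius \<open>2 / sqrt 3\<close> makes the two branches meet, and only
  \<open>2 - 2 * cos e\<close>, of second order in the spacing, is left.\<close>

lemma twist_step:
  assumes "m > 0"
  shows "cmod (twist m (Suc j) - twist m j) \<le> pi / (3 * real m)"
proof (cases "Suc j div m = j div m")
  case True
  then have "twist m (Suc j) - twist m j = (-1) ^ (j div m) * (node m (Suc j) - node m j)"
    by (simp add: twist_def algebra_simps)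
  then show ?thesis using node_step[of m j] by (simp add: norm_mult norm_power)
next
  case False
  define a where "a = j div m"
  define e where "e = pi / (6 * real m)"
  have a: "Suc j div m = Suc a" and "m dvd Suc j"
    using False unfolding a_def by (auto simp: div_Suc mod_eq_0_iff_dvd split: if_splits)
  then have j: "Suc j = m * Suc a" by (metis dvd_mult_div_cancel)
  have rj: "real j = real m * (real a + 1) - 1" using j by (metis add_diff_cancel_left' of_nat_Suc of_nat_mult plus_1_eq_Suc of_nat_1 add.commute)
  let ?c = "cis (pi * (real a + 1) / 3)"
  have n1: "node m (Suc j) = ?c * cis e" and n0: "node m j = ?c * cis (- e)"
    unfolding node_def e_def cis_mult of_nat_Suc rj
    by (rule arg_cong[of _ _ cis], use assms in \<open>simp add: field_simps\<close>)+
  have "cis (pi * (2 * real (Suc a) + 1) / 6) + cis (pi * (2 * real a + 1) / 6)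
     = ?c * (cis (pi / 6) + cis (- (pi / 6)))"
    unfolding distrib_left cis_mult
    by (intro arg_cong2[of _ _ _ _ "(+)"] arg_cong[of _ _ cis]) (simp_all add: field_simps)
  also have "cis (pi / 6) + cis (- (pi / 6)) = of_real (sqrt 3)"
    by (simp add: complex_eq_iff cos_30)
  finally have arc: "of_real (2 / sqrt 3) * (cis (pi * (2 * real (Suc a) + 1) / 6) + cis (pi * (2 * real a + 1) / 6))
     = 2 * ?c"
    by simp
  have "twist m (Suc j) - twist m j = - ((-1) ^ a * (node m (Suc j) + node m j - 2 * ?c))"
    unfolding arc[symmetric] twist_def a a_def[symmetric] by (simp add: algebra_simps)
  also have "node m (Suc j) + node m j - 2 * ?c = ?c * (cis e + cis (- e) - 2)"
    unfolding n1 n0 by (simp add: algebra_simps)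
  also have "cis e + cis (- e) - 2 = of_real (2 * cos e - 2)"
    by (simp add: complex_eq_iff)
  finally have "cmod (twist m (Suc j) - twist m j) = \<bar>2 * cos e - 2\<bar>"
    by (simp only: norm_mult norm_power norm_minus_cancel norm_of_real norm_cis norm_one power_one mult_1)
  also have "\<dots> = 2 * \<bar>cos e - cos 0\<bar>" by (simp add: abs_if)
  also have "\<bar>cos e - cos 0\<bar> = 2 * \<bar>sin (e / 2)\<bar> * \<bar>sin (e / 2)\<bar>"
    by (subst cos_diff_cos) (simp add: abs_mult)
  also have "\<dots> \<le> 2 * \<bar>e / 2\<bar> * 1"
    by (intro mult_mono abs_sin_x_le_abs_x) (simp_all add: abs_sin_x_le_abs_x)
  finally show ?thesis using assms by (simp add: e_def)
qed

lemma twist_diff_le: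
  assumes "m > 0"
  shows "cmod (twist m (j + d) - twist m j) \<le> real d * (pi / (3 * real m))"
proof (induction d)
  case (Suc d)
  have "cmod (twist m (j + Suc d) - twist m j)
      \<le> cmod (twist m (Suc (j + d)) - twist m (j + d)) + cmod (twist m (j + d) - twist m j)"
    using norm_triangle_ineq[of "twist m (Suc (j + d)) - twist m (j + d)" "twist m (j + d) - twist m j"] by simp
  also have "\<dots> \<le> pi / (3 * real m) + real d * (pi / (3 * real m))"
    by (intro add_mono twist_step Suc assms)
  finally show ?case by (simp add: distrib_right add_divide_distrib)
qed simp

lemma node_diff_le: "cmod (node m (j + d) - node m j) \<le> real d * (pi / (3 * real m))"
proof (induction d)
  case (Suc d)
  have "cmod (node m (j + Suc d) - node m j)
      \<le> cmod (node m (Suc (j + d)) - node m (j + d)) + cmod (node m (j + d) - node m j)"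
    using norm_triangle_ineq[of "node m (Suc (j + d)) - node m (j + d)" "node m (j + d) - node m j"] by simp
  also have "\<dots> \<le> pi / (3 * real m) + real d * (pi / (3 * real m))"
    by (intro add_mono node_step Suc)
  finally show ?case by (simp add: distrib_right add_divide_distrib)
qed simp

lemma node_diff_ge:
  assumes "m > 0" "d \<le> 6 * m"
  shows "cmod (node m (j + d) - node m j) \<ge> 2 * real (min d (6 * m - d)) / (3 * real m)"
proof -
  have "2 * min (real d / (6 * real m)) (1 - real d / (6 * real m)) \<le> sin (pi * (real d / (6 * real m)))"
    using assms by (intro sin_ge_min) auto
  also have "min (real d / (6 * real m)) (1 - real d / (6 * real m)) = real (min d (6 * m - d)) / (6 * real m)"
    using assms by (auto simp: min_def field_simps of_nat_diff)
  finally have "4 * (real (min d (6 * m - d)) / (6 * real m)) \<le> 2 * \<bar>sin (pi * (real d / (6 * real m)))\<bar>"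
    by linarith
  then show ?thesis by (simp add: node_diff_norm)
qed

text \<open>The shorter way round takes \<open>min d (6 * m - d)\<close> steps, each bounded by
  \<open>twist_step\<close>, while Jordan's inequality bounds the chord below by a multiple of the
  same number. The constant \<open>pi / 2\<close> is the quotient of the two factors.\<close>

lemma twist_lipschitz_aux:
  assumes "m > 0" "d \<le> 6 * m"
  shows "cmod (twist m (j + d) - twist m j) \<le> pi / 2 * cmod (node m (j + d) - node m j)"
proof -
  have "cmod (twist m (j + d) - twist m j) \<le> real (6 * m - d) * (pi / (3 * real m))"
  proof -
    have "cmod (twist m (j + d + (6 * m - d)) - twist m (j + d)) \<le> real (6 * m - d) * (pi / (3 * real m))"
      by (rule twist_diff_le[OF assms(1)])
    moreover have "twist m (j + d + (6 * m - d)) = twist m j"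
      using assms twist_periodic[of m j] by simp
    ultimately show ?thesis by (simp add: norm_minus_commute)
  qed
  with twist_diff_le[OF assms(1), of j d]
  have "cmod (twist m (j + d) - twist m j) \<le> real (min d (6 * m - d)) * (pi / (3 * real m))"
    by (simp add: min_def)
  also have "\<dots> = pi / 2 * (2 * real (min d (6 * m - d)) / (3 * real m))" by simp
  also have "\<dots> \<le> pi / 2 * cmod (node m (j + d) - node m j)"
    by (intro mult_left_mono node_diff_ge assms) simp
  finally show ?thesis .
qed

lemma twist_lipschitz:
  assumes "m > 0" "j < 6 * m" "l < 6 * m"
  shows "cmod (twist m j - twist m l) \<le> pi / 2 * cmod (node m j - node m l)"
proof (cases "l \<le> j")
  case True
  then show ?thesis using twist_lipschitz_aux[of m "j - l" l] assms by simp
next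
  case False
  then show ?thesis using twist_lipschitz_aux[of m "l - j" j] assms by (simp add: norm_minus_commute)
qed

lemma norm_chord_quot_le:
  assumes "m > 0" "j < 6 * m" "l < 6 * m"
  shows "cmod (chord_quot m j l) \<le> pi / 2"
  unfolding chord_quot_def norm_divide
  using twist_lipschitz[OF assms] by (cases "node m j = node m l") (auto simp: divide_le_eq)

lemma node_inj:
  assumes "m > 0"
  shows "inj_on (node m) {..<6 * m}"
proof -
  have neq: "node m (j + d) \<noteq> node m j" if "0 < d" "d < 6 * m" for j d
  proof -
    have "0 < 2 * real (min d (6 * m - d)) / (3 * real m)" using that assms by (auto simp: min_def)
    also have "\<dots> \<le> cmod (node m (j + d) - node m j)" using that assms by (intro node_diff_ge) auto
    finally show ?thesis by auto
  qed
  show ?thesis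
  proof (rule inj_onI)
    fix x y assume xy: "x \<in> {..<6 * m}" "y \<in> {..<6 * m}" and eq: "node m x = node m y"
    consider "x < y" | "y < x" | "x = y" by linarith
    then show "x = y"
    proof cases
      case 1 then show ?thesis using neq[of "y - x" x] xy eq by (simp add: less_imp_diff_less)
    next
      case 2 then show ?thesis using neq[of "x - y" y] xy eq by (simp add: less_imp_diff_less)
    qed
  qed
qed

lemma root_grid_node:
  assumes "m > 0"
  shows "root_grid (6 * m) (node m) (-1)"
proof
  fix j assume "j < 6 * m"
  have "real (6 * m) * (pi * (2 * real j + 1) / (6 * real m)) = pi + 2 * pi * real j"
    using assms by (simp add: field_simps)
  then have "node m j ^ (6 * m) = cis (pi + 2 * pi * real j)"
    by (simp only: node_def Complex.DeMoivre)
  then show "node m j ^ (6 * m) = - 1"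
    by (simp add: cis_mult[symmetric] cis_multiple_2pi)
qed (use assms node_inj in auto)

lemma root_grid_third_node:
  assumes "m > 0"
  shows "root_grid (2 * m) (\<lambda>j. node m (3 * j)) (cis (pi / 3))"
proof
  show "inj_on (\<lambda>j. node m (3 * j)) {..<2 * m}"
    using inj_onD[OF node_inj[OF assms]] by (intro inj_onI) fastforce
next
  fix j assume "j < 2 * m"
  have "real (2 * m) * (pi * (2 * real (3 * j) + 1) / (6 * real m)) = pi / 3 + 2 * pi * real j"
    using assms by (simp add: field_simps)
  then have "node m (3 * j) ^ (2 * m) = cis (pi / 3 + 2 * pi * real j)"
    by (simp only: node_def Complex.DeMoivre)
  then show "node m (3 * j) ^ (2 * m) = cis (pi / 3)"
    by (simp add: cis_mult[symmetric] cis_multiple_2pi)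
qed (use assms in auto)

section \<open>Fourier coefficients of the displacement\<close>

lemma sum_cis_odd_multiples:
  "2 * \<i> * of_real (sin x) * (\<Sum>l<m. cis (x * (2 * real l + 1))) = cis (2 * real m * x) - 1"
proof (induction m)
  case (Suc m)
  have s: "2 * \<i> * of_real (sin x) = cis x - cis (- x)" by (simp add: complex_eq_iff)
  have "2 * \<i> * of_real (sin x) * cis (x * (2 * real m + 1)) = cis (2 * real (Suc m) * x) - cis (2 * real m * x)"
    unfolding s left_diff_distrib cis_mult by (simp add: algebra_simps)
  then show ?case using Suc by (simp add: distrib_left)
qed simp

text \<open>The angle of \<open>node m j\<close> as a real number, so that frequencies can range
  over the integers: the quadratic form needs both \<open>k\<close> and \<open>-k\<close>.\<close>

definition node_arg :: "nat \<Rightarrow> nat \<Rightarrow> real" where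
  "node_arg m j = pi * (2 * real j + 1) / (6 * real m)"

lemma twist_fourier_shift:
  assumes "m > 0"
  shows "twist m (l + m) / node m (l + m) * cis (- (of_int k * node_arg m (l + m)))
    = - cis (- (of_int k * pi / 3)) * (twist m l / node m l * cis (- (of_int k * node_arg m l)))"
proof -
  have "cis (- (of_int k * node_arg m (l + m))) = cis (- (of_int k * pi / 3)) * cis (- (of_int k * node_arg m l))"
    unfolding cis_mult node_arg_def
    by (rule arg_cong[of _ _ cis]) (use assms in \<open>simp add: field_simps\<close>)
  then show ?thesis using twist_quot_shift[OF assms] by simp
qed

lemma cis_int_multiple: "cis (- (of_int k * pi / 3)) = cis (- (of_int (k mod 6) * pi / 3))"
proof -
  have "of_int k = 6 * of_int (k div 6) + (of_int (k mod 6) :: real)"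
    by (metis mult_div_mod_eq of_int_add of_int_mult of_int_numeral)
  then have "cis (- (of_int k * pi / 3)) = cis (- (2 * pi * of_int (k div 6)) + - (of_int (k mod 6) * pi / 3))"
    by (intro arg_cong[of _ _ cis]) (simp add: field_simps)
  also have "\<dots> = cis (2 * pi * of_int (- (k div 6))) * cis (- (of_int (k mod 6) * pi / 3))"
    by (simp add: cis_mult)
  finally show ?thesis by (simp only: cis_multiple_2pi Ints_of_int mult_1)
qed

text \<open>Passing to the next block multiplies the summand by
  \<open>q = - cis (- (k * pi / 3))\<close>, a sixth root of unity that equals 1 only when
  \<open>k\<close> is congruent to 3 modulo 6.\<close>

lemma twist_fourier_zero:
  assumes "m > 0" "k mod 6 \<noteq> 3"
  shows "(\<Sum>l<6 * m. twist m l / node m l * cis (- (of_int k * node_arg m l))) = 0"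
proof -
  define q where "q = - cis (- (of_int k * pi / 3))"
  have q6: "q ^ 6 = 1"
  proof -
    have "q ^ 6 = cis (2 * pi * of_int (- k))"
      unfolding q_def power_minus_even by (simp add: Complex.DeMoivre field_simps)
    then show ?thesis by (simp only: cis_multiple_2pi Ints_of_int)
  qed
  have "q \<noteq> 1"
  proof
    assume "q = 1"
    then have eq: "cis (- (of_int (k mod 6) * pi / 3)) = -1" 
      unfolding q_def cis_int_multiple[of k] by (simp add: minus_equation_iff)
    have "k mod 6 \<in> {0, 1, 2, 3, 4, 5}" using pos_mod_bound[of 6 k] pos_mod_sign[of 6 k] by auto
    then consider "k mod 6 = 0" | "k mod 6 = 1" | "k mod 6 = 2" | "k mod 6 = 4" | "k mod 6 = 5"
      using assms(2) by auto
    then have "cos (of_int (k mod 6) * pi / 3) \<noteq> -1"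
    proof cases
      case 4
      have "cos (pi + pi / 3) = - (1 / 2)" unfolding cos_add by (simp add: cos_60)
      then show ?thesis unfolding 4 by (simp add: field_simps)
    next
      case 5
      have "cos (2 * pi - pi / 3) = 1 / 2" unfolding cos_diff by (simp add: cos_60)
      then show ?thesis unfolding 5 by (simp add: field_simps)
    qed (auto simp: cos_60 cos_120)
    then show False using eq by (simp add: complex_eq_iff)
  qed
  then have "(\<Sum>b<6. q ^ b) = 0" using q6 by (rule sum_powers_root_of_unity[rotated])
  then show ?thesis
    by (subst sum_quasiperiodic[where q = q]) (use twist_fourier_shift[OF assms(1)] in \<open>auto simp: q_def\<close>)
qed

lemma eq_minus_i_divideI:
  assumes "\<i> * of_real s * z = 1" "s \<noteq> 0"
  shows "z = - \<i> * of_real (1 / s)"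
proof -
  have "\<i> * (\<i> * (of_real s * z)) = \<i>" using assms(1) by (simp add: mult.assoc)
  then have "of_real s * z = - \<i>" by (simp add: minus_equation_iff)
  then show ?thesis using assms(2) by (simp add: field_simps)
qed

text \<open>Now all six blocks contribute equally. On block 0 the displacement is the node minus a
  constant, so after division by the node there remain two geometric sums, at frequencies
  \<open>k\<close> and \<open>k + 1\<close>.\<close>

lemma twist_fourier:
  assumes "m > 0" "k mod 6 = 3"
    and s0: "sin (of_int k * pi / (6 * real m)) \<noteq> 0" and s1: "sin ((of_int k + 1) * pi / (6 * real m)) \<noteq> 0"
  shows "(\<Sum>l<6 * m. twist m l / node m l * cis (- (of_int k * node_arg m l)))
    = - 6 * \<i> * of_real (1 / sin (of_int k * pi / (6 * real m)) - 1 / sin ((of_int k + 1) * pi / (6 * real m)))"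
proof -
  define q where "q = - cis (- (of_int k * pi / 3))"
  have c: "cis (- (of_int k * pi / 3)) = -1"
    unfolding cis_int_multiple[of k] assms(2) by (simp add: complex_eq_iff)
  then have q: "q = 1" by (simp add: q_def)
  let ?E = "\<lambda>x. \<Sum>l<m. cis (x * (2 * real l + 1))"
  define x y where "x = - (of_int k * pi / (6 * real m))" and "y = - ((of_int k + 1) * pi / (6 * real m))"
  have "(\<Sum>l<6 * m. twist m l / node m l * cis (- (of_int k * node_arg m l)))
      = 6 * (\<Sum>l<m. twist m l / node m l * cis (- (of_int k * node_arg m l)))"
    by (subst sum_quasiperiodic[where q = 1]) (use twist_fourier_shift[OF assms(1)] c in auto)
  also have "(\<Sum>l<m. twist m l / node m l * cis (- (of_int k * node_arg m l)))
      = (\<Sum>l<m. cis (x * (2 * real l + 1)) - of_real (2 / sqrt 3) * cis (pi / 6) * cis (y * (2 * real l + 1)))"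
  proof (intro sum.cong refl)
    fix l assume l: "l \<in> {..<m}"
    have 1: "- (of_int k * node_arg m l) = x * (2 * real l + 1)"
      by (simp add: x_def node_arg_def field_simps)
    have 2: "cis (x * (2 * real l + 1)) / node m l = cis (y * (2 * real l + 1))"
      unfolding node_def cis_divide x_def y_def by (rule arg_cong[of _ _ cis]) (use assms in \<open>simp add: field_simps\<close>)
    have 3: "twist m l = node m l - of_real (2 / sqrt 3) * cis (pi / 6)"
      using l by (simp add: twist_def)
    show "twist m l / node m l * cis (- (of_int k * node_arg m l))
       = cis (x * (2 * real l + 1)) - of_real (2 / sqrt 3) * cis (pi / 6) * cis (y * (2 * real l + 1))"
      unfolding 1 2[symmetric] 3 by (simp add: field_simps)
  qed
  also have "\<dots> = ?E x - of_real (2 / sqrt 3) * cis (pi / 6) * ?E y"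
    by (simp add: sum_subtractf sum_distrib_left)
  also have "?E x = - \<i> * of_real (1 / sin (of_int k * pi / (6 * real m)))"
  proof -
    have "2 * real m * x = - (of_int k * pi / 3)" using assms by (simp add: x_def)
    then have "2 * \<i> * of_real (sin x) * ?E x = - 2"
      using sum_cis_odd_multiples[of x m] c by simp
    moreover have "sin x = - sin (of_int k * pi / (6 * real m))" by (simp add: x_def)
    ultimately have "\<i> * of_real (sin (of_int k * pi / (6 * real m))) * ?E x = 1" by (simp add: mult.assoc)
    then show ?thesis using s0 by (rule eq_minus_i_divideI)
  qed
  also have "of_real (2 / sqrt 3) * cis (pi / 6) * ?E y = - \<i> * of_real (1 / sin ((of_int k + 1) * pi / (6 * real m)))"
  proof -
    have "2 * real m * y = - (of_int k * pi / 3) + - (pi / 3)" using assms by (simp add: y_def field_simps)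
    then have "cis (2 * real m * y) = - cis (- (pi / 3))" using c by (simp only: cis_mult[symmetric] mult_minus1)
    then have "2 * \<i> * of_real (sin y) * ?E y = - (1 + cis (- (pi / 3)))"
      using sum_cis_odd_multiples[of y m] by simp
    moreover have "sin y = - sin ((of_int k + 1) * pi / (6 * real m))" by (simp add: y_def)
    ultimately have "- (2 * \<i> * of_real (sin ((of_int k + 1) * pi / (6 * real m))) * ?E y) = - (1 + cis (- (pi / 3)))"
      by simp
    then have E: "2 * \<i> * of_real (sin ((of_int k + 1) * pi / (6 * real m))) * ?E y = 1 + cis (- (pi / 3))"
      by (simp only: neg_equal_iff_equal)
    \<comment> \<open>The phase of the hexagon vertex symmetrises the numerator to
      \<open>sqrt 3\<close>, which \<open>2 / sqrt 3\<close> turns into 2, the same numerator as in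
      the sum at frequency \<open>k\<close>.\<close>
    have "cis (pi / 6) * (1 + cis (- (pi / 3))) = cis (pi / 6) + cis (- (pi / 6))"
      by (simp add: distrib_left cis_mult)
    also have "\<dots> = of_real (sqrt 3)" by (simp add: complex_eq_iff cos_30)
    finally have "of_real (2 / sqrt 3) * cis (pi / 6) * (1 + cis (- (pi / 3))) = 2"
      by (simp add: mult.assoc)
    moreover have "2 * (\<i> * of_real (sin ((of_int k + 1) * pi / (6 * real m))) * (of_real (2 / sqrt 3) * cis (pi / 6) * ?E y))
      = of_real (2 / sqrt 3) * cis (pi / 6) * (2 * \<i> * of_real (sin ((of_int k + 1) * pi / (6 * real m))) * ?E y)"
      by (simp only: mult_ac)
    ultimately have "2 * (\<i> * of_real (sin ((of_int k + 1) * pi / (6 * real m))) * (of_real (2 / sqrt 3) * cis (pi / 6) * ?E y)) = 2 * 1"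
      by (simp only: E mult_1_right)
    then have "\<i> * of_real (sin ((of_int k + 1) * pi / (6 * real m))) * (of_real (2 / sqrt 3) * cis (pi / 6) * ?E y) = 1"
      by (subst (asm) mult_left_cancel) simp_all
    then show ?thesis using s1 by (rule eq_minus_i_divideI)
  qed
  finally show ?thesis by (simp add: algebra_simps)
qed

subsection \<open>The diameter\<close>

definition pt :: "nat \<Rightarrow> nat \<Rightarrow> complex" where
  "pt m j = node m j + \<i> * of_real (tan (pi / (12 * real m))) * twist m j"

text \<open>The sign \<open>s\<close> records the parity of the block: a turn by
  \<open>pi / 3\<close> maps this family to itself with \<open>s\<close> flipped. Distances thus
  reduce to block 0 against block \<open>d \<le> 3\<close>, for both signs; \<open>s = 1\<close>
  gives \<open>pt\<close>.\<close>

definition signed_pt :: "nat \<Rightarrow> real \<Rightarrow> nat \<Rightarrow> complex" where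
  "signed_pt m s j = node m j + \<i> * of_real (s * tan (pi / (12 * real m))) * twist m j"

lemma signed_pt_shift:
  assumes "m > 0"
  shows "signed_pt m s (j + k * m) = cis (pi / 3) ^ k * signed_pt m (s * (-1) ^ k) j"
  using node_shift_mult[OF assms, of j k] twist_shift_mult[OF assms, of j k]
  by (simp add: signed_pt_def algebra_simps power_minus[of "cis (pi / 3)"])

lemma half_step:
  assumes "m > 0"
  defines "e \<equiv> pi / (12 * real m)"
  shows "0 < e" "e \<le> pi / 12" "e * real m = pi / 12" "0 < cos e" "0 < sin e"
proof -
  show e: "0 < e" "e \<le> pi / 12" "e * real m = pi / 12"
    using assms by (auto simp: divide_simps)
  show "0 < cos e" using e by (intro cos_gt_zero) auto
  show "0 < sin e" using e by (intro sin_gt_zero) auto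
qed

lemma scaled_norm_eq:
  fixes x y :: complex
  assumes "0 < c" "of_real c * x = y"
  shows "c * cmod x = cmod y"
  using assms by (auto simp: norm_mult)

text \<open>Since \<open>1 + \<i> * tan e\<close> is \<open>cis e / cos e\<close>, scaling by
  \<open>cos e\<close> turns each block into an arc of the unit circle, rotated by \<open>e\<close>
  or \<open>-e\<close> and translated by a vector of length \<open>2 / sqrt 3 * sin e\<close>. The
  target for scaled distances is then \<open>2 * cos e\<close>.\<close>

lemma signed_pt_scaled:
  assumes "m > 0" "p < m" "s \<in> {1, -1}"
  defines "e \<equiv> pi / (12 * real m)"
  shows "of_real (cos e) * signed_pt m s (p + b * m)
    = cis (2 * e * (2 * real p + 1) + real b * pi / 3 + s * (-1) ^ b * e)
      - \<i> * of_real (s * (-1) ^ b * sin e * (2 / sqrt 3)) * cis (pi * (2 * real b + 1) / 6)"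
proof -
  have d: "(p + b * m) div m = b" using assms by simp
  define S where "S = s * (-1) ^ b"
  have S: "S \<in> {1, -1}"
    using assms(3) unfolding S_def by (cases "even b") auto
  note e = half_step[OF assms(1), folded e_def]
  have t: "cos e * tan e = sin e" using e by (simp add: tan_def)
  have cs: "of_real (cos e) + \<i> * of_real (S * sin e) = cis (S * e)"
    using S by (auto simp: complex_eq_iff)
  define N where "N = node m (p + b * m)"
  define A where "A = of_real (2 / sqrt 3) * cis (pi * (2 * real b + 1) / 6)"
  have "of_real (cos e) * signed_pt m s (p + b * m)
      = of_real (cos e) * N + \<i> * of_real (s * (cos e * tan e)) * ((-1) ^ b * (N - A))"
    unfolding signed_pt_def twist_def d N_def A_def e_def by (simp add: algebra_simps)
  also have "\<dots> = N * (of_real (cos e) + \<i> * of_real (S * sin e)) - \<i> * of_real (S * sin e) * A"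
    unfolding t S_def by (simp add: algebra_simps)
  also have "N * (of_real (cos e) + \<i> * of_real (S * sin e))
    = cis (2 * e * (2 * real p + 1) + real b * pi / 3 + S * e)"
    unfolding cs N_def node_def cis_mult
    by (rule arg_cong[of _ _ cis]) (use assms in \<open>simp add: e_def field_simps\<close>)
  finally show ?thesis by (simp add: S_def A_def mult_ac)
qed

lemma dist_block_0:
  assumes "m > 0" "p < m" "q < m" "s \<in> {1, -1}"
  shows "cmod (signed_pt m s p - signed_pt m s q) \<le> 2"
proof -
  define e where "e = pi / (12 * real m)"
  note e = half_step[OF assms(1), folded e_def]
  note sc = signed_pt_scaled[OF assms(1) _ assms(4), of _ 0, folded e_def, simplified]
  have "of_real (cos e) * (signed_pt m s p - signed_pt m s q)
     = cis (2 * e * (2 * real p + 1) + s * e) - cis (2 * e * (2 * real q + 1) + s * e)"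
    by (simp add: right_diff_distrib sc assms)
  moreover have "(2 * e * (2 * real p + 1) + s * e - (2 * e * (2 * real q + 1) + s * e)) / 2 = 2 * e * (real p - real q)"
    by (simp add: field_simps)
  ultimately have "cmod (of_real (cos e) * (signed_pt m s p - signed_pt m s q)) = 2 * \<bar>sin (2 * e * (real p - real q))\<bar>"
    by (simp only: cmod_cis_diff)
  also have "\<dots> \<le> 2 * (1 / 2)"
  proof -
    have "\<bar>real p - real q\<bar> \<le> real m" using assms by linarith
    then have "2 * e * \<bar>real p - real q\<bar> \<le> 2 * e * real m" using e by (intro mult_left_mono) auto
    then have le: "2 * e * \<bar>real p - real q\<bar> \<le> pi / 6" using e by simp
    have "\<bar>sin (2 * e * (real p - real q))\<bar> = \<bar>sin \<bar>2 * e * (real p - real q)\<bar>\<bar>"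
      by (simp add: abs_if)
    also have "\<dots> = sin (2 * e * \<bar>real p - real q\<bar>)"
      using le e by (subst abs_of_nonneg[of "sin _"]) (auto simp: abs_mult intro!: sin_ge_zero)
    also have "\<dots> \<le> sin (pi / 6)"
      using le e by (intro sin_monotone_2pi_le) (auto intro: order.trans[of _ 0])
    finally show ?thesis by (simp add: sin_30)
  qed
  also have "\<dots> \<le> cos e * 2"
    using cos_monotone_0_pi_le[of e "pi / 3"] e by (simp add: cos_60)
  finally show ?thesis using e by (simp add: norm_mult)
qed

text \<open>The triangle inequality suffices. The arc points are at most
  \<open>2 * sin (pi / 3 - e)\<close> apart and the translations differ by \<open>2 * sin e\<close>;
  the sum \<open>2 * cos (pi / 6 - e)\<close> is at most \<open>2 * cos e\<close> precisely because
  \<open>e \<le> pi / 12\<close>.\<close>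

lemma dist_block_1:
  assumes "m > 0" "p < m" "q < m" "s \<in> {1, -1}"
  shows "cmod (signed_pt m s p - signed_pt m s (q + 1 * m)) \<le> 2"
proof -
  define e where "e = pi / (12 * real m)"
  note e = half_step[OF assms(1), folded e_def]
  note sc = signed_pt_scaled[OF assms(1) _ assms(4), folded e_def]
  have sc0: "of_real (cos e) * signed_pt m s p = cis (2 * e * (2 * real p + 1) + s * e)
      - \<i> * of_real (s * sin e * (2 / sqrt 3)) * cis (pi / 6)"
    using sc[OF assms(2), of 0] by simp
  have sc1: "of_real (cos e) * signed_pt m s (q + 1 * m) = cis (2 * e * (2 * real q + 1) + pi / 3 - s * e)
      + \<i> * of_real (s * sin e * (2 / sqrt 3)) * cis (pi / 2)"
    using sc[OF assms(3), of 1] by (simp add: algebra_simps)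
  define y where "y = 2 * e * (real m + real q - real p) - s * e"
  have "of_real (cos e) * (signed_pt m s p - signed_pt m s (q + 1 * m))
     = (cis (2 * e * (2 * real p + 1) + s * e) - cis (2 * e * (2 * real q + 1) + pi / 3 - s * e))
      - \<i> * of_real (s * sin e * (2 / sqrt 3)) * (cis (pi / 6) + cis (pi / 2))"
    unfolding right_diff_distrib sc0 sc1 by (simp only: algebra_simps)
  then have "cos e * cmod (signed_pt m s p - signed_pt m s (q + 1 * m))
    \<le> cmod (cis (2 * e * (2 * real p + 1) + s * e) - cis (2 * e * (2 * real q + 1) + pi / 3 - s * e))
      + cmod (\<i> * of_real (s * sin e * (2 / sqrt 3)) * (cis (pi / 6) + cis (pi / 2)))"
    by (rule scaled_norm_eq[OF e(4), THEN ord_eq_le_trans, OF _ norm_triangle_ineq4])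
  also have "cmod (cis (2 * e * (2 * real p + 1) + s * e) - cis (2 * e * (2 * real q + 1) + pi / 3 - s * e))
      = 2 * \<bar>sin (- y)\<bar>"
  proof -
    have "(2 * e * (2 * real p + 1) + s * e - (2 * e * (2 * real q + 1) + pi / 3 - s * e)) / 2 = - y"
      using e(3) by (simp add: y_def field_simps) 
    then show ?thesis by (simp only: cmod_cis_diff)
  qed
  also have "cmod (\<i> * of_real (s * sin e * (2 / sqrt 3)) * (cis (pi / 6) + cis (pi / 2))) = 2 * sin e"
  proof -
    have "cis (pi / 6) + cis (pi / 2) = cis (pi / 3) * (cis (- (pi / 6)) + cis (pi / 6))"
      unfolding distrib_left cis_mult
      by (intro arg_cong2[of _ _ _ _ "(+)"] arg_cong[of _ _ cis]) simp_all
    also have "cis (- (pi / 6)) + cis (pi / 6) = of_real (sqrt 3)" by (simp add: complex_eq_iff cos_30)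
    finally have "cmod (cis (pi / 6) + cis (pi / 2)) = sqrt 3" by (simp add: norm_mult)
    then have "cmod (\<i> * of_real (s * sin e * (2 / sqrt 3)) * (cis (pi / 6) + cis (pi / 2)))
        = \<bar>s * sin e * (2 / sqrt 3)\<bar> * sqrt 3"
      by (simp only: norm_mult norm_ii norm_of_real mult_1)
    then show ?thesis using assms(4) e by (auto simp: abs_mult)
  qed
  also have "2 * \<bar>sin (- y)\<bar> \<le> 2 * sin (pi / 3 - e)"
  proof -
    have r: "1 \<le> real m + real q - real p" "real m + real q - real p \<le> 2 * real m - 1"
      using assms by linarith+
    have "2 * e * 1 \<le> 2 * e * (real m + real q - real p)"
      "2 * e * (real m + real q - real p) \<le> 2 * e * (2 * real m - 1)"
      using r e by (intro mult_left_mono; simp)+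
    moreover have "2 * e * (2 * real m - 1) = pi / 3 - 2 * e" using e(3) by (simp add: algebra_simps)
    ultimately have "0 \<le> y" "y \<le> pi / 3 - e"
      using assms(4) e unfolding y_def by auto
    then have "sin y \<le> sin (pi / 3 - e)" "0 \<le> sin y"
      using e by (auto intro!: sin_monotone_2pi_le sin_ge_zero intro: order.trans[of _ 0])
    then show ?thesis by simp
  qed
  also have "2 * sin (pi / 3 - e) + 2 * sin e = 2 * cos (pi / 6 - e)"
    by (simp add: sin_diff cos_diff sin_60 cos_60 sin_30 cos_30)
  also have "\<dots> \<le> 2 * cos e"
    using e by (intro mult_left_mono cos_monotone_0_pi_le) auto
  finally show ?thesis using e by simp
qed

text \<open>Opposite blocks have equal translations, which cancel. Their opposite rotations make the
  angle \<open>y\<close> an odd multiple of \<open>e\<close>, so it is never 0 and the scaled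
  distance \<open>2 * \<bar>cos y\<bar>\<close> is at most \<open>2 * cos e\<close>.\<close>

lemma dist_block_3:
  assumes "m > 0" "p < m" "q < m" "s \<in> {1, -1}"
  shows "cmod (signed_pt m s p - signed_pt m s (q + 3 * m)) \<le> 2"
proof -
  define e where "e = pi / (12 * real m)"
  note e = half_step[OF assms(1), folded e_def]
  note sc = signed_pt_scaled[OF assms(1) _ assms(4), folded e_def]
  have sc0: "of_real (cos e) * signed_pt m s p = cis (2 * e * (2 * real p + 1) + s * e)
      - \<i> * of_real (s * sin e * (2 / sqrt 3)) * cis (pi / 6)"
    using sc[OF assms(2), of 0] by simp
  have sc1: "of_real (cos e) * signed_pt m s (q + 3 * m) = cis (2 * e * (2 * real q + 1) + pi - s * e)
      + \<i> * of_real (s * sin e * (2 / sqrt 3)) * cis (pi * 7 / 6)"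
    using sc[OF assms(3), of 3] by (simp add: algebra_simps)
  define y where "y = 2 * e * (real q - real p) - s * e"
  have c: "cis (pi * 7 / 6) = - cis (pi / 6)"
  proof -
    have "cis (pi * 7 / 6) = cis (pi / 6) * cis pi" unfolding cis_mult by (rule arg_cong[of _ _ cis]) simp
    then show ?thesis by simp
  qed
  have "of_real (cos e) * (signed_pt m s p - signed_pt m s (q + 3 * m))
     = cis (2 * e * (2 * real p + 1) + s * e) - cis (2 * e * (2 * real q + 1) + pi - s * e)"
    unfolding right_diff_distrib sc0 sc1 c by (simp add: algebra_simps)
  then have "cos e * cmod (signed_pt m s p - signed_pt m s (q + 3 * m))
    = cmod (cis (2 * e * (2 * real p + 1) + s * e) - cis (2 * e * (2 * real q + 1) + pi - s * e))"
    by (rule scaled_norm_eq[OF e(4)])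
  also have "\<dots> = 2 * \<bar>sin (- y - pi / 2)\<bar>"
  proof -
    have "(2 * e * (2 * real p + 1) + s * e - (2 * e * (2 * real q + 1) + pi - s * e)) / 2 = - y - pi / 2"
      by (simp add: y_def field_simps) 
    then show ?thesis by (simp only: cmod_cis_diff)
  qed
  also have "\<bar>sin (- y - pi / 2)\<bar> = \<bar>cos \<bar>y\<bar>\<bar>" by (simp add: sin_diff)
  also have "\<dots> \<le> cos e"
  proof -
    have "\<bar>real q - real p\<bar> \<le> real m - 1" using assms by linarith
    then have "2 * e * \<bar>real q - real p\<bar> \<le> 2 * e * (real m - 1)"
      using e by (intro mult_left_mono) auto
    also have "2 * e * (real m - 1) = pi / 6 - 2 * e"
      using e(3) by (simp add: algebra_simps)
    finally have "\<bar>2 * e * (real q - real p)\<bar> + \<bar>s * e\<bar> \<le> pi / 2"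
      using assms(4) e by (auto simp: abs_mult)
    then have up: "\<bar>y\<bar> \<le> pi / 2"
      unfolding y_def using abs_triangle_ineq4 order.trans by blast
    have "y = e * (2 * (real q - real p) - s)" by (simp add: y_def algebra_simps)
    then have "\<bar>y\<bar> = e * \<bar>2 * (real q - real p) - s\<bar>"
      using e(1) by (simp add: abs_mult)
    moreover have "1 \<le> \<bar>2 * (real q - real p) - s\<bar>"
    proof -
      consider "q = p" | "real q - real p \<ge> 1" | "real q - real p \<le> -1" by linarith
      then show ?thesis using assms(4) by cases auto
    qed
    ultimately have "e \<le> \<bar>y\<bar>" using e by simp
    then have "cos \<bar>y\<bar> \<le> cos e" using e up by (intro cos_monotone_0_pi_le) auto
    moreover have "0 \<le> cos \<bar>y\<bar>" using up by (intro cos_ge_zero) auto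
    ultimately show ?thesis by simp
  qed
  finally show ?thesis using e by simp
qed

text \<open>The critical case: blocks at distance two contain pairs that are nearly antipodal across a
  corner. The squared distance is controlled by \<open>2 sin e sin (Y + e) = cos Y - cos (Y + 2 e)\<close>
  together with \<open>\<bar>B\<bar> \<le> A\<close>.\<close>

lemma dist_block_2:
  assumes "m > 0" "p < m" "q < m" "s \<in> {1, -1}"
  shows "cmod (signed_pt m s p - signed_pt m s (q + 2 * m)) \<le> 2"
proof -
  define e where "e = pi / (12 * real m)"
  note e = half_step[OF assms(1), folded e_def]
  note sc = signed_pt_scaled[OF assms(1) _ assms(4), folded e_def]
  have sc0: "of_real (cos e) * signed_pt m s p = cis (2 * e * (2 * real p + 1) + s * e)
      - \<i> * of_real (s * sin e * (2 / sqrt 3)) * cis (pi / 6)"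
    using sc[OF assms(2), of 0] by simp
  have sc1: "of_real (cos e) * signed_pt m s (q + 2 * m) = cis (2 * e * (2 * real q + 1) + 2 * pi / 3 + s * e)
      - \<i> * of_real (s * sin e * (2 / sqrt 3)) * cis (pi * 5 / 6)"
    using sc[OF assms(3), of 2] by (simp add: algebra_simps)
  \<comment> \<open>Half the central angle between the two arc points is
    \<open>pi / 2 - 2 * e * A\<close>, and their bisector has direction
    \<open>pi / 2 + 2 * e * B + s * e\<close>. The bound on \<open>B\<close> comes from
    \<open>A - B = 2 * (m - q) - 1\<close> and \<open>A + B = 2 * p + 1\<close>, both
    positive.\<close>
  define A B where "A = real m - real q + real p" and "B = real p + real q + 1 - real m"
  have AB: "1 \<le> A" "A \<le> 2 * real m" "\<bar>B\<bar> \<le> A" unfolding A_def B_def using assms by linarith+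
  have A_le: "2 * e * A \<le> pi / 3"
  proof -
    have "2 * e * A \<le> 2 * e * (2 * real m)" using AB e by (intro mult_left_mono) auto
    also have "\<dots> = pi / 3" using e(3) by simp
    finally show ?thesis .
  qed
  define D where "D = of_real (cos (2 * e * A)) * cis (pi / 2 + 2 * e * B + s * e) + of_real (s * sin e)"
  have c: "cis (pi / 6) - cis (pi * 5 / 6) = of_real (sqrt 3)"
  proof -
    have "sin (pi * 5 / 6) = sin (pi / 6)" "cos (pi * 5 / 6) = - cos (pi / 6)"
      using sin_pi_minus[of "pi / 6"] cos_pi_minus[of "pi / 6"] by (simp_all add: field_simps)
    then show ?thesis by (simp add: complex_eq_iff cos_30)
  qed
  have "of_real (cos e) * (signed_pt m s p - signed_pt m s (q + 2 * m))
     = (cis (2 * e * (2 * real p + 1) + s * e) - cis (2 * e * (2 * real q + 1) + 2 * pi / 3 + s * e))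
       - \<i> * of_real (s * sin e * (2 / sqrt 3)) * (cis (pi / 6) - cis (pi * 5 / 6))"
    unfolding right_diff_distrib sc0 sc1 by (simp only: algebra_simps)
  also have "cis (2 * e * (2 * real p + 1) + s * e) - cis (2 * e * (2 * real q + 1) + 2 * pi / 3 + s * e)
      = - 2 * \<i> * of_real (cos (2 * e * A)) * cis (pi / 2 + 2 * e * B + s * e)"
  proof -
    have 1: "(2 * e * (2 * real p + 1) + s * e - (2 * e * (2 * real q + 1) + 2 * pi / 3 + s * e)) / 2
        = 2 * e * A - pi / 2"
      using e(3) by (simp add: A_def field_simps)
    have 2: "(2 * e * (2 * real p + 1) + s * e + (2 * e * (2 * real q + 1) + 2 * pi / 3 + s * e)) / 2
        = pi / 2 + 2 * e * B + s * e"
      using e(3) by (simp add: B_def field_simps)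
    show ?thesis unfolding cis_diff 1 2 by (simp add: sin_diff)
  qed
  finally have "of_real (cos e) * (signed_pt m s p - signed_pt m s (q + 2 * m)) = - 2 * \<i> * D"
    unfolding c D_def by (simp add: algebra_simps)
  then have "cos e * cmod (signed_pt m s p - signed_pt m s (q + 2 * m)) = cmod (- 2 * \<i> * D)"
    by (rule scaled_norm_eq[OF e(4)])
  then have eq: "cos e * cmod (signed_pt m s p - signed_pt m s (q + 2 * m)) = 2 * cmod D"
    by (simp add: norm_mult)
  have "(cmod D)\<^sup>2 = (cos (2 * e * A))\<^sup>2 + (sin e)\<^sup>2 - cos (2 * e * A) * (2 * s * sin e * sin (2 * e * B + s * e))"
  proof -
    have "cis (pi / 2 + 2 * e * B + s * e) = \<i> * cis (2 * e * B + s * e)"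
      by (simp add: cis_mult[symmetric] add.assoc)
    then have "Re D = s * sin e - cos (2 * e * A) * sin (2 * e * B + s * e)"
      "Im D = cos (2 * e * A) * cos (2 * e * B + s * e)"
      by (simp_all add: D_def)
    then have "(cmod D)\<^sup>2 = (s * sin e - cos (2 * e * A) * sin (2 * e * B + s * e))\<^sup>2
        + (cos (2 * e * A))\<^sup>2 * (1 - (sin (2 * e * B + s * e))\<^sup>2)"
      unfolding cmod_power2 by (simp add: power_mult_distrib cos_squared_eq)
    also have "\<dots> = (cos (2 * e * A))\<^sup>2 + s\<^sup>2 * (sin e)\<^sup>2 - cos (2 * e * A) * (2 * s * sin e * sin (2 * e * B + s * e))"
      by (simp add: power2_eq_square algebra_simps)
    finally show ?thesis using assms(4) by auto
  qed
  also have "2 * s * sin e * sin (2 * e * B + s * e) = cos (2 * e * B) - cos (2 * e * B + 2 * (s * e))"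
  proof -
    have "cos (2 * e * B) - cos (2 * e * B + 2 * (s * e)) = 2 * sin (2 * e * B + s * e) * sin (s * e)"
    proof -
      have "(2 * e * B + (2 * e * B + 2 * (s * e))) / 2 = 2 * e * B + s * e"
        "(2 * e * B + 2 * (s * e) - 2 * e * B) / 2 = s * e"
        by (simp_all add: field_simps)
      then show ?thesis by (simp only: cos_diff_cos)
    qed
    also have "sin (s * e) = s * sin e" using assms(4) by auto
    finally show ?thesis by simp
  qed
  also have "(cos (2 * e * A))\<^sup>2 + (sin e)\<^sup>2 - cos (2 * e * A) * (cos (2 * e * B) - cos (2 * e * B + 2 * (s * e)))
     \<le> (cos e)\<^sup>2"
  proof -
    have cA: "0 \<le> cos (2 * e * A)" using AB e A_le by (intro cos_ge_zero) (auto intro: order.trans[of _ 0])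
    have "cos (2 * e * A) \<le> cos \<bar>2 * e * B\<bar>"
      using AB e A_le by (intro cos_monotone_0_pi_le) (auto simp: abs_mult)
    then have "cos (2 * e * A) \<le> cos (2 * e * B)" by simp
    then have "cos (2 * e * A) - cos (2 * e * B) + cos (2 * e * B + 2 * (s * e)) \<le> 1"
      using cos_le_one[of "2 * e * B + 2 * (s * e)"] by linarith
    then have "cos (2 * e * A) * (cos (2 * e * A) - cos (2 * e * B) + cos (2 * e * B + 2 * (s * e))) \<le> cos (2 * e * A)"
      using cA by (rule mult_left_le)
    \<comment> \<open>This is \<open>A \<ge> 1\<close>: the blocks at distance two are separated by
      a full block, and no pair is closer to antipodal than one spacing.\<close>
    also have "\<dots> \<le> cos (2 * e)"
      using AB e A_le by (intro cos_monotone_0_pi_le) auto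
    also have "\<dots> = (cos e)\<^sup>2 - (sin e)\<^sup>2" by (rule cos_double)
    finally show ?thesis by (simp add: power2_eq_square algebra_simps)
  qed
  finally have "cmod D \<le> cos e" using e by (simp add: power2_le_iff_abs_le)
  then have "cos e * cmod (signed_pt m s p - signed_pt m s (q + 2 * m)) \<le> cos e * 2"
    using eq by simp
  then show ?thesis using e(4) by (simp only: mult_le_cancel_left_pos)
qed

lemma dist_blocks:
  assumes "m > 0" "p < m" "q < m" "d \<le> 3"
  shows "cmod (pt m (p + a * m) - pt m (q + (a + d) * m)) \<le> 2"
proof -
  let ?s = "(-1) ^ a :: real"
  have s: "?s \<in> {1, -1}" by (cases "even a") auto
  have pt: "pt m j = signed_pt m 1 j" for j by (simp add: pt_def signed_pt_def)
  have ix: "q + (a + d) * m = (q + d * m) + a * m" by (simp add: algebra_simps)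
  have "cmod (pt m (p + a * m) - pt m (q + (a + d) * m))
      = cmod (signed_pt m ?s p - signed_pt m ?s (q + d * m))"
    unfolding pt ix signed_pt_shift[OF assms(1), of 1 _ a] right_diff_distrib[symmetric]
    by (simp add: norm_mult norm_power)
  moreover consider "d = 0" | "d = 1" | "d = 2" | "d = 3" using assms by linarith
  then have "cmod (signed_pt m ?s p - signed_pt m ?s (q + d * m)) \<le> 2"
    using dist_block_0[OF assms(1-3) s] dist_block_1[OF assms(1-3) s]
      dist_block_2[OF assms(1-3) s] dist_block_3[OF assms(1-3) s] by cases auto
  ultimately show ?thesis by simp
qed

lemma pt_dist_le_2:
  assumes "m > 0" "j < 6 * m" "l < 6 * m"
  shows "cmod (pt m j - pt m l) \<le> 2"
proof -
  have ordered: "cmod (pt m j - pt m l) \<le> 2" if "j < 6 * m" "l < 6 * m" "j div m \<le> l div m" for j l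
  proof -
    define a b p q where "a = j div m" and "b = l div m" and "p = j mod m" and "q = l mod m"
    have pq: "p < m" "q < m" using assms(1) by (simp_all add: p_def q_def)
    have j: "j = p + a * m" and l: "l = q + b * m" by (simp_all add: a_def b_def p_def q_def)
    have ab: "a \<le> b" "b < 6"
      using that by (simp_all add: a_def b_def less_mult_imp_div_less)
    show ?thesis
    proof (cases "b - a \<le> 3")
      case True
      then show ?thesis using dist_blocks[OF assms(1) pq True, of a] ab j l by simp
    next
      case False
      \<comment> \<open>More than three blocks forward is at most two blocks backward: move
        \<open>j\<close> on by a full turn and exchange the roles of the two points.\<close>
      have "j + 6 * m = p + (b + (6 + a - b)) * m" using ab j by (simp add: algebra_simps)
      moreover have "pt m (j + 6 * m) = pt m j"
        using assms(1) by (simp add: pt_def node_periodic twist_periodic)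
      ultimately show ?thesis
        using dist_blocks[OF assms(1) pq(2) pq(1), of "6 + a - b" b] ab False l
        by (simp add: norm_minus_commute)
    qed
  qed
  show ?thesis
    using ordered[of j l] ordered[of l j] assms by (metis nle_le norm_minus_commute)
qed

subsection \<open>Second-order expansion of the product of distances\<close>

text \<open>The remainder \<open>Ln (1 + z) - z + z\<^sup>2 / 2\<close> has derivative
  \<open>z\<^sup>2 / (1 + z)\<close>, and \<open>1 + z\<close> has modulus at least
  \<open>1 / 2\<close> on the disc; apply the mean value inequality.\<close>

lemma ln_norm_one_plus:
  fixes x :: complex
  assumes "cmod x \<le> 1 / 2"
  shows "\<bar>ln (cmod (1 + x)) - Re (x - x\<^sup>2 / 2)\<bar> \<le> 2 * cmod x ^ 3"
proof -
  define f where "f z = Ln (1 + z) - z + z\<^sup>2 / 2" for z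
  have "cmod (f x - f 0) \<le> 2 * (cmod x)\<^sup>2 * cmod (x - 0)"
  proof (rule field_differentiable_bound[where S = "cball 0 (cmod x)" and f' = "\<lambda>z. z\<^sup>2 / (1 + z)"])
    fix z :: complex assume "z \<in> cball 0 (cmod x)"
    then have z: "cmod z \<le> cmod x" by simp
    have "- Re z \<le> cmod z" using abs_Re_le_cmod[of z] by linarith
    then have re: "Re (1 + z) \<ge> 1 / 2" using z assms by simp
    then have "1 + z \<notin> \<real>\<^sub>\<le>\<^sub>0" by (auto simp: complex_nonpos_Reals_iff)
    moreover have "1 + z \<noteq> 0"
    proof
      assume "1 + z = 0"
      then have "Re (1 + z) = 0" by (simp only: zero_complex.sel)
      then show False using re by linarith
    qed
    then have "inverse (1 + z) - 1 + z = z\<^sup>2 / (1 + z)" by (simp add: field_simps power2_eq_square)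
    ultimately show "(f has_field_derivative z\<^sup>2 / (1 + z)) (at z within cball 0 (cmod x))"
      unfolding f_def by (auto intro!: derivative_eq_intros)
    have "1 / 2 \<le> cmod (1 + z)" using re complex_Re_le_cmod[of "1 + z"] by linarith
    then have "(cmod z)\<^sup>2 / cmod (1 + z) \<le> (cmod x)\<^sup>2 / (1 / 2)"
      using z by (intro frac_le power_mono) auto
    then show "cmod (z\<^sup>2 / (1 + z)) \<le> 2 * (cmod x)\<^sup>2" by (simp add: norm_divide norm_power)
  qed auto
  then have bd: "cmod (f x) \<le> 2 * cmod x ^ 3" by (simp add: f_def power3_eq_cube power2_eq_square)
  have "1 + x \<noteq> 0"
  proof
    assume "1 + x = 0"
    then have "x = - 1" by (simp add: add_eq_0_iff)
    then show False using assms by simp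
  qed
  then have "Re (f x) = ln (cmod (1 + x)) - Re (x - x\<^sup>2 / 2)" by (simp add: f_def)
  then show ?thesis using bd abs_Re_le_cmod[of "f x"] by linarith
qed

text \<open>The product of \<open>Delta\<close> indexed from 0, as suits \<open>{..<n}\<close> and
  the block number \<open>j div m\<close>.\<close>

definition dist_prod :: "nat \<Rightarrow> (nat \<Rightarrow> complex) \<Rightarrow> real" where
  "dist_prod n y = (\<Prod>j<n. \<Prod>l\<in>{..<n} - {j}. cmod (y j - y l))"

lemma Delta_eq_dist_prod: "Delta n (\<lambda>i. y (i - 1)) = dist_prod n y"
proof -
  have bij: "bij_betw (\<lambda>i. i - 1) {1..n} {..<n}"
    by (rule bij_betwI[where g = Suc]) auto
  have inner: "(\<Prod>j\<in>{1..n} - {i}. cmod (y (i - 1) - y (j - 1)))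
      = (\<Prod>l\<in>{..<n} - {i - 1}. cmod (y (i - 1) - y l))" if "i \<in> {1..n}" for i
  proof -
    have "bij_betw (\<lambda>i. i - 1) ({1..n} - {i}) ({..<n} - {i - 1})"
      by (rule bij_betwI[where g = Suc]) (use that in auto)
    from prod.reindex_bij_betw[OF this, of "\<lambda>l. cmod (y (i - 1) - y l)"] show ?thesis by simp
  qed
  show ?thesis
    unfolding Delta_def dist_prod_def
    using prod.reindex_bij_betw[OF bij, of "\<lambda>j. \<Prod>l\<in>{..<n} - {j}. cmod (y j - y l)"] inner by simp
qed

context root_grid
begin

lemma dist_prod_grid: "dist_prod n w = real n ^ n"
  unfolding dist_prod_def by (simp add: prod_distances)

text \<open>Displacing by \<open>\<i> * \<tau> * g\<close> makes \<open>- x\<^sup>2 / 2\<close>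
  equal to \<open>\<tau>\<^sup>2 / 2\<close> times the squared chord quotient. The fewer than
  \<open>n^2\<close> cubic remainders are bounded one by one; for \<open>\<tau>\<close> of order
  \<open>1/n\<close> their total is \<open>O(1/n)\<close>.\<close>

lemma ln_dist_prod_perturbed:
  fixes g :: "nat \<Rightarrow> complex" and \<tau> L :: real
  assumes lip: "\<And>j l. j < n \<Longrightarrow> l < n \<Longrightarrow> cmod (g j - g l) \<le> L * cmod (w j - w l)"
    and mean: "(\<Sum>j<n. g j / w j) = 0"
    and small: "\<bar>\<tau>\<bar> * L \<le> 1 / 2" and L: "0 \<le> L"
  defines "P \<equiv> dist_prod n (\<lambda>j. w j + \<i> * of_real \<tau> * g j) / real n ^ n"
  shows "P > 0"
    and "\<bar>ln P - \<tau>\<^sup>2 / 2 * Re (\<Sum>j<n. \<Sum>l\<in>{..<n} - {j}. ((g j - g l) / (w j - w l))\<^sup>2)\<bar>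
      \<le> 2 * (real n)\<^sup>2 * (\<bar>\<tau>\<bar> * L) ^ 3"
proof -
  define G where "G j l = (g j - g l) / (w j - w l)" for j l
  define x where "x j l = \<i> * of_real \<tau> * G j l" for j l
  have x_le: "cmod (x j l) \<le> \<bar>\<tau>\<bar> * L" if "j < n" "l \<in> {..<n} - {j}" for j l
  proof -
    have "cmod (G j l) \<le> L"
      using lip[of j l] that diff_nz[OF that] by (simp add: G_def norm_divide divide_le_eq)
    then show ?thesis by (simp add: x_def norm_mult mult_left_mono)
  qed
  have pos: "0 < cmod (1 + x j l)" if "j < n" "l \<in> {..<n} - {j}" for j l
  proof -
    have "1 - cmod (x j l) \<le> cmod (1 + x j l)"
      using norm_diff_ineq[of 1 "x j l"] by simp
    then show ?thesis using x_le[OF that] small by linarith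
  qed
  have fac: "cmod ((w j + \<i> * of_real \<tau> * g j) - (w l + \<i> * of_real \<tau> * g l))
      = cmod (w j - w l) * cmod (1 + x j l)" if "j < n" "l \<in> {..<n} - {j}" for j l
  proof -
    have "(w j + \<i> * of_real \<tau> * g j) - (w l + \<i> * of_real \<tau> * g l) = (w j - w l) * (1 + x j l)"
      using diff_nz[OF that] by (simp add: x_def G_def field_simps)
    then show ?thesis by (simp add: norm_mult)
  qed
  have P: "P = (\<Prod>j<n. \<Prod>l\<in>{..<n} - {j}. cmod (1 + x j l))"
    using dist_prod_grid n_pos by (simp add: P_def dist_prod_def fac prod.distrib)
  show "P > 0" unfolding P by (intro prod_pos ballI) (use pos in auto)
  have lnP: "ln P = (\<Sum>j<n. \<Sum>l\<in>{..<n} - {j}. ln (cmod (1 + x j l)))"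
  proof -
    have "ln P = (\<Sum>j<n. ln (\<Prod>l\<in>{..<n} - {j}. cmod (1 + x j l)))"
      unfolding P by (intro ln_prod prod_pos) (use pos in auto)
    also have "\<dots> = (\<Sum>j<n. \<Sum>l\<in>{..<n} - {j}. ln (cmod (1 + x j l)))"
      by (intro sum.cong refl ln_prod) (use pos in auto)
    finally show ?thesis .
  qed
  have "(\<Sum>j<n. \<Sum>l\<in>{..<n} - {j}. Re (x j l - (x j l)\<^sup>2 / 2))
      = Re (\<Sum>j<n. \<Sum>l\<in>{..<n} - {j}. \<i> * of_real \<tau> * G j l + of_real (\<tau>\<^sup>2 / 2) * (G j l)\<^sup>2)"
    unfolding Re_sum
    by (intro sum.cong refl) (simp add: x_def power_mult_distrib)
  also have "(\<Sum>j<n. \<Sum>l\<in>{..<n} - {j}. \<i> * of_real \<tau> * G j l + of_real (\<tau>\<^sup>2 / 2) * (G j l)\<^sup>2)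
      = \<i> * of_real \<tau> * (\<Sum>j<n. \<Sum>l\<in>{..<n} - {j}. G j l)
        + of_real (\<tau>\<^sup>2 / 2) * (\<Sum>j<n. \<Sum>l\<in>{..<n} - {j}. (G j l)\<^sup>2)"
    by (simp only: sum.distrib sum_distrib_left)
  also have "(\<Sum>j<n. \<Sum>l\<in>{..<n} - {j}. G j l) = 0"
    unfolding G_def by (simp add: sum_difference_quotients mean)
  finally have main: "(\<Sum>j<n. \<Sum>l\<in>{..<n} - {j}. Re (x j l - (x j l)\<^sup>2 / 2))
      = \<tau>\<^sup>2 / 2 * Re (\<Sum>j<n. \<Sum>l\<in>{..<n} - {j}. (G j l)\<^sup>2)"
    by simp
  have "\<bar>ln P - (\<Sum>j<n. \<Sum>l\<in>{..<n} - {j}. Re (x j l - (x j l)\<^sup>2 / 2))\<bar>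
      = \<bar>\<Sum>j<n. \<Sum>l\<in>{..<n} - {j}. ln (cmod (1 + x j l)) - Re (x j l - (x j l)\<^sup>2 / 2)\<bar>"
    unfolding lnP by (simp only: sum_subtractf)
  also have "\<dots> \<le> (\<Sum>j<n. \<Sum>l\<in>{..<n} - {j}. 2 * (\<bar>\<tau>\<bar> * L) ^ 3)"
  proof (intro order.trans[OF sum_abs] sum_mono)
    fix j l assume jl: "j \<in> {..<n}" "l \<in> {..<n} - {j}"
    then have "cmod (x j l) \<le> \<bar>\<tau>\<bar> * L" by (intro x_le) auto
    then have "2 * cmod (x j l) ^ 3 \<le> 2 * (\<bar>\<tau>\<bar> * L) ^ 3" by (intro mult_left_mono power_mono) auto
    moreover have "cmod (x j l) \<le> 1 / 2" using \<open>cmod (x j l) \<le> _\<close> small by linarith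
    ultimately show "\<bar>ln (cmod (1 + x j l)) - Re (x j l - (x j l)\<^sup>2 / 2)\<bar> \<le> 2 * (\<bar>\<tau>\<bar> * L) ^ 3"
      using ln_norm_one_plus[of "x j l"] by linarith
  qed
  also have "\<dots> \<le> (\<Sum>j<n. real n * (2 * (\<bar>\<tau>\<bar> * L) ^ 3))"
    using L by (intro sum_mono) (auto intro!: mult_right_mono)
  also have "\<dots> = 2 * (real n)\<^sup>2 * (\<bar>\<tau>\<bar> * L) ^ 3" by (simp add: power2_eq_square)
  finally show "\<bar>ln P - \<tau>\<^sup>2 / 2 * Re (\<Sum>j<n. \<Sum>l\<in>{..<n} - {j}. ((g j - g l) / (w j - w l))\<^sup>2)\<bar>
      \<le> 2 * (real n)\<^sup>2 * (\<bar>\<tau>\<bar> * L) ^ 3"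
    unfolding main by (simp only: G_def)
qed

end

text \<open>The share of frequency \<open>k = 6 i + 3\<close> in the quadratic form, divided by
  \<open>n^2\<close>. The two differences, with \<open>36 = 6 * 6\<close>, come from the Fourier
  coefficients at \<open>k\<close> and \<open>-k\<close>; \<open>(k - 1) * (n - k - 1)\<close> comes
  from the eigenvalue.\<close>

definition quad_term :: "nat \<Rightarrow> nat \<Rightarrow> real" where
  "quad_term m i = (let n = 6 * real m; k = 6 * real i + 3; s = (\<lambda>x. sin (x * pi / n)) in
     - 36 * (1 / s k - 1 / s (k + 1)) * (1 / s k - 1 / s (k - 1)) * (k - 1) * (n - k - 1) / n ^ 3)"

lemma sum_residue_3_mod_6:
  fixes f :: "nat \<Rightarrow> 'a::comm_monoid_add"
  assumes "\<And>k. k mod 6 \<noteq> 3 \<Longrightarrow> f k = 0"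
  shows "(\<Sum>k<6 * m. f k) = (\<Sum>i<m. f (6 * i + 3))"
proof (induction m)
  case (Suc m)
  have six: "6 * Suc m = Suc (Suc (Suc (Suc (Suc (Suc (6 * m))))))" by simp
  have "f (6 * m) = 0" "f (Suc (6 * m)) = 0" "f (Suc (Suc (6 * m))) = 0"
    "f (Suc (Suc (Suc (Suc (6 * m))))) = 0" "f (Suc (Suc (Suc (Suc (Suc (6 * m)))))) = 0"
    by (intro assms; presburger)+
  then show ?case
    unfolding six sum.lessThan_Suc using Suc by (simp add: numeral_3_eq_3)
qed simp

lemma sum_chord_quot_squares:
  assumes "m > 0"
  shows "(\<Sum>j<6 * m. \<Sum>l\<in>{..<6 * m} - {j}. (chord_quot m j l)\<^sup>2)
    = of_real ((6 * real m)\<^sup>2 * (\<Sum>i<m. quad_term m i))"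
proof -
  interpret root_grid "6 * m" "node m" "-1" by (rule root_grid_node[OF assms])
  define U where "U j = twist m j / node m j" for j
  define n where "n = 6 * real m"
  define F where "F k = (\<Sum>j<6 * m. U j * cis (- (of_int k * node_arg m j)))" for k
  have pw: "node m j ^ k = cis (of_int (int k) * node_arg m j)" for j k
    by (simp add: node_def node_arg_def Complex.DeMoivre)
  have F1: "(\<Sum>j<6 * m. U j / node m j ^ k) = F (int k)" for k
    unfolding F_def pw by (intro sum.cong refl) (simp add: divide_inverse)
  have F2: "(\<Sum>j<6 * m. U j * node m j ^ k) = F (- int k)" for k
    unfolding F_def pw by simp
  have twist: "twist m j = node m j * U j" for j by (simp add: U_def)
  have "(\<Sum>j<6 * m. \<Sum>l\<in>{..<6 * m} - {j}. (chord_quot m j l)\<^sup>2)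
    = - of_nat (6 * m) * (\<Sum>k<6 * m. (F (int k) / of_nat (6 * m)) * (F (- int k) / of_nat (6 * m))
          * ((of_nat k - 1) * (of_nat (6 * m) - of_nat k - 1)))"
    unfolding chord_quot_def twist quadratic_form_fourier F1 F2 ..
  also have "(\<Sum>k<6 * m. (F (int k) / of_nat (6 * m)) * (F (- int k) / of_nat (6 * m))
          * ((of_nat k - 1) * (of_nat (6 * m) - of_nat k - 1)))
     = (\<Sum>i<m. (F (int (6 * i + 3)) / of_nat (6 * m)) * (F (- int (6 * i + 3)) / of_nat (6 * m))
          * ((of_nat (6 * i + 3) - 1) * (of_nat (6 * m) - of_nat (6 * i + 3) - 1)))"
  proof (rule sum_residue_3_mod_6)
    fix k :: nat assume "k mod 6 \<noteq> 3"
    then have "int k mod 6 \<noteq> 3" by presburger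
    then have "F (int k) = 0" unfolding F_def U_def by (rule twist_fourier_zero[OF assms])
    then show "(F (int k) / of_nat (6 * m)) * (F (- int k) / of_nat (6 * m))
          * ((of_nat k - 1) * (of_nat (6 * m) - of_nat k - 1)) = 0" by simp
  qed
  also have "\<dots> = (\<Sum>i<m. of_real (- n * quad_term m i))"
  proof (intro sum.cong refl)
    fix i assume i: "i \<in> {..<m}"
    define k where "k = 6 * real i + 3"
    define s where "s x = sin (x * pi / n)" for x
    have n: "n > 0" using assms by (simp add: n_def)
    have k: "0 < k - 1" "k + 1 < n" using i by (auto simp: k_def n_def)
    have s_pos: "s x > 0" if "0 < x" "x < n" for x
      unfolding s_def using that by (intro sin_gt_zero) (auto simp: field_simps)
    have minus: "s (- x) = - s x" for x by (simp add: s_def)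
    have neg: "s (- k) = - s k" "s (- k + 1) = - s (k - 1)"
      using minus[of k] minus[of "k - 1"] by simp_all
    have nz: "s k \<noteq> 0" "s (k + 1) \<noteq> 0" "s (k - 1) \<noteq> 0" "s (- k) \<noteq> 0" "s (- k + 1) \<noteq> 0"
      unfolding neg using s_pos[of k] s_pos[of "k + 1"] s_pos[of "k - 1"] k by auto
    have m1: "int (6 * i + 3) mod 6 = 3" "(- int (6 * i + 3)) mod 6 = 3" by presburger+
    have r1: "real_of_int (int (6 * i + 3)) = k" "real_of_int (- int (6 * i + 3)) = - k" by (simp_all add: k_def)
    have Fk: "F (int (6 * i + 3)) = - 6 * \<i> * of_real (1 / s k - 1 / s (k + 1))"
      unfolding F_def U_def r1 s_def n_def
      by (rule twist_fourier[OF assms m1(1), unfolded r1])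
         (use nz in \<open>simp_all add: s_def n_def\<close>)
    have Fk': "F (- int (6 * i + 3)) = - 6 * \<i> * of_real (1 / s (- k) - 1 / s (- k + 1))"
      unfolding F_def U_def r1 s_def n_def
      by (rule twist_fourier[OF assms m1(2), unfolded r1])
         (use nz in \<open>simp_all add: s_def n_def\<close>)
    have Fk2: "F (- int (6 * i + 3)) = 6 * \<i> * of_real (1 / s k - 1 / s (k - 1))"
      unfolding Fk' neg by (simp add: algebra_simps)
    have q: "- n * quad_term m i = 36 * (1 / s k - 1 / s (k + 1)) * (1 / s k - 1 / s (k - 1)) / n\<^sup>2 * ((k - 1) * (n - k - 1))"
    proof -
      define A B where "A = 1 / s k - 1 / s (k + 1)" and "B = 1 / s k - 1 / s (k - 1)"
      have "quad_term m i = - 36 * A * B * (k - 1) * (n - k - 1) / n ^ 3"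
        by (simp only: quad_term_def Let_def A_def B_def s_def n_def k_def)
      then show ?thesis
        unfolding A_def[symmetric] B_def[symmetric]
        using n by (simp add: power2_eq_square power3_eq_cube)
    qed
    have c1: "of_nat (6 * m) = (of_real n :: complex)" "of_nat (6 * i + 3) = (of_real k :: complex)"
      by (simp_all add: n_def k_def)
    show "(F (int (6 * i + 3)) / of_nat (6 * m)) * (F (- int (6 * i + 3)) / of_nat (6 * m))
          * ((of_nat (6 * i + 3) - 1) * (of_nat (6 * m) - of_nat (6 * i + 3) - 1)) = of_real (- n * quad_term m i)"
    proof -
      define A B where "A = 1 / s k - 1 / s (k + 1)" and "B = 1 / s k - 1 / s (k - 1)"
      show ?thesis
        unfolding q Fk Fk2 c1 A_def[symmetric] B_def[symmetric] by (simp add: power2_eq_square mult_ac)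
    qed
  qed
  finally show ?thesis
    by (simp add: n_def power2_eq_square sum_distrib_left sum_negf mult.assoc)
qed

subsection \<open>Limit of the quadratic form\<close>

text \<open>Jordan's bound with \<open>min t (1 - t)\<close> weakened to \<open>t * (1 - t)\<close>:
  a product formula covers both ends of the range and cancels against the polynomial factors of
  \<open>quad_term\<close>.\<close>

lemma sin_node_ge:
  assumes "0 \<le> x" "x \<le> n" "0 < n"
  shows "2 * x * (n - x) / n\<^sup>2 \<le> sin (x * pi / n)"
proof -
  define t where "t = x / n"
  have t: "0 \<le> t" "t \<le> 1" using assms by (auto simp: t_def)
  have "t * (1 - t) \<le> min t (1 - t)"
    using t by (auto simp: min_def mult_left_le mult_left_le_one_le)
  then have "2 * (t * (1 - t)) \<le> 2 * min t (1 - t)" by (rule mult_left_mono) simp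
  also have "\<dots> \<le> sin (pi * t)" by (rule sin_ge_min[OF t])
  finally have "2 * (t * (1 - t)) \<le> sin (pi * t)" .
  moreover have "2 * x * (n - x) / n\<^sup>2 = 2 * (t * (1 - t))"
    using assms by (simp add: t_def power2_eq_square field_simps)
  ultimately show ?thesis by (simp add: t_def mult.commute)
qed

lemma abs_sin_diff_le: "\<bar>sin x - sin y\<bar> \<le> \<bar>x - y\<bar>" for x y :: real
proof -
  have "\<bar>sin x - sin y\<bar> = 2 * (\<bar>sin ((x - y) / 2)\<bar> * \<bar>cos ((x + y) / 2)\<bar>)"
    by (subst sin_diff_sin) (simp add: abs_mult)
  also have "\<dots> \<le> 2 * (\<bar>(x - y) / 2\<bar> * 1)"
    by (intro mult_left_mono mult_mono abs_sin_x_le_abs_x) simp_all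
  finally show ?thesis by simp
qed

lemma inverse_sin_diff_le:
  assumes x: "0 < x" "x < n" and y: "0 < y" "y < n" and xy: "\<bar>x - y\<bar> = 1"
  shows "\<bar>1 / sin (x * pi / n) - 1 / sin (y * pi / n)\<bar> \<le> pi * n ^ 3 / (4 * (x * (n - x)) * (y * (n - y)))"
proof -
  have n: "0 < n" using x by simp
  define a b where "a = 2 * x * (n - x) / n\<^sup>2" and "b = 2 * y * (n - y) / n\<^sup>2"
  have ab: "0 < a" "0 < b" using x y n by (auto simp: a_def b_def)
  have sa: "a \<le> sin (x * pi / n)" and sb: "b \<le> sin (y * pi / n)"
    unfolding a_def b_def using x y by (auto intro!: sin_node_ge)
  have "1 / sin (x * pi / n) - 1 / sin (y * pi / n)
      = (sin (y * pi / n) - sin (x * pi / n)) / (sin (x * pi / n) * sin (y * pi / n))"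
    using sa sb ab by (simp add: field_simps)
  then have "\<bar>1 / sin (x * pi / n) - 1 / sin (y * pi / n)\<bar>
      = \<bar>sin (y * pi / n) - sin (x * pi / n)\<bar> / (sin (x * pi / n) * sin (y * pi / n))"
    using sa sb ab by (simp add: abs_mult)
  also have "\<dots> \<le> (pi / n) / (a * b)"
  proof (intro frac_le mult_mono)
    have "\<bar>y * pi / n - x * pi / n\<bar> = \<bar>x - y\<bar> * (pi / n)"
      using n by (simp add: diff_divide_distrib[symmetric] left_diff_distrib[symmetric] abs_mult abs_minus_commute)
    then show "\<bar>sin (y * pi / n) - sin (x * pi / n)\<bar> \<le> pi / n"
      using abs_sin_diff_le[of "y * pi / n" "x * pi / n"] xy by simp
  qed (use sa sb ab n in auto)
  also have "\<dots> = pi * n ^ 3 / (4 * (x * (n - x)) * (y * (n - y)))"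
    using n by (simp add: a_def b_def power2_eq_square power3_eq_cube)
  finally show ?thesis .
qed

text \<open>The terms \<open>quad_term m i\<close> are symmetric under \<open>i \<mapsto> m - 1 - i\<close>, with both ends contributing to
  the limit. Since \<open>cutoff t + cutoff (1 - t) = 1\<close>, the weight \<open>2 * cutoff\<close> folds the sum onto its
  first end, after which one summable majorant serves all \<open>m\<close>.\<close>

definition cutoff :: "real \<Rightarrow> real" where
  "cutoff t = (1 - t)\<^sup>2 * (1 + 2 * t)"

lemma cutoff_symmetric: "cutoff t + cutoff (1 - t) = 1"
  by (simp add: cutoff_def power2_eq_square algebra_simps)

lemma quad_term_symmetric:
  assumes "i < m"
  shows "quad_term m (m - Suc i) = quad_term m i"
proof -
  define n k where "n = 6 * real m" and "k = 6 * real i + 3"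
  define s where "s x = sin (x * pi / n)" for x
  have n: "n > 0" using assms by (simp add: n_def)
  have r: "6 * real (m - Suc i) + 3 = n - k"
    using assms by (simp add: n_def k_def of_nat_diff)
  have refl: "s (n - x) = s x" for x
    unfolding s_def using n sin_pi_minus[of "x * pi / n"] by (simp add: left_diff_distrib diff_divide_distrib)
  have e: "n - k + 1 = n - (k - 1)" "n - k - 1 = n - (k + 1)" by simp_all
  have "quad_term m (m - Suc i) = - 36 * (1 / s (n - k) - 1 / s (n - k + 1)) * (1 / s (n - k) - 1 / s (n - k - 1))
      * (n - k - 1) * (n - (n - k) - 1) / n ^ 3"
    by (simp only: quad_term_def Let_def r s_def n_def[symmetric])
  also have "\<dots> = - 36 * (1 / s k - 1 / s (k - 1)) * (1 / s k - 1 / s (k + 1)) * (n - k - 1) * (k - 1) / n ^ 3"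
    unfolding e refl by simp
  also have "\<dots> = - 36 * (1 / s k - 1 / s (k + 1)) * (1 / s k - 1 / s (k - 1)) * (k - 1) * (n - k - 1) / n ^ 3"
    by (simp only: mult_ac)
  also have "\<dots> = quad_term m i"
    by (simp only: quad_term_def Let_def s_def n_def k_def)
  finally show ?thesis .
qed

definition cut_term :: "nat \<Rightarrow> nat \<Rightarrow> real" where
  "cut_term m i = (if i < m then 2 * cutoff ((6 * real i + 3) / (6 * real m)) * quad_term m i else 0)"

lemma sum_quad_term_eq: "(\<Sum>i<m. quad_term m i) = (\<Sum>i. cut_term m i)"
proof -
  define c where "c i = cutoff ((6 * real i + 3) / (6 * real m))" for i
  have c: "c i + c (m - Suc i) = 1" if "i < m" for i
  proof -
    have "(6 * real (m - Suc i) + 3) / (6 * real m) = 1 - (6 * real i + 3) / (6 * real m)"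
      using that by (simp add: of_nat_diff field_simps)
    then show ?thesis unfolding c_def using cutoff_symmetric by metis
  qed
  have "(\<Sum>i<m. quad_term m i) = (\<Sum>i<m. c i * quad_term m i + c (m - Suc i) * quad_term m (m - Suc i))"
  proof (intro sum.cong refl)
    fix i assume "i \<in> {..<m}"
    then have "quad_term m i = (c i + c (m - Suc i)) * quad_term m i" using c[of i] by simp
    then show "quad_term m i = c i * quad_term m i + c (m - Suc i) * quad_term m (m - Suc i)"
      using quad_term_symmetric[of i m] \<open>i \<in> {..<m}\<close> by (simp add: distrib_right)
  qed
  also have "\<dots> = (\<Sum>i<m. 2 * c i * quad_term m i)"
    using sum.nat_diff_reindex[of "\<lambda>i. c i * quad_term m i" m]
    by (simp add: sum.distrib sum_distrib_left[symmetric] mult.assoc)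
  also have "\<dots> = (\<Sum>i<m. cut_term m i)" by (simp add: cut_term_def c_def)
  also have "\<dots> = (\<Sum>i. cut_term m i)"
    by (rule suminf_finite[symmetric]) (auto simp: cut_term_def)
  finally show ?thesis .
qed

text \<open>The double zero of \<open>cutoff\<close> at 1 cancels the factor
  \<open>(n - k)\<^sup>2\<close> in the denominators of the two difference bounds, and the
  eigenvalue cancels \<open>k - 1\<close> and \<open>n - k - 1\<close>. What remains is a multiple
  of \<open>n / (k\<^sup>2 * (k + 1) * (n - k + 1))\<close>, and
  \<open>n \<le> 2 * ((k + 1) * (n - k + 1))\<close>.\<close>

lemma abs_cut_term_le: "\<bar>cut_term m i\<bar> \<le> 27 * pi\<^sup>2 / (real i + 1)\<^sup>2"
proof (cases "i < m")
  case False
  then show ?thesis by (simp add: cut_term_def)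
next
  case True
  define n k where "n = 6 * real m" and "k = 6 * real i + 3"
  define s where "s x = sin (x * pi / n)" for x
  define t where "t = k / n"
  have "real i + 1 \<le> real m" using True by linarith
  then have nk: "n - k \<ge> 3" by (simp add: n_def k_def)
  have k: "k \<ge> 3" by (simp add: k_def)
  have n: "n > 0" using nk k by simp
  have t: "0 \<le> t" "t \<le> 1" using nk k n by (auto simp: t_def)
  have A: "\<bar>1 / s k - 1 / s (k + 1)\<bar> \<le> pi * n ^ 3 / (4 * (k * (n - k)) * ((k + 1) * (n - k - 1)))"
    unfolding s_def using inverse_sin_diff_le[of k n "k + 1"] nk k by (simp add: diff_diff_eq)
  have B: "\<bar>1 / s k - 1 / s (k - 1)\<bar> \<le> pi * n ^ 3 / (4 * (k * (n - k)) * ((k - 1) * (n - k + 1)))"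
    unfolding s_def using inverse_sin_diff_le[of k n "k - 1"] nk k by (simp add: algebra_simps)
  have C: "\<bar>cutoff t\<bar> \<le> 3 * ((n - k) / n)\<^sup>2"
  proof -
    have "\<bar>cutoff t\<bar> = (1 - t)\<^sup>2 * (1 + 2 * t)" using t by (simp add: cutoff_def abs_mult)
    also have "\<dots> \<le> (1 - t)\<^sup>2 * 3" using t by (intro mult_left_mono) auto
    also have "1 - t = (n - k) / n" using n by (simp add: t_def field_simps)
    finally show ?thesis by simp
  qed
  have "\<bar>cut_term m i\<bar> = 2 * \<bar>cutoff t\<bar> * (36 * (\<bar>1 / s k - 1 / s (k + 1)\<bar> * \<bar>1 / s k - 1 / s (k - 1)\<bar>) * ((k - 1) * (n - k - 1)) / n ^ 3)"
  proof -
    have "cut_term m i = 2 * cutoff t * (- 36 * (1 / s k - 1 / s (k + 1)) * (1 / s k - 1 / s (k - 1)) * (k - 1) * (n - k - 1) / n ^ 3)"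
      using True by (simp only: if_True cut_term_def quad_term_def Let_def t_def s_def n_def k_def)
    moreover define X Y where "X = 1 / s k - 1 / s (k + 1)" and "Y = 1 / s k - 1 / s (k - 1)"
    ultimately have "cut_term m i = 2 * cutoff t * (- 36 * X * Y * (k - 1) * (n - k - 1) / n ^ 3)" by simp
    then have "\<bar>cut_term m i\<bar> = 2 * \<bar>cutoff t\<bar> * (36 * (\<bar>X\<bar> * \<bar>Y\<bar>) * ((k - 1) * (n - k - 1)) / n ^ 3)"
      using n nk k by (simp add: abs_mult)
    then show ?thesis by (simp only: X_def Y_def)
  qed
  also have "\<dots> \<le> 2 * (3 * ((n - k) / n)\<^sup>2) * (36 * ((pi * n ^ 3 / (4 * (k * (n - k)) * ((k + 1) * (n - k - 1))))
       * (pi * n ^ 3 / (4 * (k * (n - k)) * ((k - 1) * (n - k + 1))))) * ((k - 1) * (n - k - 1)) / n ^ 3)"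
    using nk k n A B C by (intro mult_mono divide_right_mono) auto
  also have "\<dots> = 27 / 2 * pi\<^sup>2 * (n / (k\<^sup>2 * (k + 1) * (n - k + 1)))"
  proof -
    define a b c d e where "a = n - k" and "b = n - k - 1" and "c = k + 1" and "d = n - k + 1" and "e = k - 1"
    have nz: "a \<noteq> 0" "b \<noteq> 0" "c \<noteq> 0" "d \<noteq> 0" "e \<noteq> 0" "n \<noteq> 0" "k \<noteq> 0"
      using nk k n by (auto simp: a_def b_def c_def d_def e_def)
    have "2 * (3 * (a / n)\<^sup>2) * (36 * ((pi * n ^ 3 / (4 * (k * a) * (c * b)))
       * (pi * n ^ 3 / (4 * (k * a) * (e * d)))) * (e * b) / n ^ 3) = 27 / 2 * pi\<^sup>2 * (n / (k\<^sup>2 * c * d))"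
      using nz by (simp add: field_simps power2_eq_square power3_eq_cube)
    then show ?thesis by (simp only: a_def b_def c_def d_def e_def)
  qed
  also have "\<dots> \<le> 27 / 2 * pi\<^sup>2 * (2 / k\<^sup>2)"
  proof (intro mult_left_mono)
    have "n \<le> 2 * ((k + 1) * (n - k + 1))"
    proof -
      have "0 \<le> k * (n - k)" using k nk by simp
      moreover have "2 * ((k + 1) * (n - k + 1)) = 2 * (k * (n - k)) + 2 * n + 2" by (simp add: algebra_simps)
      ultimately show ?thesis using n by linarith
    qed
    then have "n / ((k + 1) * (n - k + 1)) \<le> 2" using k nk by (simp add: pos_divide_le_eq)
    then have "n / ((k + 1) * (n - k + 1)) / k\<^sup>2 \<le> 2 / k\<^sup>2" by (intro divide_right_mono) auto
    then show "n / (k\<^sup>2 * (k + 1) * (n - k + 1)) \<le> 2 / k\<^sup>2" by (simp add: mult_ac)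
  qed simp
  also have "\<dots> = 27 * pi\<^sup>2 / k\<^sup>2" by simp
  also have "\<dots> \<le> 27 * pi\<^sup>2 / (real i + 1)\<^sup>2"
    by (intro divide_left_mono power_mono) (auto simp: k_def intro!: mult_pos_pos)
  finally show ?thesis .
qed

text \<open>Here 72 is twice the 36 of \<open>quad_term\<close>, since both ends of the spectrum
  contribute. The factor \<open>8 / pi\<^sup>2\<close> relative to the series for
  \<open>ln C_star\<close> offsets the limit \<open>pi\<^sup>2 / 8\<close> of
  \<open>(n * tan (pi / (2 * n)))\<^sup>2 / 2\<close>.\<close>

definition limit_term :: "nat \<Rightarrow> real" where
  "limit_term i = 72 / (pi\<^sup>2 * (6 * real i + 3)\<^sup>2 * (6 * real i + 4))"

lemma tendsto_scaled_sin:
  assumes "x > 0"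
  shows "(\<lambda>m. 1 / (6 * real m * sin (x * pi / (6 * real m)))) \<longlonglongrightarrow> 1 / (x * pi)"
proof -
  have "(\<lambda>m. 6 * real m * sin (x * pi / (6 * real m))) \<longlonglongrightarrow> x * pi"
    by real_asymp
  then show ?thesis using assms by (intro tendsto_divide) auto
qed

lemma cut_term_tendsto: "(\<lambda>m. cut_term m i) \<longlonglongrightarrow> limit_term i"
proof -
  define k where "k = 6 * real i + 3"
  \<comment> \<open>The denominator \<open>n ^ 3\<close> is shared out: one \<open>n\<close> to each
    reciprocal sine difference and one to \<open>n - k - 1\<close>, so that each factor
    converges.\<close>
  define r where "r x m = 1 / (6 * real m * sin (x * pi / (6 * real m)))" for x m
  have k: "k \<ge> 3" by (simp add: k_def)
  have lim: "(\<lambda>m. 2 * cutoff (k / (6 * real m)) * (- 36 * (r k m - r (k + 1) m) * (r k m - r (k - 1) m) * (k - 1)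
      * ((6 * real m - k - 1) / (6 * real m))))
     \<longlonglongrightarrow> 2 * 1 * (- 36 * (1 / (k * pi) - 1 / ((k + 1) * pi)) * (1 / (k * pi) - 1 / ((k - 1) * pi)) * (k - 1) * 1)"
  proof -
    have L1: "(\<lambda>m. cutoff (k / (6 * real m))) \<longlonglongrightarrow> 1"
      unfolding cutoff_def by real_asymp
    have L2: "(\<lambda>m. (6 * real m - k - 1) / (6 * real m)) \<longlonglongrightarrow> 1"
      by real_asymp
    have L3: "r k \<longlonglongrightarrow> 1 / (k * pi)" "r (k + 1) \<longlonglongrightarrow> 1 / ((k + 1) * pi)"
      "r (k - 1) \<longlonglongrightarrow> 1 / ((k - 1) * pi)"
      unfolding r_def using k by (auto intro!: tendsto_scaled_sin)
    show ?thesis by (intro tendsto_intros L1 L2 L3)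
  qed
  have ev: "\<forall>\<^sub>F m in sequentially. 2 * cutoff (k / (6 * real m)) * (- 36 * (r k m - r (k + 1) m) * (r k m - r (k - 1) m) * (k - 1)
      * ((6 * real m - k - 1) / (6 * real m))) = cut_term m i"
    using eventually_gt_at_top[of i]
  proof eventually_elim
    case (elim m)
    define n where "n = 6 * real m"
    define s where "s x = sin (x * pi / n)" for x
    have n: "n > 0" using elim by (simp add: n_def)
    have r: "r x m - r y m = (1 / s x - 1 / s y) / n" for x y
      unfolding r_def s_def n_def by (simp add: diff_divide_distrib mult_ac)
    have c: "cut_term m i = 2 * cutoff (k / n) * (- 36 * (1 / s k - 1 / s (k + 1)) * (1 / s k - 1 / s (k - 1)) * (k - 1) * (n - k - 1) / n ^ 3)"
      using elim by (simp only: if_True cut_term_def quad_term_def Let_def s_def n_def k_def)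
    show ?case
      unfolding c r n_def[symmetric] using n by (simp add: power3_eq_cube)
  qed
  have "2 * 1 * (- 36 * (1 / (k * pi) - 1 / ((k + 1) * pi)) * (1 / (k * pi) - 1 / ((k - 1) * pi)) * (k - 1) * 1)
      = limit_term i"
  proof -
    have nz: "k \<noteq> 0" "k + 1 \<noteq> 0" "k - 1 \<noteq> 0" using k by auto
    have 1: "1 / (k * pi) - 1 / ((k + 1) * pi) = 1 / (k * (k + 1) * pi)"
      using nz by (simp add: divide_simps) (simp add: algebra_simps)?
    have 2: "1 / (k * pi) - 1 / ((k - 1) * pi) = - (1 / (k * (k - 1) * pi))"
      using nz by (simp add: divide_simps) (simp add: algebra_simps)?
    have 3: "limit_term i = 72 / (pi\<^sup>2 * k\<^sup>2 * (k + 1))"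
      by (simp add: limit_term_def k_def add.commute)
    define a c where "a = k - 1" and "c = k + 1"
    have "2 * 1 * (- 36 * (1 / (k * c * pi)) * - (1 / (k * a * pi)) * a * 1) = 72 / (pi\<^sup>2 * k\<^sup>2 * c)"
      using nz by (simp add: a_def[symmetric] c_def[symmetric] power2_eq_square)
    then show ?thesis unfolding 1 2 3 by (simp only: a_def c_def)
  qed
  with Lim_transform_eventually[OF lim ev] show ?thesis by simp
qed

lemma sum_quad_term_tendsto: "(\<lambda>m. \<Sum>i<m. quad_term m i) \<longlonglongrightarrow> (\<Sum>i. limit_term i)"
proof -
  have "summable (\<lambda>i. 1 / (real i + 1)\<^sup>2)"
    using sums_summable[OF inverse_squares_sums] by (simp add: add_ac)
  then have sm: "summable (\<lambda>i. 27 * pi\<^sup>2 * (1 / (real i + 1)\<^sup>2))" by (rule summable_mult)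
  have "\<forall>\<^sub>F (i, m) in at_top \<times>\<^sub>F sequentially. norm (cut_term m i) \<le> 27 * pi\<^sup>2 * (1 / (real i + 1)\<^sup>2)"
    using abs_cut_term_le by (intro always_eventually) auto
  then show ?thesis
    unfolding sum_quad_term_eq
    using tannerys_theorem[of "\<lambda>i m. cut_term m i" limit_term sequentially, OF cut_term_tendsto _ sm]
    by simp
qed

subsection \<open>The series for \<open>ln C\<^sub>*\<close> and numerical bounds\<close>

text \<open>A primitive of \<open>x\<^sup>2 (1 - x) / (1 - x ^ 6) = \<Sum>i. x ^ (6 i + 2) - x ^ (6 i + 3)\<close>, obtained by partial
  fractions; its increment over \<open>[0, 1]\<close> is \<open>\<Sum>i. 1 / (6 i + 3) - 1 / (6 i + 4)\<close>.\<close>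

definition corner_prim :: "real \<Rightarrow> real" where
  "corner_prim x = ln (1 + x) / 3 - ln (x\<^sup>2 + x + 1) / 4 + ln (x\<^sup>2 - x + 1) / 12
     - arctan ((2 * x + 1) / sqrt 3) / (2 * sqrt 3) + arctan ((2 * x - 1) / sqrt 3) / (2 * sqrt 3)"

text \<open>The factored form of \<open>(1 - x ^ 6) / (1 - x)\<close>, without the singularity at
  1.\<close>

definition corner_den :: "real \<Rightarrow> real" where
  "corner_den x = (1 + x) * (x\<^sup>2 + x + 1) * (x\<^sup>2 - x + 1)"

lemma quadratic_pos: "x\<^sup>2 + x + 1 > 0" "x\<^sup>2 - x + 1 > 0" for x :: real
proof -
  have "x\<^sup>2 + x + 1 = (x + 1 / 2)\<^sup>2 + 3 / 4" "x\<^sup>2 - x + 1 = (x - 1 / 2)\<^sup>2 + 3 / 4"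
    by (simp_all add: power2_eq_square algebra_simps)
  moreover have "0 \<le> (x + 1 / 2)\<^sup>2" "0 \<le> (x - 1 / 2)\<^sup>2" by simp_all
  ultimately show "x\<^sup>2 + x + 1 > 0" "x\<^sup>2 - x + 1 > 0" by linarith+
qed

lemma arctan_part_deriv:
  "((\<lambda>x. arctan ((2 * x + c) / sqrt 3) / (2 * sqrt 3)) has_real_derivative 1 / (4 * x\<^sup>2 + 4 * c * x + c\<^sup>2 + 3)) (at x)"
proof -
  define Q where "Q = 4 * x\<^sup>2 + 4 * c * x + c\<^sup>2 + 3"
  have p: "1 + ((2 * x + c) / sqrt 3)\<^sup>2 = Q / 3"
    by (simp add: Q_def power_divide power2_eq_square field_simps)
  have "((\<lambda>x. arctan ((2 * x + c) / sqrt 3) / (2 * sqrt 3)) has_real_derivative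
      (inverse (1 + ((2 * x + c) / sqrt 3)\<^sup>2) * (2 / sqrt 3)) / (2 * sqrt 3)) (at x)"
    by (auto intro!: derivative_eq_intros)
  moreover have "(inverse (Q / 3) * (2 / sqrt 3)) / (2 * sqrt 3) = 3 / (Q * (sqrt 3 * sqrt 3))"
    by (simp add: field_simps)
  then have "(inverse (Q / 3) * (2 / sqrt 3)) / (2 * sqrt 3) = 1 / Q" by simp
  ultimately show ?thesis by (simp only: p Q_def)
qed

lemma corner_prim_deriv:
  assumes "0 \<le> x"
  shows "(corner_prim has_real_derivative x\<^sup>2 / corner_den x) (at x)"
proof -
  note q = quadratic_pos[of x]
  let ?d = "1 / (1 + x) / 3 - (2 * x + 1) / (x\<^sup>2 + x + 1) / 4 + (2 * x - 1) / (x\<^sup>2 - x + 1) / 12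
      - 1 / (4 * x\<^sup>2 + 4 * 1 * x + 1\<^sup>2 + 3) + 1 / (4 * x\<^sup>2 + 4 * (- 1) * x + (- 1)\<^sup>2 + 3)"
  have "((\<lambda>x. ln (1 + x) / 3) has_real_derivative 1 / (1 + x) / 3) (at x)"
    by (rule DERIV_cdivide) (use assms in \<open>auto intro!: derivative_eq_intros\<close>)
  moreover have "((\<lambda>x. ln (x\<^sup>2 + x + 1) / 4) has_real_derivative (2 * x + 1) / (x\<^sup>2 + x + 1) / 4) (at x)"
    by (rule DERIV_cdivide) (use q in \<open>auto intro!: derivative_eq_intros\<close>)
  moreover have "((\<lambda>x. ln (x\<^sup>2 - x + 1) / 12) has_real_derivative (2 * x - 1) / (x\<^sup>2 - x + 1) / 12) (at x)"
    by (rule DERIV_cdivide) (use q in \<open>auto intro!: derivative_eq_intros\<close>)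
  ultimately have "(corner_prim has_real_derivative ?d) (at x)"
    unfolding corner_prim_def
    using arctan_part_deriv[of 1 x] arctan_part_deriv[of "- 1" x]
    by (intro DERIV_add DERIV_diff) simp_all
  moreover have "?d = x\<^sup>2 / corner_den x"
  proof -
    define a b c where "a = 1 + x" and "b = x\<^sup>2 + x + 1" and "c = x\<^sup>2 - x + 1"
    have nz: "a \<noteq> 0" "b \<noteq> 0" "c \<noteq> 0" using q assms by (auto simp: a_def b_def c_def)
    have e: "4 * x\<^sup>2 + 4 * 1 * x + 1\<^sup>2 + 3 = 4 * b" "4 * x\<^sup>2 + 4 * (- 1) * x + (- 1)\<^sup>2 + 3 = 4 * c"
      by (simp_all add: b_def c_def)
    have "1 / a / 3 - (2 * x + 1) / b / 4 + (2 * x - 1) / c / 12 - 1 / (4 * b) + 1 / (4 * c)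
        = (4 * b * c - 3 * (2 * x + 1) * a * c + (2 * x - 1) * a * b - 3 * a * c + 3 * a * b) / (12 * (a * b * c))"
      using nz by (simp add: divide_simps) (simp add: algebra_simps)
    also have "4 * b * c - 3 * (2 * x + 1) * a * c + (2 * x - 1) * a * b - 3 * a * c + 3 * a * b = 12 * x\<^sup>2"
      by (simp add: a_def b_def c_def power2_eq_square algebra_simps)
    also have "12 * x\<^sup>2 / (12 * (a * b * c)) = x\<^sup>2 / (a * b * c)" by simp
    finally show ?thesis unfolding e corner_den_def a_def b_def c_def .
  qed
  ultimately show ?thesis by simp
qed

lemma corner_den_geometric:
  "(\<Sum>i<N. x ^ (6 * i + 3) - x ^ (6 * i + 2)) * corner_den x = x\<^sup>2 * x ^ (6 * N) - x\<^sup>2"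
proof (induction N)
  case (Suc N)
  have d: "corner_den x * (x - 1) = x ^ 6 - 1"
    by (simp add: corner_den_def algebra_simps numeral_eq_Suc)
  have "x ^ (6 * N + 3) - x ^ (6 * N + 2) = x ^ (6 * N) * x\<^sup>2 * (x - 1)"
    by (simp add: power_add algebra_simps power2_eq_square power3_eq_cube)
  then have "(x ^ (6 * N + 3) - x ^ (6 * N + 2)) * corner_den x = x ^ (6 * N) * x\<^sup>2 * (corner_den x * (x - 1))"
    by (simp only: mult_ac)
  also have "\<dots> = x\<^sup>2 * x ^ (6 * Suc N) - x\<^sup>2 * x ^ (6 * N)"
    unfolding d by (simp add: power_add algebra_simps)
  finally show ?case using Suc by (simp add: distrib_right)
qed simp

text \<open>No integral or limit interchange is needed. Partial sum plus primitive, as a function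
  \<open>H\<close> of \<open>x\<close>, has as derivative the geometric remainder \<open>h\<close>,
  and \<open>0 \<le> h x \<le> x ^ (6 * N + 2)\<close> on \<open>[0, 1]\<close>; monotonicity of
  \<open>H\<close> and of \<open>K\<close> gives the two bounds.\<close>

lemma corner_partial_sum_bounds:
  defines "s \<equiv> \<lambda>N. \<Sum>i<N. 1 / (6 * real i + 4) - 1 / (6 * real i + 3)"
  shows "corner_prim 0 - corner_prim 1 \<le> s N" "s N \<le> corner_prim 0 - corner_prim 1 + 1 / (6 * real N + 3)"
proof -
  define H where "H x = (\<Sum>i<N. x ^ (6 * i + 4) / (6 * real i + 4) - x ^ (6 * i + 3) / (6 * real i + 3)) + corner_prim x" for x
  define h where "h x = x\<^sup>2 * x ^ (6 * N) / corner_den x" for x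
  have den: "1 \<le> corner_den x" if "0 \<le> x" for x
  proof -
    have "corner_den x = 1 + x * (1 + x + x\<^sup>2 + x ^ 3 + x ^ 4)"
      by (simp add: corner_den_def algebra_simps numeral_eq_Suc)
    then show ?thesis using that by simp
  qed
  have H: "(H has_real_derivative h x) (at x)" if "0 \<le> x" for x
  proof -
    have "((\<lambda>x. \<Sum>i<N. x ^ (6 * i + 4) / (6 * real i + 4) - x ^ (6 * i + 3) / (6 * real i + 3))
        has_real_derivative (\<Sum>i<N. x ^ (6 * i + 3) - x ^ (6 * i + 2))) (at x)"
    proof (intro DERIV_sum DERIV_diff)
      fix i :: nat
      have "((\<lambda>x. x ^ Suc k / real (Suc k)) has_real_derivative x ^ k) (at x)" for k
      proof -
        have "((\<lambda>x. x ^ Suc k / real (Suc k)) has_real_derivative (real (Suc k) * x ^ k) / real (Suc k)) (at x)"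
          by (rule DERIV_cdivide) (rule derivative_eq_intros refl | simp)+
        then show ?thesis by simp
      qed
      from this[of "6 * i + 3"] this[of "6 * i + 2"]
      show "((\<lambda>x. x ^ (6 * i + 4) / (6 * real i + 4)) has_real_derivative x ^ (6 * i + 3)) (at x)"
        "((\<lambda>x. x ^ (6 * i + 3) / (6 * real i + 3)) has_real_derivative x ^ (6 * i + 2)) (at x)"
        by (simp_all add: eval_nat_numeral add_ac)
    qed
    then have "(H has_real_derivative (\<Sum>i<N. x ^ (6 * i + 3) - x ^ (6 * i + 2)) + x\<^sup>2 / corner_den x) (at x)"
      unfolding H_def by (intro DERIV_add corner_prim_deriv that)
    moreover have "(\<Sum>i<N. x ^ (6 * i + 3) - x ^ (6 * i + 2)) + x\<^sup>2 / corner_den x = h x"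
    proof -
      have "(\<Sum>i<N. x ^ (6 * i + 3) - x ^ (6 * i + 2)) = (x\<^sup>2 * x ^ (6 * N) - x\<^sup>2) / corner_den x"
        using corner_den_geometric[of x N] den[OF that] by (simp add: eq_divide_eq)
      then show ?thesis by (simp add: h_def diff_divide_distrib)
    qed
    ultimately show ?thesis by simp
  qed
  have H1: "H 1 = s N + corner_prim 1" and H0: "H 0 = corner_prim 0"
    by (simp_all add: H_def s_def power_0_left)
  have "H 0 \<le> H 1"
  proof (rule DERIV_nonneg_imp_nondecreasing[where f = H])
    fix x :: real assume x: "0 \<le> x" "x \<le> 1"
    then show "\<exists>y. (H has_real_derivative y) (at x) \<and> 0 \<le> y"
      using H[of x] den[of x] by (intro exI[of _ "h x"]) (simp add: h_def)
  qed simp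
  then show "corner_prim 0 - corner_prim 1 \<le> s N" using H0 H1 by simp
  define K where "K x = x ^ Suc (6 * N + 2) / real (Suc (6 * N + 2)) - H x" for x
  have "K 0 \<le> K 1"
  proof (rule DERIV_nonneg_imp_nondecreasing[where f = K])
    fix x :: real assume x: "0 \<le> x" "x \<le> 1"
    have "((\<lambda>x. x ^ Suc (6 * N + 2) / real (Suc (6 * N + 2))) has_real_derivative
        (real (Suc (6 * N + 2)) * x ^ (6 * N + 2)) / real (Suc (6 * N + 2))) (at x)"
      by (rule DERIV_cdivide) (rule derivative_eq_intros refl | simp)+
    then have "(K has_real_derivative x ^ (6 * N + 2) - h x) (at x)"
      unfolding K_def using H[of x] x by (intro DERIV_diff) (simp_all del: power_Suc)
    moreover have "h x \<le> x ^ (6 * N + 2)"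
    proof -
      have "h x = x ^ (6 * N + 2) / corner_den x" by (simp add: h_def power_add power2_eq_square mult_ac)
      also have "\<dots> \<le> x ^ (6 * N + 2) / 1" using den[of x] x by (intro divide_left_mono) auto
      finally show ?thesis by simp
    qed
    ultimately show "\<exists>y. (K has_real_derivative y) (at x) \<and> 0 \<le> y" by auto
  qed simp
  then show "s N \<le> corner_prim 0 - corner_prim 1 + 1 / (6 * real N + 3)"
    using H0 H1 by (simp add: K_def add_ac)
qed

lemma arctan_sqrt_3: "arctan (sqrt 3) = pi / 3" "arctan (1 / sqrt 3) = pi / 6"
proof -
  show "arctan (sqrt 3) = pi / 3" by (rule arctan_unique) (use pi_gt_zero in \<open>simp_all add: tan_60 del: pi_gt_zero\<close>)
  show "arctan (1 / sqrt 3) = pi / 6" by (rule arctan_unique) (use pi_gt_zero in \<open>simp_all add: tan_30 del: pi_gt_zero\<close>)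
qed

lemma corner_prim_diff: "corner_prim 0 - corner_prim 1 = ln 3 / 4 - ln 2 / 3 - pi / (12 * sqrt 3)"
proof -
  have m: "arctan (- 1 / sqrt 3) = - (pi / 6)"
    using arctan_minus[of "1 / sqrt 3"] arctan_sqrt_3(2) by simp
  have t: "3 / sqrt 3 = sqrt (3 :: real)" by (simp add: real_div_sqrt)
  have 0: "corner_prim 0 = - (pi / 6) / (2 * sqrt 3) + - (pi / 6) / (2 * sqrt 3)"
    unfolding corner_prim_def by (simp add: m[simplified] arctan_sqrt_3(2))
  have 1: "corner_prim 1 = ln 2 / 3 - ln 3 / 4 - (pi / 3) / (2 * sqrt 3) + (pi / 6) / (2 * sqrt 3)"
    unfolding corner_prim_def by (simp add: arctan_sqrt_3 t)
  show ?thesis unfolding 0 1 by (simp add: field_simps)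
qed

lemma corner_series_sums:
  "(\<lambda>i. 1 / (6 * real i + 4) - 1 / (6 * real i + 3)) sums (ln 3 / 4 - ln 2 / 3 - pi / (12 * sqrt 3))"
  unfolding sums_def corner_prim_diff[symmetric]
proof (rule tendsto_sandwich[where f = "\<lambda>_. corner_prim 0 - corner_prim 1"
      and h = "\<lambda>N. corner_prim 0 - corner_prim 1 + 1 / (6 * real N + 3)"])
  have "(\<lambda>N. 1 / (6 * real N + 3)) \<longlonglongrightarrow> 0"
    by real_asymp
  from tendsto_add[OF tendsto_const[of "corner_prim 0 - corner_prim 1"] this]
  show "(\<lambda>N. corner_prim 0 - corner_prim 1 + 1 / (6 * real N + 3)) \<longlonglongrightarrow> corner_prim 0 - corner_prim 1"
    by simp
qed (use corner_partial_sum_bounds in \<open>auto intro!: always_eventually\<close>)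

lemma inverse_odd_squares_sums: "(\<lambda>i. 1 / (2 * real i + 1)\<^sup>2) sums (pi\<^sup>2 / 8)"
proof -
  have a: "(\<lambda>i. 1 / (real i + 1)\<^sup>2) sums (pi\<^sup>2 / 6)"
    using inverse_squares_sums by (simp add: add_ac)
  from sums_group[OF this, of 2]
  have b: "(\<lambda>i. 1 / (2 * real i + 1)\<^sup>2 + 1 / (2 * real i + 2)\<^sup>2) sums (pi\<^sup>2 / 6)"
    by (simp add: mult.commute numeral_2_eq_2 add_ac)
  have "(\<lambda>i. 1 / 4 * (1 / (real i + 1)\<^sup>2)) sums (1 / 4 * (pi\<^sup>2 / 6))"
    using a by (rule sums_mult)
  moreover have "1 / 4 * (1 / (real i + 1)\<^sup>2) = 1 / (2 * real i + 2)\<^sup>2" for i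
  proof -
    have "2 * real i + 2 = 2 * (real i + 1)" by simp
    then show ?thesis by (simp only: power_mult_distrib) simp
  qed
  ultimately have c: "(\<lambda>i. 1 / (2 * real i + 2)\<^sup>2) sums (pi\<^sup>2 / 24)" by simp
  from sums_diff[OF b c] show ?thesis by (simp add: field_simps)
qed

lemma C_star_pos: "0 < C_star"
  by (simp add: C_star_def)

lemma ln_C_star: "ln C_star = 9 / 4 * ln 3 - 3 * ln 2 + (pi\<^sup>2 - 2 * sqrt 3 * pi) / 8"
proof -
  have "ln C_star = ln (3 powr (9 / 4) / 2 ^ 3) + ln (exp ((pi\<^sup>2 - 2 * sqrt 3 * pi) / 8))"
    unfolding C_star_def by (rule ln_mult_pos) simp_all
  also have "ln (3 powr (9 / 4) / 2 ^ 3 :: real) = 9 / 4 * ln 3 - 3 * ln 2"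
  proof -
    have "ln (2 ^ 3 :: real) = 3 * ln 2" by (subst ln_realpow) simp_all
    moreover have "ln (3 powr (9 / 4) / 2 ^ 3 :: real) = ln (3 powr (9 / 4)) - ln (2 ^ 3)"
      by (rule ln_divide_pos) simp_all
    ultimately show ?thesis by (simp only: ln_powr)
  qed
  finally show ?thesis by simp
qed

text \<open>Partial fractions: \<open>9 / (k\<^sup>2 * (k + 1)) = 9 / k\<^sup>2 + 9 * (1 / (k + 1) -
  1 / k)\<close>. With \<open>k = 3 * (2 * i + 1)\<close> the first part is the series of inverse
  odd squares, the second the corner series.\<close>

lemma ln_C_star_sums:
  "(\<lambda>i. 9 / ((6 * real i + 3)\<^sup>2 * (6 * real i + 4))) sums ln C_star"
proof -
  have "(\<lambda>i. 1 / (2 * real i + 1)\<^sup>2 + 9 * (1 / (6 * real i + 4) - 1 / (6 * real i + 3)))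
      sums (pi\<^sup>2 / 8 + 9 * (ln 3 / 4 - ln 2 / 3 - pi / (12 * sqrt 3)))"
    by (intro sums_add sums_mult inverse_odd_squares_sums corner_series_sums)
  moreover have "1 / (2 * real i + 1)\<^sup>2 + 9 * (1 / (6 * real i + 4) - 1 / (6 * real i + 3))
      = 9 / ((6 * real i + 3)\<^sup>2 * (6 * real i + 4))" for i
  proof -
    define k where "k = 6 * real i + 3"
    have k: "k > 0" by (simp add: k_def)
    have "2 * real i + 1 = k / 3" "6 * real i + 4 = k + 1" by (simp_all add: k_def)
    moreover have "1 / (k / 3)\<^sup>2 + 9 * (1 / (k + 1) - 1 / k) = 9 / (k\<^sup>2 * (k + 1))"
      using k by (simp add: power2_eq_square divide_simps) (simp add: algebra_simps)?
    ultimately show ?thesis by (simp only: k_def[symmetric])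
  qed
  moreover have "pi\<^sup>2 / 8 + 9 * (ln 3 / 4 - ln 2 / 3 - pi / (12 * sqrt 3)) = ln C_star"
  proof -
    have "pi / (12 * sqrt 3) = sqrt 3 * pi / 36"
      by (simp add: field_simps)
    then show ?thesis unfolding ln_C_star by (simp add: field_simps)
  qed
  ultimately show ?thesis by simp
qed

section \<open>Numerical enclosure of \<open>C_star\<close>\<close>

lemma exp_taylor_7:
  fixes x :: real
  assumes "\<bar>x\<bar> \<le> 1 / 2"
  shows "exp x \<le> (\<Sum>m<7. x ^ m / fact m) + 2 / 5040 * \<bar>x\<bar> ^ 7"
    and "(\<Sum>m<7. x ^ m / fact m) - 2 / 5040 * \<bar>x\<bar> ^ 7 \<le> exp x"
proof -
  obtain t where t: "\<bar>t\<bar> \<le> \<bar>x\<bar>" and e: "exp x = (\<Sum>m<7. x ^ m / fact m) + exp t / fact 7 * x ^ 7"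
    using Maclaurin_exp_le[of x 7] by auto
  have "exp t \<le> 2" using exp_bound_half[of t] t assms by simp
  then have "exp t / fact 7 * \<bar>x\<bar> ^ 7 \<le> 2 / fact 7 * \<bar>x\<bar> ^ 7"
    by (intro mult_right_mono divide_right_mono) auto
  moreover have "\<bar>exp x - (\<Sum>m<7. x ^ m / fact m)\<bar> = exp t / fact 7 * \<bar>x\<bar> ^ 7"
    unfolding e by (simp add: abs_mult power_abs)
  moreover have "(fact 7 :: real) = 5040" by (simp add: fact_numeral)
  ultimately have "\<bar>exp x - (\<Sum>m<7. x ^ m / fact m)\<bar> \<le> 2 / 5040 * \<bar>x\<bar> ^ 7" by simp
  then show "exp x \<le> (\<Sum>m<7. x ^ m / fact m) + 2 / 5040 * \<bar>x\<bar> ^ 7"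
    and "(\<Sum>m<7. x ^ m / fact m) - 2 / 5040 * \<bar>x\<bar> ^ 7 \<le> exp x"
    unfolding abs_le_iff by linarith+
qed

lemma C_star_bounds: "1.3044565 \<le> C_star" "C_star \<le> 1.3044575"
proof -
  \<comment> \<open>Then \<open>C_star = 9 / 8 * 3 powr (1 / 4) * exp (- y)\<close> with
    \<open>y\<close> near 0.127, small enough for a Taylor polynomial of degree six.\<close>
  define y where "y = pi * (2 * sqrt 3 - pi) / 8"
  have s: "1.7320508075 \<le> sqrt 3" "sqrt 3 \<le> 1.7320508076"
  proof -
    show "1.7320508075 \<le> sqrt 3" by (rule real_le_rsqrt) (simp add: power2_eq_square)
    show "sqrt 3 \<le> 1.7320508076" by (rule real_le_lsqrt) (simp_all add: power2_eq_square)
  qed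
  define r :: real where "r = 3 powr (1 / 4)"
  have r2: "r\<^sup>2 = sqrt 3"
    by (simp add: r_def powr_realpow[symmetric] powr_powr powr_half_sqrt)
  have r0: "0 \<le> r" by (simp add: r_def)
  have r: "1.3160740129 \<le> r" "r \<le> 1.3160740130"
  proof -
    have "1.3160740129\<^sup>2 \<le> r\<^sup>2" unfolding r2 using s(1) by (rule order.trans[rotated]) (simp add: power2_eq_square)
    then show "1.3160740129 \<le> r" using r0 by (rule power2_le_imp_le)
    have "r\<^sup>2 \<le> 1.3160740130\<^sup>2" unfolding r2 using s(2) by (rule order.trans) (simp add: power2_eq_square)
    then show "r \<le> 1.3160740130" by (rule power2_le_imp_le) simp
  qed
  have p94: "3 powr (9 / 4) = 9 * r"
  proof -
    have "(3::real) powr (9 / 4) = 3 powr (2 + 1 / 4)" by simp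
    also have "\<dots> = 3 powr 2 * r" unfolding r_def by (rule powr_add)
    finally show ?thesis by simp
  qed
  have C: "C_star = 9 / 8 * r * exp (- y)"
    unfolding C_star_def p94 by (simp add: y_def power2_eq_square field_simps)
  have y: "0.1266489729 \<le> y" "y \<le> 0.1266489731"
  proof -
    have "3.141592653588 * (2 * 1.7320508075 - 3.1415926535899) \<le> pi * (2 * sqrt 3 - pi)"
      using pi_approx s by (intro mult_mono) auto
    moreover have "pi * (2 * sqrt 3 - pi) \<le> 3.1415926535899 * (2 * 1.7320508076 - 3.141592653588)"
      using pi_approx s by (intro mult_mono) auto
    ultimately show "0.1266489729 \<le> y" "y \<le> 0.1266489731" by (auto simp: y_def)
  qed
  have sum7: "(\<Sum>m<7. x ^ m / fact m) = 1 + x + x^2/2 + x^3/6 + x^4/24 + x^5/120 + x^6/720" for x :: real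
    by (simp add: numeral_eq_Suc)
  have "exp (- y) \<le> exp (- 0.1266489729)" using y by simp
  also have "\<dots> \<le> 0.8810428886"
    using exp_taylor_7(1)[of "- 0.1266489729"] unfolding sum7 by (simp add: power_divide)
  finally have up: "exp (- y) \<le> 0.8810428886" .
  have "0.8810428875 \<le> exp (- 0.1266489731 :: real)"
    using exp_taylor_7(2)[of "- 0.1266489731"] unfolding sum7 by (simp add: power_divide)
  also have "\<dots> \<le> exp (- y)" using y by simp
  finally have lo: "0.8810428875 \<le> exp (- y)" .
  have "r * exp (- y) \<le> 1.3160740130 * 0.8810428886" using r r0 up by (intro mult_mono) auto
  then show "C_star \<le> 1.3044575" unfolding C by simp
  have "1.3160740129 * 0.8810428875 \<le> r * exp (- y)" using r r0 lo by (intro mult_mono) auto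
  then show "1.3044565 \<le> C_star" unfolding C by simp
qed

subsection \<open>Asymptotics of the configurations\<close>

lemma sum_limit_term: "(\<Sum>i. limit_term i) = 8 / pi\<^sup>2 * ln C_star"
proof -
  have "limit_term = (\<lambda>i. 8 / pi\<^sup>2 * (9 / ((6 * real i + 3)\<^sup>2 * (6 * real i + 4))))"
    by (simp add: limit_term_def fun_eq_iff)
  then show ?thesis
    using sums_mult[OF ln_C_star_sums, of "8 / pi\<^sup>2"] by (simp add: sums_iff)
qed

definition half_angle_tan :: "nat \<Rightarrow> real" where
  "half_angle_tan m = tan (pi / (12 * real m))"

lemma half_angle_tan_limits:
  "half_angle_tan \<longlonglongrightarrow> 0"
  "(\<lambda>m. 6 * real m * half_angle_tan m) \<longlonglongrightarrow> pi / 2"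
  unfolding half_angle_tan_def by real_asymp+

lemma half_angle_tan_small: "\<forall>\<^sub>F m in sequentially. \<bar>half_angle_tan m\<bar> * (pi / 2) \<le> 1 / 2"
proof -
  have "(\<lambda>m. \<bar>half_angle_tan m\<bar> * (pi / 2)) \<longlonglongrightarrow> \<bar>0\<bar> * (pi / 2)"
    by (intro tendsto_intros half_angle_tan_limits)
  then have "\<forall>\<^sub>F m in sequentially. \<bar>half_angle_tan m\<bar> * (pi / 2) < 1 / 2"
    by (rule order_tendstoD) simp
  then show ?thesis by eventually_elim simp
qed

lemma error_term_tendsto_0:
  "(\<lambda>m. 2 * (6 * real m)\<^sup>2 * (\<bar>half_angle_tan m\<bar> * (pi / 2)) ^ 3) \<longlonglongrightarrow> 0"
proof -
  have "(\<lambda>m. 2 * (pi / 2) ^ 3 * (6 * real m * half_angle_tan m)\<^sup>2 * \<bar>half_angle_tan m\<bar>)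
      \<longlonglongrightarrow> 2 * (pi / 2) ^ 3 * (pi / 2)\<^sup>2 * \<bar>0\<bar>"
    by (intro tendsto_intros half_angle_tan_limits)
  moreover have "2 * (pi / 2) ^ 3 * (6 * real m * half_angle_tan m)\<^sup>2 * \<bar>half_angle_tan m\<bar>
      = 2 * (6 * real m)\<^sup>2 * (\<bar>half_angle_tan m\<bar> * (pi / 2)) ^ 3" for m
  proof -
    define t where "t = half_angle_tan m"
    have "\<bar>t\<bar> ^ 3 = t\<^sup>2 * \<bar>t\<bar>"
      by (simp add: power3_eq_cube power2_eq_square)
    then show ?thesis
      unfolding t_def[symmetric] power_mult_distrib by simp
  qed
  ultimately show ?thesis by simp
qed

lemma exp_tendsto_of_ln:
  fixes P a :: "nat \<Rightarrow> real"
  assumes "\<forall>\<^sub>F m in sequentially. 0 < P m \<and> \<bar>ln (P m) - a m\<bar> \<le> e m"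
    and "a \<longlonglongrightarrow> l" and "e \<longlonglongrightarrow> 0"
  shows "P \<longlonglongrightarrow> exp l"
proof -
  have "(\<lambda>m. ln (P m) - a m) \<longlonglongrightarrow> 0"
    by (rule Lim_null_comparison[OF _ assms(3)]) (use assms(1) in eventually_elim, simp)
  from tendsto_add[OF this assms(2)] have "(\<lambda>m. ln (P m)) \<longlonglongrightarrow> l" by simp
  then have "(\<lambda>m. exp (ln (P m))) \<longlonglongrightarrow> exp l" by (rule tendsto_exp)
  then show ?thesis
    by (rule Lim_transform_eventually) (use assms(1) in eventually_elim, simp)
qed

lemma twist_mean_zero: "m > 0 \<Longrightarrow> (\<Sum>j<6 * m. twist m j / node m j) = 0"
  using twist_fourier_zero[of m 0] by simp

lemma dist_prod_pt_tendsto: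
  "(\<lambda>m. dist_prod (6 * m) (pt m) / real (6 * m) ^ (6 * m)) \<longlonglongrightarrow> C_star"
proof -
  define S where "S m = (\<Sum>i<m. quad_term m i)" for m
  have "(\<lambda>m. dist_prod (6 * m) (pt m) / real (6 * m) ^ (6 * m)) \<longlonglongrightarrow> exp (ln C_star)"
  proof (rule exp_tendsto_of_ln)
    show "\<forall>\<^sub>F m in sequentially. 0 < dist_prod (6 * m) (pt m) / real (6 * m) ^ (6 * m) \<and>
       \<bar>ln (dist_prod (6 * m) (pt m) / real (6 * m) ^ (6 * m)) - (6 * real m * half_angle_tan m)\<^sup>2 / 2 * S m\<bar>
       \<le> 2 * (6 * real m)\<^sup>2 * (\<bar>half_angle_tan m\<bar> * (pi / 2)) ^ 3"
      using half_angle_tan_small eventually_gt_at_top[of 0]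
    proof eventually_elim
      case (elim m)
      interpret root_grid "6 * m" "node m" "-1" by (rule root_grid_node) (use elim in simp)
      have pt: "pt m = (\<lambda>j. node m j + \<i> * of_real (half_angle_tan m) * twist m j)"
        by (simp add: pt_def half_angle_tan_def fun_eq_iff)
      have Q: "Re (\<Sum>j<6 * m. \<Sum>l\<in>{..<6 * m} - {j}. ((twist m j - twist m l) / (node m j - node m l))\<^sup>2)
          = (6 * real m)\<^sup>2 * S m"
        using sum_chord_quot_squares[of m] elim by (simp add: chord_quot_def S_def)
      have eq: "(half_angle_tan m)\<^sup>2 / 2 * ((6 * real m)\<^sup>2 * S m) = (6 * real m * half_angle_tan m)\<^sup>2 / 2 * S m"
        by (simp add: power_mult_distrib)
      have n6: "real (6 * m) = 6 * real m" by simp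
      note est = ln_dist_prod_perturbed[of "twist m" "pi / 2" "half_angle_tan m",
          OF twist_lipschitz twist_mean_zero elim(1) pi_half_ge_zero, OF elim(2) _ _ elim(2), folded pt]
      show ?case
        using est(1) est(2)[unfolded Q eq n6] unfolding n6 by (rule conjI)
    qed
    have "(\<lambda>m. (6 * real m * half_angle_tan m)\<^sup>2 / 2 * S m) \<longlonglongrightarrow> (pi / 2)\<^sup>2 / 2 * (8 / pi\<^sup>2 * ln C_star)"
      unfolding S_def sum_limit_term[symmetric]
      by (intro tendsto_intros half_angle_tan_limits sum_quad_term_tendsto) simp
    then show "(\<lambda>m. (6 * real m * half_angle_tan m)\<^sup>2 / 2 * S m) \<longlonglongrightarrow> ln C_star"
      by (simp add: power2_eq_square)
  qed (rule error_term_tendsto_0)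
  then show ?thesis using C_star_pos by simp
qed

text \<open>The growth \<open>n log n\<close> of this sum makes the error in passing from all nodes
  to every third node negligible.\<close>

lemma (in root_grid) sum_inverse_distances_le:
  assumes "j < n"
  shows "(\<Sum>l\<in>{..<n} - {j}. 1 / cmod (w j - w l)) \<le> real n / 2 * harm n"
proof -
  have "(\<Sum>l\<in>{..<n} - {j}. 1 / cmod (w j - w l)) = (\<Sum>l\<in>{..<n} - {j}. 1 / cmod (1 - w l / w j))"
  proof (rule sum.cong)
    fix l
    have "w j - w l = w j * (1 - w l / w j)" using nz[OF assms] by (simp add: field_simps)
    then show "1 / cmod (w j - w l) = 1 / cmod (1 - w l / w j)"
      by (metis norm_mult unit[OF assms] mult_1)
  qed simp
  also have "\<dots> = (\<Sum>r\<in>{r. r ^ n = 1} - {1}. 1 / cmod (1 - r))"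
    using sum.reindex_bij_betw[OF ratio_bij[OF assms], of "\<lambda>r. 1 / cmod (1 - r)"] by simp
  also have "\<dots> = (\<Sum>d\<in>{..<n} - {0}. 1 / cmod (1 - cis (2 * pi * real d / real n)))"
  proof (rule sum.reindex_bij_betw [symmetric])
    have "bij_betw (\<lambda>k. cis (2 * pi * real k / real n)) ({..<n} - {0}) ({z. z ^ n = 1} - {cis (2 * pi * real 0 / real n)})"
      using Complex.bij_betw_roots_unity[OF n_pos] n_pos by (intro bij_betw_DiffI) auto
    then show "bij_betw (\<lambda>k. cis (2 * pi * real k / real n)) ({..<n} - {0}) ({z. z ^ n = 1} - {1})"
      by simp
  qed
  also have "\<dots> \<le> (\<Sum>d\<in>{..<n} - {0}. real n / 4 * (1 / real d) + real n / 4 * (1 / real (n - d)))"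
  proof (rule sum_mono)
    fix d assume d: "d \<in> {..<n} - {0}"
    define t where "t = real d / real n"
    have t: "0 < t" "t < 1" using d by (auto simp: t_def)
    have "cmod (1 - cis (2 * pi * real d / real n)) = 2 * \<bar>sin (pi * t)\<bar>"
      using cmod_cis_diff[of 0 "2 * pi * real d / real n"] by (simp add: t_def)
    moreover have "2 * min t (1 - t) \<le> sin (pi * t)" using t by (intro sin_ge_min) auto
    moreover have "0 < min t (1 - t)" using t by simp
    ultimately have ge: "4 * min t (1 - t) \<le> cmod (1 - cis (2 * pi * real d / real n))" by linarith
    have "1 / cmod (1 - cis (2 * pi * real d / real n)) \<le> 1 / (4 * min t (1 - t))"
      using ge t by (intro divide_left_mono) (auto intro!: mult_pos_pos)
    \<comment> \<open>Replacing the minimum by both terms yields two harmonic sums, exchanged by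
      \<open>d \<mapsto> n - d\<close>.\<close>
    also have "\<dots> \<le> 1 / 4 * (1 / t) + 1 / 4 * (1 / (1 - t))"
      using t by (auto simp: min_def)
    also have "\<dots> = real n / 4 * (1 / real d) + real n / 4 * (1 / real (n - d))"
      using d by (simp add: t_def of_nat_diff field_simps)
    finally show "1 / cmod (1 - cis (2 * pi * real d / real n)) \<le> real n / 4 * (1 / real d) + real n / 4 * (1 / real (n - d))" .
  qed
  also have "\<dots> = real n / 4 * (\<Sum>d\<in>{..<n} - {0}. 1 / real d) + real n / 4 * (\<Sum>d\<in>{..<n} - {0}. 1 / real (n - d))"
    by (simp add: sum.distrib sum_distrib_left)
  also have "(\<Sum>d\<in>{..<n} - {0}. 1 / real (n - d)) = (\<Sum>d\<in>{..<n} - {0}. 1 / real d)"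
    by (rule sum.reindex_bij_witness[of _ "\<lambda>d. n - d" "\<lambda>d. n - d"]) auto
  also have "(\<Sum>d\<in>{..<n} - {0}. 1 / real d) \<le> harm n"
    unfolding harm_def by (simp add: inverse_eq_divide) (intro sum_mono2; auto)
  finally show ?thesis using n_pos by (simp add: mult_left_mono mult_ac)
qed

section \<open>The quadratic form on every third node\<close>

lemma sum_triples: "(\<Sum>J<3 * N. f J) = (\<Sum>j<N. \<Sum>a<3. f (3 * j + a))" for f :: "nat \<Rightarrow> 'a::comm_monoid_add"
proof (induction N)
  case (Suc N)
  have "3 * Suc N = 3 * N + 3" by simp
  then show ?case using Suc by (simp only: sum_lessThan_add sum.lessThan_Suc) (simp add: add.commute)
qed simp

lemma chord_quot_self [simp]: "chord_quot m j j = 0"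
  by (simp add: chord_quot_def)

definition third_quad :: "nat \<Rightarrow> complex" where
  "third_quad m = (\<Sum>j<2 * m. \<Sum>l\<in>{..<2 * m} - {j}. (chord_quot m (3 * j) (3 * l))\<^sup>2)"

text \<open>Moving both indices within their triples changes numerator and denominator by at most
  four node spacings. Since the quotients stay bounded by \<open>pi / 2\<close>, only one inverse
  chord is lost.\<close>

lemma chord_quot_perturb:
  assumes "m > 0" "j < 2 * m" "l < 2 * m" "j \<noteq> l" "a < 3" "b < 3"
  shows "cmod ((chord_quot m (3 * j + a) (3 * l + b))\<^sup>2 - (chord_quot m (3 * j) (3 * l))\<^sup>2)
    \<le> 4 * pi\<^sup>2 * (1 + pi / 2) / (3 * real m) * (1 / cmod (node m (3 * j) - node m (3 * l)))"
proof -
  define \<delta> where "\<delta> = pi / (3 * real m)"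
  have \<delta>: "0 \<le> \<delta>" by (simp add: \<delta>_def)
  define x x' y y' where "x = twist m (3 * j) - twist m (3 * l)" and "x' = twist m (3 * j + a) - twist m (3 * l + b)"
    and "y = node m (3 * j) - node m (3 * l)" and "y' = node m (3 * j + a) - node m (3 * l + b)"
  have c: "chord_quot m (3 * j) (3 * l) = x / y" and c': "chord_quot m (3 * j + a) (3 * l + b) = x' / y'"
    by (simp_all add: chord_quot_def x_def x'_def y_def y'_def)
  have lt: "3 * j < 6 * m" "3 * l < 6 * m" "3 * j + a < 6 * m" "3 * l + b < 6 * m"
    using assms by linarith+
  have neq: "3 * j \<noteq> 3 * l" "3 * j + a \<noteq> 3 * l + b" using assms by presburger+
  have ynz: "y \<noteq> 0" "y' \<noteq> 0"
    using inj_onD[OF node_inj[OF assms(1)]] lt neq unfolding y_def y'_def by (metis lessThan_iff right_minus_eq)+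
  have le2: "real k * \<delta> \<le> 2 * \<delta>" if "k < 3" for k :: nat
    using that \<delta> by (intro mult_right_mono) auto
  have xd: "cmod (x' - x) \<le> 4 * \<delta>"
  proof -
    have "x' - x = (twist m (3 * j + a) - twist m (3 * j)) - (twist m (3 * l + b) - twist m (3 * l))"
      by (simp add: x_def x'_def)
    then have "cmod (x' - x) \<le> cmod (twist m (3 * j + a) - twist m (3 * j)) + cmod (twist m (3 * l + b) - twist m (3 * l))"
      by (metis norm_triangle_ineq4)
    also have "\<dots> \<le> real a * \<delta> + real b * \<delta>"
      unfolding \<delta>_def by (intro add_mono twist_diff_le assms)
    finally show ?thesis using le2[OF assms(5)] le2[OF assms(6)] by linarith
  qed
  have yd: "cmod (y' - y) \<le> 4 * \<delta>"
  proof -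
    have "y' - y = (node m (3 * j + a) - node m (3 * j)) - (node m (3 * l + b) - node m (3 * l))"
      by (simp add: y_def y'_def)
    then have "cmod (y' - y) \<le> cmod (node m (3 * j + a) - node m (3 * j)) + cmod (node m (3 * l + b) - node m (3 * l))"
      by (metis norm_triangle_ineq4)
    also have "\<dots> \<le> real a * \<delta> + real b * \<delta>"
      unfolding \<delta>_def by (intro add_mono node_diff_le)
    finally show ?thesis using le2[OF assms(5)] le2[OF assms(6)] by linarith
  qed
  have q: "cmod (x / y) \<le> pi / 2" "cmod (x' / y') \<le> pi / 2"
    unfolding c[symmetric] c'[symmetric] by (intro norm_chord_quot_le assms lt)+
  \<comment> \<open>Written so that the bounded quotient \<open>x' / y'\<close> absorbs the
    perturbed denominator and only the coarse chord \<open>y\<close> is divided by.\<close>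
  have "x' / y' - x / y = ((x' - x) - x' / y' * (y' - y)) / y"
    using ynz by (simp add: field_simps)
  then have "cmod (x' / y' - x / y) = cmod ((x' - x) - x' / y' * (y' - y)) / cmod y" by (simp add: norm_divide)
  also have "\<dots> \<le> (4 * \<delta> + pi / 2 * (4 * \<delta>)) / cmod y"
  proof (intro divide_right_mono)
    have "cmod ((x' - x) - x' / y' * (y' - y)) \<le> cmod (x' - x) + cmod (x' / y') * cmod (y' - y)"
      by (metis norm_triangle_ineq4 norm_mult)
    also have "\<dots> \<le> 4 * \<delta> + pi / 2 * (4 * \<delta>)"
      by (intro add_mono mult_mono xd yd q) auto
    finally show "cmod ((x' - x) - x' / y' * (y' - y)) \<le> 4 * \<delta> + pi / 2 * (4 * \<delta>)" .
  qed simp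
  finally have d: "cmod (x' / y' - x / y) \<le> (4 * \<delta> + pi / 2 * (4 * \<delta>)) / cmod y" .
  have "cmod ((x' / y')\<^sup>2 - (x / y)\<^sup>2) = cmod (x' / y' + x / y) * cmod (x' / y' - x / y)"
    by (simp only: power2_eq_square square_diff_square_factored norm_mult)
  also have "\<dots> \<le> pi * ((4 * \<delta> + pi / 2 * (4 * \<delta>)) / cmod y)"
  proof (intro mult_mono d)
    show "cmod (x' / y' + x / y) \<le> pi" using norm_triangle_ineq[of "x' / y'" "x / y"] q by linarith
  qed auto
  also have "\<dots> = 4 * pi * (1 + pi / 2) * \<delta> * (1 / cmod y)"
    using ynz by (simp add: field_simps)
  also have "\<dots> = 4 * pi\<^sup>2 * (1 + pi / 2) / (3 * real m) * (1 / cmod y)"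
    by (simp add: \<delta>_def power2_eq_square)
  finally show ?thesis unfolding c c' y_def .
qed

text \<open>The pairs of fine nodes fall into groups of nine, one group for each pair of triples,
  and each group is compared with its representative. Summing the inverse chords gives a harmonic
  number.\<close>

lemma third_quad_close:
  assumes "m > 0"
  shows "cmod (of_real ((6 * real m)\<^sup>2 * (\<Sum>i<m. quad_term m i)) - 9 * third_quad m)
    \<le> 2 * real m * (9 * (pi\<^sup>2 / 4) + 12 * pi\<^sup>2 * (1 + pi / 2) * harm (2 * m))"
proof -
  interpret g: root_grid "2 * m" "\<lambda>j. node m (3 * j)" "cis (pi / 3)" by (rule root_grid_third_node[OF assms])
  define K where "K = 4 * pi\<^sup>2 * (1 + pi / 2) / (3 * real m)"
  have diag: "(\<Sum>l\<in>{..<N} - {j}. (h l)\<^sup>2) = (\<Sum>l<N. (h l)\<^sup>2)" if "h j = 0" for N j and h :: "nat \<Rightarrow> complex"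
    by (rule sum.mono_neutral_left) (use that in auto)
  define D where "D j a l b = (chord_quot m (3 * j + a) (3 * l + b))\<^sup>2 - (chord_quot m (3 * j) (3 * l))\<^sup>2" for j a l b
  \<comment> \<open>For \<open>l = j\<close> the group holds distinct fine nodes of one triple but
    has no coarse counterpart, so the trivial bound \<open>(pi / 2)\<^sup>2\<close> is used.\<close>
  define B where "B j l = (if l = j then pi\<^sup>2 / 4 else K * (1 / cmod (node m (3 * j) - node m (3 * l))))" for j l
  have "of_real ((6 * real m)\<^sup>2 * (\<Sum>i<m. quad_term m i)) = (\<Sum>J<3 * (2 * m). \<Sum>L<3 * (2 * m). (chord_quot m J L)\<^sup>2)"
    unfolding sum_chord_quot_squares[OF assms, symmetric] by (simp add: diag)
  also have "\<dots> = (\<Sum>j<2 * m. \<Sum>a<3. \<Sum>l<2 * m. \<Sum>b<3. (chord_quot m (3 * j + a) (3 * l + b))\<^sup>2)"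
    by (simp only: sum_triples)
  finally have Q: "of_real ((6 * real m)\<^sup>2 * (\<Sum>i<m. quad_term m i))
      = (\<Sum>j<2 * m. \<Sum>a<3. \<Sum>l<2 * m. \<Sum>b<3. (chord_quot m (3 * j + a) (3 * l + b))\<^sup>2)" .
  have T: "9 * third_quad m = (\<Sum>j<2 * m. \<Sum>a<(3::nat). \<Sum>l<2 * m. \<Sum>b<(3::nat). (chord_quot m (3 * j) (3 * l))\<^sup>2)"
    unfolding third_quad_def by (simp add: diag sum_distrib_left)
  have bd: "cmod (D j a l b) \<le> B j l" if "j < 2 * m" "l < 2 * m" "a < 3" "b < 3" for j a l b
  proof (cases "l = j")
    case True
    have "cmod (chord_quot m (3 * j + a) (3 * j + b)) \<le> pi / 2"
      by (rule norm_chord_quot_le) (use that assms in linarith)+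
    then have "(cmod (chord_quot m (3 * j + a) (3 * j + b)))\<^sup>2 \<le> (pi / 2)\<^sup>2" by (intro power_mono) auto
    then show ?thesis using True by (simp add: D_def B_def norm_power power_divide)
  next
    case False
    then show ?thesis
      using chord_quot_perturb[OF assms that(1,2) _ that(3,4)] by (simp add: D_def B_def K_def)
  qed
  have "of_real ((6 * real m)\<^sup>2 * (\<Sum>i<m. quad_term m i)) - 9 * third_quad m
      = (\<Sum>j<2 * m. \<Sum>a<3. \<Sum>l<2 * m. \<Sum>b<3. D j a l b)"
    unfolding Q T D_def by (simp only: sum_subtractf)
  then have "cmod (of_real ((6 * real m)\<^sup>2 * (\<Sum>i<m. quad_term m i)) - 9 * third_quad m)
      \<le> (\<Sum>j<2 * m. \<Sum>a<(3::nat). \<Sum>l<2 * m. \<Sum>b<(3::nat). B j l)"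
    by (simp only:) (intro sum_norm_le bd; simp)
  also have "\<dots> = (\<Sum>j<2 * m. 9 * (\<Sum>l<2 * m. B j l))" by (simp add: sum_distrib_left)
  also have "\<dots> \<le> (\<Sum>j<2 * m. 9 * (pi\<^sup>2 / 4) + 12 * pi\<^sup>2 * (1 + pi / 2) * harm (2 * m))"
  proof (intro sum_mono)
    fix j assume j: "j \<in> {..<2 * m}"
    have "(\<Sum>l<2 * m. B j l) = B j j + (\<Sum>l\<in>{..<2 * m} - {j}. B j l)"
      using j by (intro sum.remove) auto
    also have "\<dots> = pi\<^sup>2 / 4 + K * (\<Sum>l\<in>{..<2 * m} - {j}. 1 / cmod (node m (3 * j) - node m (3 * l)))"
      by (simp add: B_def sum_distrib_left)
    also have "\<dots> \<le> pi\<^sup>2 / 4 + K * (real (2 * m) / 2 * harm (2 * m))"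
      using g.sum_inverse_distances_le[of j] j by (intro add_left_mono mult_left_mono) (auto simp: K_def)
    also have "K * (real (2 * m) / 2 * harm (2 * m)) = 4 * pi\<^sup>2 * (1 + pi / 2) / 3 * harm (2 * m)"
      using assms by (simp add: K_def)
    finally have "9 * (\<Sum>l<2 * m. B j l) \<le> 9 * (pi\<^sup>2 / 4 + 4 * pi\<^sup>2 * (1 + pi / 2) / 3 * harm (2 * m))"
      by (rule mult_left_mono) simp
    also have "\<dots> = 9 * (pi\<^sup>2 / 4) + 12 * pi\<^sup>2 * (1 + pi / 2) * harm (2 * m)"
      by (simp add: field_simps)
    finally show "9 * (\<Sum>l<2 * m. B j l) \<le> 9 * (pi\<^sup>2 / 4) + 12 * pi\<^sup>2 * (1 + pi / 2) * harm (2 * m)" .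
  qed
  also have "\<dots> = 2 * real m * (9 * (pi\<^sup>2 / 4) + 12 * pi\<^sup>2 * (1 + pi / 2) * harm (2 * m))" by simp
  finally show ?thesis .
qed

lemma harm_over_n_tendsto: "(\<lambda>m. harm (2 * m) / real m :: real) \<longlonglongrightarrow> 0"
proof (rule tendsto_sandwich[where f = "\<lambda>_. 0" and h = "\<lambda>m. (1 + ln (real (2 * m))) / real m"])
  show "\<forall>\<^sub>F m in sequentially. harm (2 * m) / real m \<le> (1 + ln (real (2 * m))) / real m"
    using eventually_gt_at_top[of 0]
  proof eventually_elim
    case (elim m)
    then have "harm (2 * m) - ln (real (2 * m)) \<le> (1 :: real)"
      using euler_mascheroni_sequence_decreasing[of 1 "2 * m"] by (simp add: harm_expand)
    then show ?case by (intro divide_right_mono) auto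
  qed
  show "(\<lambda>m. (1 + ln (real (2 * m))) / real m) \<longlonglongrightarrow> 0" by real_asymp
qed (auto intro!: always_eventually simp: harm_nonneg)

lemma third_quad_tendsto:
  "(\<lambda>m. Re (third_quad m) / (real m)\<^sup>2) \<longlonglongrightarrow> 32 / pi\<^sup>2 * ln C_star"
proof -
  define S where "S m = (\<Sum>i<m. quad_term m i)" for m
  define E where "E m = 2 * (9 * (pi\<^sup>2 / 4) * (1 / real m) + 12 * pi\<^sup>2 * (1 + pi / 2) * (harm (2 * m) / real m)) / 9" for m
  have "(\<lambda>m. Re (third_quad m) / (real m)\<^sup>2 - 4 * S m) \<longlonglongrightarrow> 0"
  proof (rule Lim_null_comparison)
    show "\<forall>\<^sub>F m in sequentially. norm (Re (third_quad m) / (real m)\<^sup>2 - 4 * S m) \<le> E m"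
      using eventually_gt_at_top[of 0]
    proof eventually_elim
      case (elim m)
      have "\<bar>Re (of_real ((6 * real m)\<^sup>2 * S m) - 9 * third_quad m)\<bar>
         \<le> 2 * real m * (9 * (pi\<^sup>2 / 4) + 12 * pi\<^sup>2 * (1 + pi / 2) * harm (2 * m))"
        using third_quad_close[OF elim] abs_Re_le_cmod order.trans unfolding S_def by blast
      then have "\<bar>Re (of_real ((6 * real m)\<^sup>2 * S m) - 9 * third_quad m)\<bar> / (9 * (real m)\<^sup>2)
         \<le> 2 * real m * (9 * (pi\<^sup>2 / 4) + 12 * pi\<^sup>2 * (1 + pi / 2) * harm (2 * m)) / (9 * (real m)\<^sup>2)"
        by (intro divide_right_mono) auto
      moreover have "2 * real m * (9 * (pi\<^sup>2 / 4) + 12 * pi\<^sup>2 * (1 + pi / 2) * harm (2 * m)) / (9 * (real m)\<^sup>2) = E m"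
        using elim by (simp add: E_def power2_eq_square field_simps)
      moreover have "\<bar>Re (of_real ((6 * real m)\<^sup>2 * S m) - 9 * third_quad m)\<bar> / (9 * (real m)\<^sup>2)
          = \<bar>Re (third_quad m) / (real m)\<^sup>2 - 4 * S m\<bar>"
      proof -
        have "Re (third_quad m) / (real m)\<^sup>2 - 4 * S m
          = - (Re (of_real ((6 * real m)\<^sup>2 * S m) - 9 * third_quad m) / (9 * (real m)\<^sup>2))"
          using elim by (simp add: field_simps power2_eq_square)
        then show ?thesis by (simp only: abs_minus_cancel abs_divide) simp
      qed
      ultimately show ?case by simp
    qed
    have "E \<longlonglongrightarrow> 2 * (9 * (pi\<^sup>2 / 4) * 0 + 12 * pi\<^sup>2 * (1 + pi / 2) * 0) / 9"
      unfolding E_def by (intro tendsto_intros harm_over_n_tendsto lim_const_over_n) simp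
    then show "E \<longlonglongrightarrow> 0" by simp
  qed
  moreover have "(\<lambda>m. 4 * S m) \<longlonglongrightarrow> 4 * (8 / pi\<^sup>2 * ln C_star)"
    unfolding S_def sum_limit_term[symmetric] by (intro tendsto_intros sum_quad_term_tendsto)
  ultimately have "(\<lambda>m. Re (third_quad m) / (real m)\<^sup>2 - 4 * S m + 4 * S m) \<longlonglongrightarrow> 0 + 4 * (8 / pi\<^sup>2 * ln C_star)"
    by (rule tendsto_add)
  then show ?thesis by simp
qed

lemma twist_mean_zero_thirds:
  assumes "m > 0"
  shows "(\<Sum>j<2 * m. twist m (3 * j) / node m (3 * j)) = 0"
proof -
  have "twist m (3 * (j + m)) / node m (3 * (j + m)) = - (twist m (3 * j) / node m (3 * j))" for j
  proof -
    \<comment> \<open>A shift by \<open>m\<close> in the coarse index is half a turn, that is three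
      blocks and hence three changes of sign.\<close>
    have "3 * (j + m) = 3 * j + m + m + m" by simp
    then show ?thesis by (simp only: twist_quot_shift[OF assms] minus_minus)
  qed
  then have "(\<Sum>j<m + m. twist m (3 * j) / node m (3 * j)) = 0"
    unfolding sum_lessThan_add by (simp add: sum_negf)
  then show ?thesis by (simp add: mult_2)
qed

text \<open>The amplitude is still that of the configuration with \<open>6 * m\<close> points. In
  the limit, \<open>(pi / 2)\<^sup>2 / 72 * (32 / pi\<^sup>2) = 1 / 9\<close>, where
  \<open>72 = 2 * 36\<close> and \<open>32 = 8 * 36 / 9\<close>.\<close>

lemma dist_prod_third_tendsto:
  "(\<lambda>m. dist_prod (2 * m) (\<lambda>j. pt m (3 * j)) / real (2 * m) ^ (2 * m)) \<longlonglongrightarrow> C_star powr (1 / 9)"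
proof -
  have "(\<lambda>m. dist_prod (2 * m) (\<lambda>j. pt m (3 * j)) / real (2 * m) ^ (2 * m)) \<longlonglongrightarrow> exp (ln C_star / 9)"
  proof (rule exp_tendsto_of_ln)
    show "\<forall>\<^sub>F m in sequentially. 0 < dist_prod (2 * m) (\<lambda>j. pt m (3 * j)) / real (2 * m) ^ (2 * m) \<and>
       \<bar>ln (dist_prod (2 * m) (\<lambda>j. pt m (3 * j)) / real (2 * m) ^ (2 * m))
          - (6 * real m * half_angle_tan m)\<^sup>2 / 72 * (Re (third_quad m) / (real m)\<^sup>2)\<bar>
       \<le> 2 * (6 * real m)\<^sup>2 * (\<bar>half_angle_tan m\<bar> * (pi / 2)) ^ 3"
      using half_angle_tan_small eventually_gt_at_top[of 0]
    proof eventually_elim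
      case (elim m)
      interpret root_grid "2 * m" "\<lambda>j. node m (3 * j)" "cis (pi / 3)" by (rule root_grid_third_node) (use elim in simp)
      have pt: "(\<lambda>j. pt m (3 * j)) = (\<lambda>j. node m (3 * j) + \<i> * of_real (half_angle_tan m) * twist m (3 * j))"
        by (simp add: pt_def half_angle_tan_def fun_eq_iff)
      have lip: "cmod (twist m (3 * j) - twist m (3 * l)) \<le> pi / 2 * cmod (node m (3 * j) - node m (3 * l))"
        if "j < 2 * m" "l < 2 * m" for j l
        by (rule twist_lipschitz) (use elim that in linarith)+
      note est = ln_dist_prod_perturbed[of "\<lambda>j. twist m (3 * j)" "pi / 2" "half_angle_tan m",
          OF lip twist_mean_zero_thirds[OF elim(2)] elim(1) pi_half_ge_zero,
          folded pt chord_quot_def, folded third_quad_def]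
      have eq: "(half_angle_tan m)\<^sup>2 / 2 * Re (third_quad m)
          = (6 * real m * half_angle_tan m)\<^sup>2 / 72 * (Re (third_quad m) / (real m)\<^sup>2)"
        using elim by (simp add: power_mult_distrib)
      have "2 * (real (2 * m))\<^sup>2 * (\<bar>half_angle_tan m\<bar> * (pi / 2)) ^ 3
          \<le> 2 * (6 * real m)\<^sup>2 * (\<bar>half_angle_tan m\<bar> * (pi / 2)) ^ 3"
        by (intro mult_right_mono mult_left_mono power_mono) auto
      then show ?case
        using est(1) order.trans[OF est(2)[unfolded eq]] by blast
    qed
    have "(\<lambda>m. (6 * real m * half_angle_tan m)\<^sup>2 / 72 * (Re (third_quad m) / (real m)\<^sup>2))
        \<longlonglongrightarrow> (pi / 2)\<^sup>2 / 72 * (32 / pi\<^sup>2 * ln C_star)"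
      by (intro tendsto_intros half_angle_tan_limits third_quad_tendsto) simp
    then show "(\<lambda>m. (6 * real m * half_angle_tan m)\<^sup>2 / 72 * (Re (third_quad m) / (real m)\<^sup>2)) \<longlonglongrightarrow> ln C_star / 9"
      by (simp add: power2_eq_square)
  qed (rule error_term_tendsto_0)
  then show ?thesis using C_star_pos by (simp add: powr_def)
qed

section \<open>Lower bounds for \<open>Delta_max_bar\<close> and assembly of the theorem\<close>

lemma dist_prod_le_Delta_max:
  assumes "\<And>j l. j < n \<Longrightarrow> l < n \<Longrightarrow> cmod (y j - y l) \<le> 2"
  shows "dist_prod n y \<le> Delta_max n"
  unfolding Delta_max_def
proof (rule cSup_upper[OF _ Delta_values_bdd_above])
  have "\<forall>i\<in>{1..n}. \<forall>j\<in>{1..n}. cmod (y (i - 1) - y (j - 1)) \<le> 2"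
    using assms by auto
  then show "dist_prod n y \<in> Delta_values n"
    unfolding Delta_values_def Delta_eq_dist_prod[symmetric] by (intro CollectI exI[of _ "\<lambda>i. y (i - 1)"]) simp
qed

lemma Delta_max_bar_even:
  assumes "m > 0"
  shows "dist_prod (2 * m) (\<lambda>j. pt m (3 * j)) / real (2 * m) ^ (2 * m) \<le> Delta_max_bar (2 * m)"
  unfolding Delta_max_bar_def
  by (intro divide_right_mono dist_prod_le_Delta_max pt_dist_le_2) (use assms in auto)

lemma root_grid_cis:
  assumes "n > 0"
  shows "root_grid n (\<lambda>j. cis (2 * pi * real j / real n)) 1"
  using Complex.bij_betw_roots_unity[OF assms] assms
  by unfold_locales (auto simp: bij_betw_def)

text \<open>An odd regular polygon has no antipodal vertices, so it can be enlarged by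
  \<open>R = 1 / cos (pi / (2 * n))\<close>, gaining \<open>R ^ (n * (n - 1))\<close>. From
  \<open>R \<ge> 1 + 1 / (2 * n\<^sup>2)\<close> Bernoulli's inequality gives at least
  \<open>1 + (n - 1) / (2 * n)\<close>, which is enough to exceed
  \<open>C_star powr (1 / 9)\<close>.\<close>

lemma Delta_max_bar_odd:
  assumes "odd n" "n \<ge> 3"
  shows "4 / 3 \<le> Delta_max_bar n"
proof -
  define w where "w j = cis (2 * pi * real j / real n)" for j
  interpret root_grid n w 1 unfolding w_def by (rule root_grid_cis) (use assms in simp)
  define x where "x = pi / (2 * real n)"
  define R where "R = 1 / cos x"
  have x: "0 < x" "x < pi / 2" using assms by (auto simp: x_def field_simps)
  have c: "0 < cos x" using x by (intro cos_gt_zero) auto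
  have w_dist: "cmod (w j - w l) \<le> 2 * cos x" if "j < n" "l < n" for j l
  proof -
    have aux: "sin (pi * real d / real n) \<le> cos x" "0 \<le> sin (pi * real d / real n)" if "d < n" for d
    proof -
      \<comment> \<open>Parity enters here: \<open>pi * d / n\<close> stays at least
        \<open>x\<close> away from \<open>pi / 2\<close>.\<close>
      have "2 * d \<noteq> n" using assms by auto
      define u where "u = \<bar>pi / 2 - pi * real d / real n\<bar>"
      have "1 \<le> \<bar>real n - 2 * real d\<bar>" using \<open>2 * d \<noteq> n\<close> by linarith
      then have "x * 1 \<le> x * \<bar>real n - 2 * real d\<bar>" using x by (intro mult_left_mono) auto
      also have "\<dots> = \<bar>x * (real n - 2 * real d)\<bar>" using x by (simp add: abs_mult)
      also have "x * (real n - 2 * real d) = pi / 2 - pi * real d / real n"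
        using assms by (simp add: x_def field_simps)
      finally have "x \<le> u" by (simp add: u_def)
      moreover have le: "pi * real d / real n \<le> pi" using that by (simp add: field_simps)
      moreover have "0 \<le> pi * real d / real n" by simp
      then have "u \<le> pi" using le pi_gt_zero unfolding u_def by linarith
      ultimately have "cos u \<le> cos x" using x by (intro cos_monotone_0_pi_le) auto
      then show "sin (pi * real d / real n) \<le> cos x" by (simp add: u_def sin_cos_eq)
      show "0 \<le> sin (pi * real d / real n)" using le by (intro sin_ge_zero) auto
    qed
    have "cmod (w j - w l) = 2 * \<bar>sin (pi * (real j - real l) / real n)\<bar>"
    proof -
      have "(2 * pi * real j / real n - 2 * pi * real l / real n) / 2 = pi * (real j - real l) / real n"
        by (simp add: diff_divide_distrib right_diff_distrib)
      then show ?thesis by (simp only: w_def cmod_cis_diff)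
    qed
    also have "\<bar>sin (pi * (real j - real l) / real n)\<bar> \<le> cos x"
    proof (cases "l \<le> j")
      case True
      then show ?thesis using aux[of "j - l"] that by (simp add: of_nat_diff)
    next
      case False
      then have "pi * (real j - real l) / real n = - (pi * real (l - j) / real n)"
        by (simp add: of_nat_diff minus_divide_left algebra_simps)
      then show ?thesis using aux[of "l - j"] that by simp
    qed
    finally show ?thesis by simp
  qed
  have R0: "0 < R" using c by (simp add: R_def)
  have "dist_prod n (\<lambda>j. of_real R * w j) \<le> Delta_max n"
  proof (rule dist_prod_le_Delta_max)
    fix j l assume "j < n" "l < n"
    then have "R * cmod (w j - w l) \<le> R * (2 * cos x)" using R0 w_dist by (intro mult_left_mono) auto
    also have "\<dots> = 2" using c by (simp add: R_def)
    finally show "cmod (of_real R * w j - of_real R * w l) \<le> 2"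
      using R0 by (simp add: right_diff_distrib[symmetric] norm_mult)
  qed
  moreover have "dist_prod n (\<lambda>j. of_real R * w j) = R ^ (n * (n - 1)) * real n ^ n"
  proof -
    have "dist_prod n (\<lambda>j. of_real R * w j) = (\<Prod>j<n. R ^ (n - 1) * (\<Prod>l\<in>{..<n} - {j}. cmod (w j - w l)))"
      unfolding dist_prod_def
      using R0 by (intro prod.cong refl) (simp add: right_diff_distrib[symmetric] norm_mult prod.distrib)
    also have "\<dots> = R ^ (n * (n - 1)) * dist_prod n w"
      unfolding dist_prod_def by (simp add: prod.distrib power_mult[symmetric] mult.commute)
    finally show ?thesis by (simp add: dist_prod_grid)
  qed
  ultimately have "R ^ (n * (n - 1)) * real n ^ n \<le> Delta_max n" by simp
  then have "R ^ (n * (n - 1)) \<le> Delta_max_bar n"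
    using assms by (simp add: Delta_max_bar_def pos_le_divide_eq)
  moreover have "4 / 3 \<le> R ^ (n * (n - 1))"
  proof -
    define t where "t = 1 / (2 * (real n)\<^sup>2)"
    have n2: "9 \<le> (real n)\<^sup>2" using power_mono[of 3 "real n" 2] assms by simp
    have t: "0 < t" "t < 1" using assms n2 by (auto simp: t_def divide_simps)
    have "2 * (1 / (4 * real n)) \<le> sin (pi * (1 / (4 * real n)))"
      using assms by (intro sin_ge_linear) (auto simp: field_simps)
    then have "1 / (2 * real n) \<le> sin (x / 2)" by (simp add: x_def)
    then have "(1 / (2 * real n))\<^sup>2 \<le> (sin (x / 2))\<^sup>2" by (intro power_mono) auto
    moreover have "cos x = 1 - 2 * (sin (x / 2))\<^sup>2" using cos_double_sin[of "x / 2"] by simp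
    ultimately have "cos x \<le> 1 - t" by (simp add: t_def power2_eq_square)
    moreover have "(1 + t) * (1 - t) \<le> 1" using t by (simp add: algebra_simps)
    then have "(1 + t) * cos x \<le> 1"
      using \<open>cos x \<le> 1 - t\<close> t by (meson mult_left_mono order.trans add_nonneg_nonneg zero_le_one less_imp_le)
    then have "1 + t \<le> R" using c by (simp add: R_def pos_le_divide_eq)
    then have "(1 + t) ^ (n * (n - 1)) \<le> R ^ (n * (n - 1))" using t by (intro power_mono) auto
    moreover have "1 + real (n * (n - 1)) * t \<le> (1 + t) ^ (n * (n - 1))"
      using t by (intro Bernoulli_inequality) auto
    moreover have "1 / 3 \<le> real (n * (n - 1)) * t"
    proof -
      have eq: "real (n * (n - 1)) * t = (real n - 1) / (2 * real n)"
        using assms by (simp add: t_def power2_eq_square of_nat_diff)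
      show ?thesis unfolding eq using assms by (simp add: field_simps)
    qed
    ultimately show ?thesis by linarith
  qed
  ultimately show ?thesis by linarith
qed

lemma C_star_powr_bounds: "1 < C_star powr (1 / 9)" "C_star powr (1 / 9) < 4 / 3"
proof -
  show "1 < C_star powr (1 / 9)" using C_star_bounds by (intro gr_one_powr) auto
  have "C_star powr (1 / 9) \<le> C_star powr 1" using C_star_bounds by (intro powr_mono) auto
  then show "C_star powr (1 / 9) < 4 / 3" using C_star_bounds by simp
qed

lemma liminf_Delta_max_bar: "ereal (C_star powr (1 / 9)) \<le> liminf (\<lambda>n. ereal (Delta_max_bar n))"
  unfolding le_Liminf_iff
proof (intro allI impI)
  fix e assume e: "e < ereal (C_star powr (1 / 9))"
  then obtain y where y: "e < ereal y" "y < C_star powr (1 / 9)"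
    using ereal_dense2[OF e] by auto
  have "\<forall>\<^sub>F m in sequentially. y < dist_prod (2 * m) (\<lambda>j. pt m (3 * j)) / real (2 * m) ^ (2 * m)"
    using dist_prod_third_tendsto y(2) by (rule order_tendstoD)
  then obtain M where M: "\<And>m. m \<ge> M \<Longrightarrow> y < dist_prod (2 * m) (\<lambda>j. pt m (3 * j)) / real (2 * m) ^ (2 * m)"
    by (auto simp: eventually_sequentially)
  show "\<forall>\<^sub>F n in sequentially. e < ereal (Delta_max_bar n)"
    unfolding eventually_sequentially
  \<comment> \<open>An even \<open>n = 2 * m\<close> beyond this bound has \<open>m \<ge> M\<close>
    and \<open>m > 0\<close>, and an odd one has \<open>n \<ge> 3\<close>.\<close>
  proof (intro exI[of _ "2 * M + 3"] allI impI)
    fix n assume n: "2 * M + 3 \<le> n"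
    have "y < Delta_max_bar n"
    proof (cases "even n")
      case True
      then obtain m where m: "n = 2 * m" by blast
      then show ?thesis using M[of m] Delta_max_bar_even[of m] n by simp
    next
      case False
      then show ?thesis using Delta_max_bar_odd[of n] n y(2) C_star_powr_bounds(2) by simp
    qed
    then show "e < ereal (Delta_max_bar n)" using y(1) by (meson less_ereal.simps(1) less_trans)
  qed
qed

lemma dist_prod_nonzero_imp_inj:
  assumes "dist_prod n y \<noteq> 0"
  shows "inj_on y {..<n}"
proof (rule inj_onI, rule ccontr)
  fix j l assume jl: "j \<in> {..<n}" "l \<in> {..<n}" "y j = y l" "j \<noteq> l"
  then have "(\<Prod>l\<in>{..<n} - {j}. cmod (y j - y l)) = 0"
    by (intro prod_zero) auto
  then have "dist_prod n y = 0" unfolding dist_prod_def using jl by (intro prod_zero) auto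
  then show False using assms by simp
qed

text \<open>For the finitely many \<open>n\<close> where the points of \<open>pt\<close> might coincide, any
  small configuration will do.\<close>

definition config :: "nat \<Rightarrow> nat \<Rightarrow> complex" where
  "config n = (if n > 0 \<and> inj_on (pt (n div 6)) {..<n} then (\<lambda>i. pt (n div 6) (i - 1))
     else (\<lambda>i. of_real (real i / real n)))"

lemma config_valid:
  assumes "6 dvd n"
  shows "inj_on (config n) {1..n}" "diameter (config n ` {1..n}) \<le> 2"
proof -
  show "inj_on (config n) {1..n}"
  proof (cases "n > 0 \<and> inj_on (pt (n div 6)) {..<n}")
    case True
    show ?thesis
    proof (rule inj_onI)
      fix i j assume ij: "i \<in> {1..n}" "j \<in> {1..n}" "config n i = config n j"
      then have "pt (n div 6) (i - 1) = pt (n div 6) (j - 1)" using True by (simp add: config_def)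
      then have "i - 1 = j - 1" using True ij by (auto elim!: inj_onD)
      then show "i = j" using ij by auto
    qed
  next
    case False
    then show ?thesis by (auto simp: config_def inj_on_def)
  qed
  show "diameter (config n ` {1..n}) \<le> 2"
  proof (rule diameter_le)
    fix x y assume "x \<in> config n ` {1..n}" "y \<in> config n ` {1..n}"
    then obtain i j where ij: "i \<in> {1..n}" "j \<in> {1..n}" "x = config n i" "y = config n j" by auto
    show "norm (x - y) \<le> 2"
    proof (cases "n > 0 \<and> inj_on (pt (n div 6)) {..<n}")
      case True
      then have "n div 6 > 0" "6 * (n div 6) = n" using assms by (auto simp: dvd_imp_le)
      then show ?thesis using pt_dist_le_2[of "n div 6" "i - 1" "j - 1"] ij True by (auto simp: config_def)
    next
      case False
      have "\<bar>real i / real n - real j / real n\<bar> \<le> 1"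
        using ij by (auto simp: diff_divide_distrib[symmetric] abs_le_iff divide_simps)
      moreover have "x - y = of_real (real i / real n - real j / real n)"
        using False ij by (auto simp: config_def)
      ultimately show ?thesis by (simp only: norm_of_real)
    qed
  qed simp
qed

lemma Delta_config_tendsto:
  "(\<lambda>m. Delta (6 * m) (config (6 * m)) / real (6 * m) ^ (6 * m)) \<longlonglongrightarrow> C_star"
proof (rule Lim_transform_eventually[OF dist_prod_pt_tendsto])
  have "\<forall>\<^sub>F m in sequentially. 0 < dist_prod (6 * m) (pt m) / real (6 * m) ^ (6 * m)"
    using dist_prod_pt_tendsto C_star_pos by (rule order_tendstoD)
  then show "\<forall>\<^sub>F m in sequentially. dist_prod (6 * m) (pt m) / real (6 * m) ^ (6 * m)
      = Delta (6 * m) (config (6 * m)) / real (6 * m) ^ (6 * m)"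
    using eventually_gt_at_top[of 0]
  proof eventually_elim
    case (elim m)
    \<comment> \<open>The positive limit makes the product eventually nonzero, so the points are
      distinct and \<open>config\<close> takes its first branch.\<close>
    then have "inj_on (pt m) {..<6 * m}" by (intro dist_prod_nonzero_imp_inj) auto
    then have cfg: "config (6 * m) = (\<lambda>i. pt m (i - 1))" using elim by (simp add: config_def)
    show ?case by (simp only: cfg Delta_eq_dist_prod)
  qed
qed

theorem theorem1p2:
  shows "(\<exists>z :: nat \<Rightarrow> nat \<Rightarrow> complex.
           (\<forall>n. 6 dvd n \<longrightarrow> inj_on (z n) {1..n} \<and> diameter (z n ` {1..n}) \<le> 2) \<and>
           (\<lambda>m. Delta (6 * m) (z (6 * m)) / real (6 * m) ^ (6 * m)) \<longlonglongrightarrow> C_star)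
       \<and> \<bar>C_star - 1.304457\<bar> \<le> 5 / 10 ^ 7
       \<and> liminf (\<lambda>n. ereal (Delta_max_bar n)) \<ge> ereal (C_star powr (1 / 9))
       \<and> C_star powr (1 / 9) > 1"
proof (intro conjI exI[of _ config] allI impI)
  show "\<bar>C_star - 1.304457\<bar> \<le> 5 / 10 ^ 7"
    unfolding abs_le_iff using C_star_bounds by simp
qed (use config_valid Delta_config_tendsto liminf_Delta_max_bar C_star_powr_bounds in auto)

end
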